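(* Let $G$ be a second countable locally compact abelian group, let $\Delta$ be a closed subgroup of $G\times\widehat{G}$, and let $g\in L^2(G)$. Then $\{\pi(\nu)g\}_{\nu\in\Delta}$ is a total Riesz family for $L^2(G)$ if, and only if, $\Delta$ is a uniform lattice, $\mathrm{d}(\Delta)=1$, and $\{\pi(\nu)g\}_{\nu\in\Delta}$ is a frame for $L^2(G)$.
   Context: $G$ is written multiplicatively and carries a fixed Haar measure; the dual group $\widehat{G}$ carries the dual Haar measure (so that the Plancherel theorem holds), and $G\times\widehat{G}$ the product measure. For $\lambda\in G$, $\gamma\in\widehat{G}$, the operators on $L^2(G)$ are $(T_\lambda f)(x)=f(x\lambda^{-1})$, $(E_\gamma f)(x)=\gamma(x)f(x)$, and $\pi(\nu)=E_\gamma T_\lambda$ for $\nu=(\lambda,\gamma)\in G\times\widehat{G}$. The closed subgroup $\Delta$ carries a fixed Haar measure $d\nu$, and $(G\times\widehat{G})/\Delta$ carries the unique Haar measure $d\dot\chi$ for which Weil's formula $\int_{G\times\widehat{G}}f(\chi)\,d\chi=\int_{(G\times\widehat{G})/\Delta}\int_\Delta f(\chi\nu)\,d\nu\,d\dot\chi$ holds for all $f\in L^1(G\times\widehat{G})$. The size of $\Delta$ is $\mathrm{d}(\Delta):=\int_{(G\times\widehat{G})/\Delta}1\,d\dot\chi\in(0,\infty]$. A uniform lattice is a discrete, co-compact subgroup. The system $\{\pi(\nu)g\}_{\nu\in\Delta}$ is a frame for $L^2(G)$ if there are constants $0<A\le B<\infty$ with $A\|f\|^2\le\int_\Delta|\langle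 f,\pi(\nu)g\rangle|^2\,d\nu\le B\|f\|^2$ for all $f\in L^2(G)$. It is a total Riesz family for $L^2(G)$ if it is a frame for $L^2(G)$ and the analysis operator $L^2(G)\to L^2(\Delta)$, $f\mapsto(\nu\mapsto\langle f,\pi(\nu)g\rangle)$, has dense range (equivalently, is surjective).
   Formalization: If Δ is discrete, its Haar measure is taken to be counting measure; with an arbitrary Haar measure the claim fails (G=ℝ, Δ=aℤ×bℤ, ab=1/2, half the counting measure: d(Δ)=1 and a Gaussian gives an overcomplete frame). *)

theory Defs
  imports "HOL-Analysis.Analysis" "HOL-Algebra.Coset"
begin

section \<open>Locally compact abelian groups\<close>

text \<open>
  A group is an HOL-Algebra record together with an abstract topology on its carrier, so that
  \<open>G\<close>, its dual, their product, closed subgroups and quotients are objects of the same kind.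
\<close>

locale topological_comm_group = comm_group G for G :: "('a, 'm) monoid_scheme" (structure) +
  fixes T :: "'a topology"
  assumes topspace_carrier: "topspace T = carrier G"
    and continuous_mult: "continuous_map (prod_topology T T) T (\<lambda>(x, y). x \<otimes> y)"
    and continuous_inv: "continuous_map T T (\<lambda>x. inv x)"

locale lca_group = topological_comm_group +
  assumes Hausdorff: "Hausdorff_space T"
    and locally_compact: "locally_compact_space T"

definition quotient_topology ::
    "('a, 'm) monoid_scheme \<Rightarrow> 'a topology \<Rightarrow> 'a set \<Rightarrow> 'a set topology" where
  "quotient_topology G T H =
     topology (\<lambda>\<U>. \<U> \<subseteq> carrier (G Mod H) \<and> openin T {x \<in> topspace T. H #>\<^bsub>G\<^esub> x \<in> \<U>})"

lemma openin_quotient_topology: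
  "openin (quotient_topology G T H) \<U> \<longleftrightarrow>
     \<U> \<subseteq> carrier (G Mod H) \<and> openin T {x \<in> topspace T. H #>\<^bsub>G\<^esub> x \<in> \<U>}"
proof -
  let ?p = "\<lambda>\<U>. {x \<in> topspace T. H #>\<^bsub>G\<^esub> x \<in> \<U>}"
  have "istopology (\<lambda>\<U>. \<U> \<subseteq> carrier (G Mod H) \<and> openin T (?p \<U>))"
    unfolding istopology_def
  proof (intro conjI allI impI)
    fix \<U> \<V>
    assume "\<U> \<subseteq> carrier (G Mod H) \<and> openin T (?p \<U>)"
      and "\<V> \<subseteq> carrier (G Mod H) \<and> openin T (?p \<V>)"
    moreover have "?p (\<U> \<inter> \<V>) = ?p \<U> \<inter> ?p \<V>" by auto
    ultimately show "\<U> \<inter> \<V> \<subseteq> carrier (G Mod H)" "openin T (?p (\<U> \<inter> \<V>))"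
      by (auto intro: openin_Int)
  next
    fix \<K>
    assume *: "\<forall>K\<in>\<K>. K \<subseteq> carrier (G Mod H) \<and> openin T (?p K)"
    have "?p (\<Union>\<K>) = (\<Union>K\<in>\<K>. ?p K)" by auto
    with * show "\<Union>\<K> \<subseteq> carrier (G Mod H)" "openin T (?p (\<Union>\<K>))"
      by (auto intro!: openin_Union)
  qed
  then show ?thesis by (simp add: quotient_topology_def)
qed

lemma (in topological_comm_group) quotient_map_quotient_topology:
  "quotient_map T (quotient_topology G T H) (\<lambda>x. H #> x)"
proof -
  have carr: "carrier (G Mod H) = (\<lambda>x. H #> x) ` topspace T"
    by (auto simp: FactGroup_def RCOSETS_def topspace_carrier)
  have "{x \<in> topspace T. H #> x \<in> carrier (G Mod H)} = topspace T"
    by (auto simp: carr)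
  then have "openin (quotient_topology G T H) (carrier (G Mod H))"
    by (simp add: openin_quotient_topology)
  then have "topspace (quotient_topology G T H) = carrier (G Mod H)"
    by (meson openin_quotient_topology openin_subset openin_topspace subset_antisym)
  then show ?thesis
    by (simp add: quotient_map_def carr openin_quotient_topology)
qed

text \<open>A uniform lattice: a discrete subgroup with compact quotient.\<close>

definition uniform_lattice ::
    "('a, 'm) monoid_scheme \<Rightarrow> 'a topology \<Rightarrow> 'a set \<Rightarrow> bool" where
  "uniform_lattice G T H \<longleftrightarrow>
     subgroup H G \<and> subtopology T H = discrete_topology H \<and>
     compact_space (quotient_topology G T H)"

section \<open>The dual group\<close>

text \<open>
  Characters are made extensional (\<open>undefined\<close> off the carrier), so that equality
  of functions is equality of characters.
\<close>

definition dual_group ::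
    "('a, 'm) monoid_scheme \<Rightarrow> 'a topology \<Rightarrow> ('a \<Rightarrow> complex) monoid" where
  "dual_group G T =
     \<lparr>carrier = {\<gamma> \<in> carrier G \<rightarrow>\<^sub>E sphere 0 1. continuous_map T euclidean \<gamma> \<and>
        (\<forall>x\<in>carrier G. \<forall>y\<in>carrier G. \<gamma> (x \<otimes>\<^bsub>G\<^esub> y) = \<gamma> x * \<gamma> y)},
      mult = (\<lambda>\<gamma> \<delta>. \<lambda>x\<in>carrier G. \<gamma> x * \<delta> x),
      one = (\<lambda>x\<in>carrier G. 1)\<rparr>"

text \<open>The compact-open topology.\<close>

definition dual_topology ::
    "('a, 'm) monoid_scheme \<Rightarrow> 'a topology \<Rightarrow> ('a \<Rightarrow> complex) topology" where
  "dual_topology G T =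
     topology_generated_by
       {{\<gamma> \<in> carrier (dual_group G T). \<gamma> ` K \<subseteq> U} | K U. compactin T K \<and> open U}"

lemma topspace_dual_topology: "topspace (dual_topology G T) = carrier (dual_group G T)"
proof -
  let ?S = "{{\<gamma> \<in> carrier (dual_group G T). \<gamma> ` K \<subseteq> U} | K U. compactin T K \<and> open U}"
  have "{\<gamma> \<in> carrier (dual_group G T). \<gamma> ` {} \<subseteq> UNIV} \<in> ?S"
    using compactin_empty open_UNIV by blast
  then have "\<Union> ?S = carrier (dual_group G T)" by auto
  then show ?thesis by (simp add: dual_topology_def)
qed

lemma (in topological_comm_group) comm_group_dual_group: "comm_group (dual_group G T)"
proof (rule comm_groupI)
  fix \<gamma> \<delta> assume \<gamma>: "\<gamma> \<in> carrier (dual_group G T)" and \<delta>: "\<delta> \<in> carrier (dual_group G T)"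
  have "continuous_map T euclidean (\<lambda>x. \<gamma> x * \<delta> x)"
    using \<gamma> \<delta> by (auto simp: dual_group_def continuous_map_atin intro!: tendsto_mult)
  then have "continuous_map T euclidean (\<lambda>x\<in>carrier G. \<gamma> x * \<delta> x)"
    by (rule continuous_map_eq) (simp add: topspace_carrier)
  then show "\<gamma> \<otimes>\<^bsub>dual_group G T\<^esub> \<delta> \<in> carrier (dual_group G T)"
    using \<gamma> \<delta> by (auto simp: dual_group_def PiE_iff norm_mult)
next
  have "continuous_map T euclidean (\<lambda>x\<in>carrier G. 1::complex)"
    by (rule continuous_map_eq[where f = "\<lambda>_. 1"]) (simp_all add: topspace_carrier)
  then show "\<one>\<^bsub>dual_group G T\<^esub> \<in> carrier (dual_group G T)"
    by (auto simp: dual_group_def)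
next
  fix \<gamma> assume \<gamma>: "\<gamma> \<in> carrier (dual_group G T)"
  then show "\<one>\<^bsub>dual_group G T\<^esub> \<otimes>\<^bsub>dual_group G T\<^esub> \<gamma> = \<gamma>"
    by (auto simp: dual_group_def PiE_iff extensional_def fun_eq_iff restrict_def)
  let ?\<delta> = "\<lambda>x\<in>carrier G. cnj (\<gamma> x)"
  have cnj_mult: "cnj z * z = 1" if "cmod z = 1" for z
    using that complex_norm_square[of z] by (simp add: mult.commute)
  have "continuous_map T euclidean (\<lambda>x. cnj (\<gamma> x))"
    using \<gamma> continuous_map_compose[of T euclidean \<gamma> euclidean cnj]
    by (auto simp: dual_group_def o_def intro!: continuous_intros)
  then have "continuous_map T euclidean ?\<delta>"
    by (rule continuous_map_eq) (simp add: topspace_carrier)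
  then have "?\<delta> \<in> carrier (dual_group G T)"
    using \<gamma> by (auto simp: dual_group_def PiE_iff)
  moreover have "?\<delta> \<otimes>\<^bsub>dual_group G T\<^esub> \<gamma> = \<one>\<^bsub>dual_group G T\<^esub>"
    using \<gamma> cnj_mult by (auto simp: dual_group_def PiE_iff fun_eq_iff restrict_def)
  ultimately show "\<exists>\<delta>\<in>carrier (dual_group G T). \<delta> \<otimes>\<^bsub>dual_group G T\<^esub> \<gamma> = \<one>\<^bsub>dual_group G T\<^esub>"
    by blast
qed (auto simp: dual_group_def fun_eq_iff restrict_def mult_ac)

section \<open>Haar measures\<close>

definition borel_of :: "'a topology \<Rightarrow> 'a measure" where
  "borel_of T = sigma (topspace T) {U. openin T U}"

text \<open>A Haar measure: a nonzero translation-invariant Radon measure on the Borel sets.\<close>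

definition haar_measure ::
    "('a, 'm) monoid_scheme \<Rightarrow> 'a topology \<Rightarrow> 'a measure \<Rightarrow> bool" where
  "haar_measure G T M \<longleftrightarrow>
     sets M = sets (borel_of T) \<and>
     emeasure M (space M) \<noteq> 0 \<and>
     (\<forall>x\<in>carrier G. \<forall>A\<in>sets M. emeasure M ((\<lambda>y. x \<otimes>\<^bsub>G\<^esub> y) ` A) = emeasure M A) \<and>
     (\<forall>K. compactin T K \<longrightarrow> emeasure M K < \<infinity>) \<and>
     (\<forall>A\<in>sets M. emeasure M A = (INF U\<in>{U. openin T U \<and> A \<subseteq> U}. emeasure M U)) \<and>
     (\<forall>U. openin T U \<longrightarrow> emeasure M U = (SUP K\<in>{K. compactin T K \<and> K \<subseteq> U}. emeasure M K))"

text \<open>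
  Square-integrable functions are not identified when they agree almost everywhere; every notion
  below depends only on almost-everywhere classes.
\<close>

definition L2_space :: "'a measure \<Rightarrow> ('a \<Rightarrow> complex) set" where
  "L2_space M = {f \<in> borel_measurable M. integrable M (\<lambda>x. (cmod (f x))\<^sup>2)}"

definition L2_inner :: "'a measure \<Rightarrow> ('a \<Rightarrow> complex) \<Rightarrow> ('a \<Rightarrow> complex) \<Rightarrow> complex" where
  "L2_inner M f g = (\<integral>x. f x * cnj (g x) \<partial>M)"

definition L2_norm :: "'a measure \<Rightarrow> ('a \<Rightarrow> complex) \<Rightarrow> real" where
  "L2_norm M f = sqrt (\<integral>x. (cmod (f x))\<^sup>2 \<partial>M)"

definition fourier_transform ::
    "'a measure \<Rightarrow> ('a \<Rightarrow> complex) \<Rightarrow> ('a \<Rightarrow> complex) \<Rightarrow> complex" where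
  "fourier_transform M f \<gamma> = (\<integral>x. f x * cnj (\<gamma> x) \<partial>M)"

text \<open>
  The Haar measure on the dual group that is dual to \<open>M\<close>: the one normalised so that the
  Fourier transform is isometric from \<open>L\<^sup>1 \<inter> L\<^sup>2\<close> into \<open>L\<^sup>2\<close>.
\<close>

definition dual_haar_measure ::
    "('a, 'm) monoid_scheme \<Rightarrow> 'a topology \<Rightarrow> 'a measure \<Rightarrow> ('a \<Rightarrow> complex) measure \<Rightarrow> bool" where
  "dual_haar_measure G T M M' \<longleftrightarrow>
     haar_measure (dual_group G T) (dual_topology G T) M' \<and>
     (\<forall>f. integrable M f \<and> f \<in> L2_space M \<longrightarrow>
        fourier_transform M f \<in> L2_space M' \<and>
        L2_norm M' (fourier_transform M f) = L2_norm M f)"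

text \<open>
  The Haar measure \<open>Q\<close> on the quotient by \<open>H\<close> given by Weil's formula, relative to
  the measures \<open>M\<close> on the group and \<open>D\<close> on \<open>H\<close>. By invariance of \<open>D\<close>, the inner integral
  takes a single value as \<open>x\<close> ranges over a coset \<open>C\<close>; \<open>the_elem\<close> extracts it.
\<close>

definition quotient_haar_measure ::
    "('a, 'm) monoid_scheme \<Rightarrow> 'a topology \<Rightarrow> 'a set \<Rightarrow> 'a measure \<Rightarrow> 'a measure \<Rightarrow>
     'a set measure \<Rightarrow> bool" where
  "quotient_haar_measure G T H M D Q \<longleftrightarrow>
     haar_measure (G Mod H) (quotient_topology G T H) Q \<and>
     (\<forall>f :: 'a \<Rightarrow> complex. integrable M f \<longrightarrow>
        (\<integral>x. f x \<partial>M) = (\<integral>C. the_elem ((\<lambda>x. \<integral>h. f (x \<otimes>\<^bsub>G\<^esub> h) \<partial>D) ` C) \<partial>Q))"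

text \<open>
  The size of a subgroup, in terms of the measure \<open>Q\<close> on the quotient. Scaling the Haar measure on
  the subgroup scales the size inversely, so a statement about size 1 presupposes a normalisation:
  the usual one is that a discrete subgroup carries counting measure.
\<close>

definition subgroup_size :: "'a set measure \<Rightarrow> ennreal" where
  "subgroup_size Q = (\<integral>\<^sup>+ C. 1 \<partial>Q)"

section \<open>Gabor systems\<close>

definition translation ::
    "('a, 'm) monoid_scheme \<Rightarrow> 'a \<Rightarrow> ('a \<Rightarrow> complex) \<Rightarrow> 'a \<Rightarrow> complex" where
  "translation G l f x = f (x \<otimes>\<^bsub>G\<^esub> inv\<^bsub>G\<^esub> l)"

definition modulation :: "('a \<Rightarrow> complex) \<Rightarrow> ('a \<Rightarrow> complex) \<Rightarrow> 'a \<Rightarrow> complex" where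
  "modulation \<gamma> f x = \<gamma> x * f x"

definition time_frequency_shift ::
    "('a, 'm) monoid_scheme \<Rightarrow> 'a \<times> ('a \<Rightarrow> complex) \<Rightarrow> ('a \<Rightarrow> complex) \<Rightarrow> 'a \<Rightarrow> complex" where
  "time_frequency_shift G \<nu> f = modulation (snd \<nu>) (translation G (fst \<nu>) f)"

definition gabor_analysis ::
    "('a, 'm) monoid_scheme \<Rightarrow> 'a measure \<Rightarrow> ('a \<Rightarrow> complex) \<Rightarrow> ('a \<Rightarrow> complex) \<Rightarrow>
     'a \<times> ('a \<Rightarrow> complex) \<Rightarrow> complex" where
  "gabor_analysis G M g f \<nu> = L2_inner M f (time_frequency_shift G \<nu> g)"

text \<open>
  Below, \<open>M\<close> is the Haar measure on \<open>G\<close> and \<open>D\<close> the Haar measure on the subgroup indexing the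
  system, which enters as the space of \<open>D\<close>.
\<close>

definition gabor_frame ::
    "('a, 'm) monoid_scheme \<Rightarrow> 'a measure \<Rightarrow> ('a \<times> ('a \<Rightarrow> complex)) measure \<Rightarrow>
     ('a \<Rightarrow> complex) \<Rightarrow> bool" where
  "gabor_frame G M D g \<longleftrightarrow>
     (\<exists>A B :: real. 0 < A \<and> A \<le> B \<and>
        (\<forall>f\<in>L2_space M.
           ennreal (A * (L2_norm M f)\<^sup>2) \<le> (\<integral>\<^sup>+ \<nu>. ennreal ((cmod (gabor_analysis G M g f \<nu>))\<^sup>2) \<partial>D) \<and>
           (\<integral>\<^sup>+ \<nu>. ennreal ((cmod (gabor_analysis G M g f \<nu>))\<^sup>2) \<partial>D) \<le> ennreal (B * (L2_norm M f)\<^sup>2)))"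

text \<open>The second conjunct says that the analysis operator has dense range.\<close>

definition gabor_total_riesz_family ::
    "('a, 'm) monoid_scheme \<Rightarrow> 'a measure \<Rightarrow> ('a \<times> ('a \<Rightarrow> complex)) measure \<Rightarrow>
     ('a \<Rightarrow> complex) \<Rightarrow> bool" where
  "gabor_total_riesz_family G M D g \<longleftrightarrow>
     gabor_frame G M D g \<and>
     (\<forall>c\<in>L2_space D. \<forall>e>0. \<exists>f\<in>L2_space M. L2_norm D (\<lambda>\<nu>. gabor_analysis G M g f \<nu> - c \<nu>) < e)"

end

theory Submission
  imports Defs
begin

text \<open>
  Write \<open>C f = (\<langle>f, \<pi>(\<nu>) g\<rangle>)\<^sub>\<nu>\<close> for the analysis operator of the system generated by \<open>g\<close>. The heart of the
  matter is a formula for the size of \<open>\<Delta>\<close>. Suppose that \<open>\<Delta>\<close> is discrete and the system is a frame, and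
  let \<open>h\<close> be the canonical dual window, the preimage of \<open>g\<close> under the frame operator
  (\<open>frame_operator_surj\<close>). The frame operator commutes with the shifts from \<open>\<Delta>\<close>, whence
  \<open>\<Sum>\<^sub>\<nu> \<langle>f, \<pi>(\<nu>) g\<rangle> \<langle>\<pi>(\<nu>) h, f\<rangle> = \<parallel>f\<parallel>\<^sup>2\<close> for all \<open>f\<close>. Applied to the shifted functions \<open>\<pi>(\<xi>)\<^sup>* f\<close>, this
  says that the sum of \<open>\<langle>f, \<pi>(\<xi>) g\<rangle> \<langle>\<pi>(\<xi>) h, f\<rangle>\<close> over any coset of \<open>\<Delta>\<close> is \<open>\<parallel>f\<parallel>\<^sup>2\<close>. By Weil's formula,
  the integral of that function over the time-frequency plane is therefore \<open>\<parallel>f\<parallel>\<^sup>2\<close> times the measure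
  of the quotient, while the orthogonality relations (\<open>stft_orthogonality\<close>) evaluate it as
  \<open>\<parallel>f\<parallel>\<^sup>2 \<langle>h, g\<rangle>\<close>. So \<open>\<langle>h, g\<rangle>\<close> is the size of \<open>\<Delta>\<close> (\<open>L2_inner_dual_window\<close>).

  On the other hand \<open>\<langle>h, g\<rangle> = 1\<close> characterises total Riesz families. By definition of \<open>h\<close> we have
  \<open>\<langle>C h, C w\<rangle> = \<langle>g, w\<rangle>\<close> for all \<open>w\<close>, and the value of \<open>C h\<close> at the unit is \<open>\<langle>h, g\<rangle>\<close>. If \<open>\<langle>h, g\<rangle> = 1\<close>, then
  \<open>\<parallel>C h\<parallel>\<^sup>2 = \<langle>g, h\<rangle> = 1\<close> is exhausted by that one value, so that \<open>C h\<close> is the unit sequence at the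
  neutral element; shifting \<open>h\<close> gives all unit sequences, and the range of \<open>C\<close> is dense. Conversely
  \<open>C h\<close> minus the unit sequence is orthogonal to the range of \<open>C\<close>, hence \<open>0\<close> if the range is dense.

  It remains to see that a total Riesz family forces \<open>\<Delta>\<close> to be a uniform lattice. The values of \<open>C f\<close>
  are bounded by a constant times \<open>\<parallel>C f\<parallel>\<close>, so functions \<open>C f\<close> cannot approximate the indicator of a set
  of small positive measure; hence points have positive measure and \<open>\<Delta>\<close> is discrete
  (\<open>total_riesz_imp_discrete\<close>). The quotient then has Haar measure \<open>1\<close>, and a topological group of finite
  Haar measure is compact (\<open>compact_space_if_finite_haar_measure\<close>).
\<close>

section \<open>The Hilbert space of square-integrable functions\<close>

lemma borel_measurable_cnj [measurable]:
  "f \<in> borel_measurable M \<Longrightarrow> (\<lambda>x. cnj (f x)) \<in> borel_measurable M"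
  by (rule measurable_compose[where g = cnj])
    (auto intro!: borel_measurable_continuous_onI continuous_intros)

lemma L2_space_measurable [measurable_dest]: "f \<in> L2_space M \<Longrightarrow> f \<in> borel_measurable M"
  by (simp add: L2_space_def)

lemma L2_space_integrable_square:
  "f \<in> L2_space M \<Longrightarrow> integrable M (\<lambda>x. (cmod (f x))\<^sup>2)"
  by (simp add: L2_space_def)

lemma L2_norm_nonneg [simp]: "0 \<le> L2_norm M f"
  by (simp add: L2_norm_def)

lemma L2_norm_square: "(L2_norm M f)\<^sup>2 = (\<integral>x. (cmod (f x))\<^sup>2 \<partial>M)"
  by (simp add: L2_norm_def)

lemma nn_integral_L2_norm:
  assumes "f \<in> L2_space M"
  shows "(\<integral>\<^sup>+x. ennreal ((cmod (f x))\<^sup>2) \<partial>M) = ennreal ((L2_norm M f)\<^sup>2)"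
  using assms by (simp add: L2_norm_square L2_space_def nn_integral_eq_integral)

lemma L2_space_iff_nn_integral:
  "f \<in> L2_space M \<longleftrightarrow>
     f \<in> borel_measurable M \<and> (\<integral>\<^sup>+x. ennreal ((cmod (f x))\<^sup>2) \<partial>M) < \<infinity>"
proof -
  have "(\<lambda>x. (cmod (f x))\<^sup>2) \<in> borel_measurable M" if "f \<in> borel_measurable M"
    using that by measurable
  then show ?thesis
    by (auto simp: L2_space_def integrable_iff_bounded)
qed

lemma L2_space_cong:
  "(\<And>x. x \<in> space M \<Longrightarrow> f x = g x) \<Longrightarrow> f \<in> L2_space M \<longleftrightarrow> g \<in> L2_space M"
  unfolding L2_space_iff_nn_integral
  by (intro arg_cong2[where f = "(\<and>)"] measurable_cong arg_cong2[where f = "(<)"] nn_integral_cong) auto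

lemma L2_norm_cong: "(\<And>x. x \<in> space M \<Longrightarrow> f x = g x) \<Longrightarrow> L2_norm M f = L2_norm M g"
  unfolding L2_norm_def by (intro arg_cong[where f = sqrt] Bochner_Integration.integral_cong) auto

lemma L2_inner_cong:
  "(\<And>x. x \<in> space M \<Longrightarrow> f x = f' x) \<Longrightarrow> (\<And>x. x \<in> space M \<Longrightarrow> g x = g' x) \<Longrightarrow>
    L2_inner M f g = L2_inner M f' g'"
  unfolding L2_inner_def by (intro Bochner_Integration.integral_cong) auto

lemma L2_space_zero [simp]: "(\<lambda>x. 0) \<in> L2_space M"
  by (simp add: L2_space_def)

lemma L2_space_add_mult:
  assumes [measurable]: "f \<in> L2_space M" "g \<in> L2_space M"
  shows "(\<lambda>x. f x + c * g x) \<in> L2_space M"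
proof -
  have "integrable M (\<lambda>x. 2 * (cmod (f x))\<^sup>2 + 2 * (cmod c)\<^sup>2 * (cmod (g x))\<^sup>2)"
    using assms[THEN L2_space_integrable_square] by (intro Bochner_Integration.integrable_add) simp_all
  then have "integrable M (\<lambda>x. (cmod (f x + c * g x))\<^sup>2)"
  proof (rule Bochner_Integration.integrable_bound)
    show "AE x in M. norm ((cmod (f x + c * g x))\<^sup>2)
        \<le> norm (2 * (cmod (f x))\<^sup>2 + 2 * (cmod c)\<^sup>2 * (cmod (g x))\<^sup>2)"
    proof (rule AE_I2)
      fix x
      have "(cmod (f x + c * g x))\<^sup>2 \<le> (cmod (f x) + cmod c * cmod (g x))\<^sup>2"
        by (intro power_mono) (auto intro: norm_triangle_le simp: norm_mult)
      also have "\<dots> \<le> 2 * (cmod (f x))\<^sup>2 + 2 * (cmod c * cmod (g x))\<^sup>2"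
        using sum_squares_bound[of "cmod (f x)" "cmod c * cmod (g x)"] by (simp add: power2_sum)
      finally show "norm ((cmod (f x + c * g x))\<^sup>2)
          \<le> norm (2 * (cmod (f x))\<^sup>2 + 2 * (cmod c)\<^sup>2 * (cmod (g x))\<^sup>2)"
        by (simp add: power_mult_distrib mult.assoc)
    qed
  qed measurable
  then show ?thesis by (simp add: L2_space_def)
qed

lemma L2_space_diff:
  "f \<in> L2_space M \<Longrightarrow> g \<in> L2_space M \<Longrightarrow> (\<lambda>x. f x - g x) \<in> L2_space M"
  using L2_space_add_mult[of f M g "-1"] by simp

lemma L2_space_sum:
  assumes "finite I" and "\<And>i. i \<in> I \<Longrightarrow> f i \<in> L2_space M"
  shows "(\<lambda>x. \<Sum>i\<in>I. c i * f i x) \<in> L2_space M"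
  using assms
proof (induction I rule: finite_induct)
  case (insert i I)
  then show ?case
    using L2_space_add_mult[of "\<lambda>x. \<Sum>i\<in>I. c i * f i x" M "f i" "c i"] by (simp add: add.commute)
qed simp

lemma L2_mult_integrable:
  assumes [measurable]: "f \<in> L2_space M" "g \<in> L2_space M"
  shows "integrable M (\<lambda>x. f x * cnj (g x))"
proof (rule Bochner_Integration.integrable_bound)
  show "integrable M (\<lambda>x. (cmod (f x))\<^sup>2 + (cmod (g x))\<^sup>2)"
    using assms[THEN L2_space_integrable_square] by simp
  have "2 * (cmod (f x) * cmod (g x)) \<le> (cmod (f x))\<^sup>2 + (cmod (g x))\<^sup>2" for x
    using sum_squares_bound[of "cmod (f x)" "cmod (g x)"] by (simp add: mult.assoc)
  moreover have "0 \<le> cmod (f x) * cmod (g x)" for x by simp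
  ultimately have "cmod (f x) * cmod (g x) \<le> (cmod (f x))\<^sup>2 + (cmod (g x))\<^sup>2" for x
    by (smt (verit))
  then show "AE x in M. norm (f x * cnj (g x)) \<le> norm ((cmod (f x))\<^sup>2 + (cmod (g x))\<^sup>2)"
    by (intro AE_I2) (simp add: norm_mult)
qed measurable

lemma L2_inner_commute: "L2_inner M g f = cnj (L2_inner M f g)"
proof -
  have "(\<integral>x. g x * cnj (f x) \<partial>M) = (\<integral>x. cnj (f x * cnj (g x)) \<partial>M)"
    by (intro Bochner_Integration.integral_cong) (auto simp: mult.commute)
  then show ?thesis unfolding L2_inner_def by (simp only: Bochner_Integration.integral_cnj)
qed

lemma L2_inner_add_mult_left:
  assumes "f \<in> L2_space M" "g \<in> L2_space M" "h \<in> L2_space M"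
  shows "L2_inner M (\<lambda>x. f x + c * g x) h = L2_inner M f h + c * L2_inner M g h"
proof -
  have "L2_inner M (\<lambda>x. f x + c * g x) h = (\<integral>x. f x * cnj (h x) + c * (g x * cnj (h x)) \<partial>M)"
    unfolding L2_inner_def by (intro Bochner_Integration.integral_cong) (auto simp: algebra_simps)
  also have "\<dots> = L2_inner M f h + c * L2_inner M g h"
    using L2_mult_integrable[of f M h] L2_mult_integrable[of g M h] assms
    by (simp add: L2_inner_def)
  finally show ?thesis .
qed

lemma L2_inner_add_mult_right:
  assumes "f \<in> L2_space M" "g \<in> L2_space M" "h \<in> L2_space M"
  shows "L2_inner M h (\<lambda>x. f x + c * g x) = L2_inner M h f + cnj c * L2_inner M h g"
  using L2_inner_add_mult_left[OF assms, of c]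
  by (subst (1 2 3) L2_inner_commute) simp

lemma L2_inner_mult_left: "L2_inner M (\<lambda>x. c * f x) h = c * L2_inner M f h"
  by (simp add: L2_inner_def mult.assoc)

lemma L2_inner_mult_right: "L2_inner M h (\<lambda>x. c * f x) = cnj c * L2_inner M h f"
  by (subst (1 2) L2_inner_commute) (simp add: L2_inner_mult_left)

lemma L2_inner_sum_left:
  assumes "finite I" and "\<And>i. i \<in> I \<Longrightarrow> f i \<in> L2_space M" and "h \<in> L2_space M"
  shows "L2_inner M (\<lambda>x. \<Sum>i\<in>I. c i * f i x) h = (\<Sum>i\<in>I. c i * L2_inner M (f i) h)"
  using assms
proof (induction I rule: finite_induct)
  case (insert i I)
  then show ?case
    using L2_inner_add_mult_left[of "\<lambda>x. \<Sum>i\<in>I. c i * f i x" M "f i" h "c i"] L2_space_sum[of I f M c]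
    by (simp add: add.commute)
qed (simp add: L2_inner_def)

lemma L2_inner_self: "L2_inner M f f = of_real ((L2_norm M f)\<^sup>2)"
proof -
  have "L2_inner M f f = (\<integral>x. of_real ((cmod (f x))\<^sup>2) \<partial>M)"
    unfolding L2_inner_def
    by (intro Bochner_Integration.integral_cong) (auto simp: complex_norm_square[symmetric])
  then show ?thesis by (simp only: integral_complex_of_real L2_norm_square)
qed

lemma L2_norm_add_mult_square:
  assumes "f \<in> L2_space M" "g \<in> L2_space M"
  shows "(L2_norm M (\<lambda>x. f x + c * g x))\<^sup>2 =
      (L2_norm M f)\<^sup>2 + 2 * Re (cnj c * L2_inner M f g) + (cmod c)\<^sup>2 * (L2_norm M g)\<^sup>2"
proof -
  let ?s = "\<lambda>x. f x + c * g x"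
  have s: "?s \<in> L2_space M" by (intro L2_space_add_mult assms)
  have "complex_of_real ((L2_norm M ?s)\<^sup>2) =
      L2_inner M f f + cnj c * L2_inner M f g + c * (L2_inner M g f + cnj c * L2_inner M g g)"
    unfolding L2_inner_self[symmetric]
    using assms s by (simp add: L2_inner_add_mult_left L2_inner_add_mult_right)
  also have "\<dots> = L2_inner M f f + (cnj c * L2_inner M f g + cnj (cnj c * L2_inner M f g))
      + (c * cnj c) * L2_inner M g g"
    by (simp add: L2_inner_commute[of M g f] algebra_simps)
  also have "\<dots> = complex_of_real ((L2_norm M f)\<^sup>2 + 2 * Re (cnj c * L2_inner M f g)
      + (cmod c)\<^sup>2 * (L2_norm M g)\<^sup>2)"
    unfolding L2_inner_self complex_add_cnj complex_norm_square[symmetric] by simp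
  finally show ?thesis by (simp only: of_real_eq_iff)
qed

lemma L2_Cauchy_Schwarz:
  assumes [measurable]: "f \<in> L2_space M" "g \<in> L2_space M"
  shows "cmod (L2_inner M f g) \<le> L2_norm M f * L2_norm M g"
proof -
  have "ennreal (cmod (L2_inner M f g)) \<le> (\<integral>\<^sup>+x. norm (f x * cnj (g x)) \<partial>M)"
    unfolding L2_inner_def
    by (rule integral_norm_bound_ennreal[OF L2_mult_integrable[OF assms]])
  also have "\<dots> = (\<integral>\<^sup>+x. ennreal (cmod (f x)) * ennreal (cmod (g x)) \<partial>M)"
    by (simp add: norm_mult ennreal_mult)
  finally have "(ennreal (cmod (L2_inner M f g)))\<^sup>2
      \<le> (\<integral>\<^sup>+x. ennreal (cmod (f x)) * ennreal (cmod (g x)) \<partial>M)\<^sup>2"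
    by (rule power_mono) simp
  also have "\<dots> \<le> (\<integral>\<^sup>+x. (ennreal (cmod (f x)))\<^sup>2 \<partial>M) * (\<integral>\<^sup>+x. (ennreal (cmod (g x)))\<^sup>2 \<partial>M)"
    by (rule Cauchy_Schwarz_nn_integral) measurable
  also have "\<dots> = ennreal ((L2_norm M f)\<^sup>2) * ennreal ((L2_norm M g)\<^sup>2)"
    by (simp only: ennreal_power norm_ge_zero nn_integral_L2_norm assms)
  finally have "ennreal ((cmod (L2_inner M f g))\<^sup>2) \<le> ennreal ((L2_norm M f * L2_norm M g)\<^sup>2)"
    by (simp add: ennreal_power ennreal_mult power_mult_distrib)
  then have "(cmod (L2_inner M f g))\<^sup>2 \<le> (L2_norm M f * L2_norm M g)\<^sup>2"
    by simp
  then show ?thesis by (rule power2_le_imp_le) simp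
qed

lemma L2_norm_triangle:
  assumes "f \<in> L2_space M" "g \<in> L2_space M"
  shows "L2_norm M (\<lambda>x. f x + g x) \<le> L2_norm M f + L2_norm M g"
proof (rule power2_le_imp_le)
  have "(L2_norm M (\<lambda>x. f x + g x))\<^sup>2 =
      (L2_norm M f)\<^sup>2 + 2 * Re (L2_inner M f g) + (L2_norm M g)\<^sup>2"
    using L2_norm_add_mult_square[OF assms, of 1] by simp
  moreover have "Re (L2_inner M f g) \<le> L2_norm M f * L2_norm M g"
    using L2_Cauchy_Schwarz[OF assms] complex_Re_le_cmod order_trans by blast
  ultimately show "(L2_norm M (\<lambda>x. f x + g x))\<^sup>2 \<le> (L2_norm M f + L2_norm M g)\<^sup>2"
    by (simp add: power2_sum)
qed simp

lemma L2_norm_triangle_diff: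
  assumes "f \<in> L2_space M" "g \<in> L2_space M" "h \<in> L2_space M"
  shows "L2_norm M (\<lambda>x. f x - h x) \<le> L2_norm M (\<lambda>x. f x - g x) + L2_norm M (\<lambda>x. g x - h x)"
  using L2_norm_triangle[OF L2_space_diff[OF assms(1,2)] L2_space_diff[OF assms(2,3)]] by simp

text \<open>
  Weighting the squared increments by \<open>2^k\<close> keeps their sum integrable, hence
  finite almost everywhere, and \<open>d \<le> 2^-k + 2^k d\<^sup>2\<close> then makes the increments themselves
  summable almost everywhere; Fatou's lemma turns the pointwise limit into a limit in norm.
\<close>

lemma L2_Riesz_Fischer:
  assumes v: "\<And>n. v n \<in> L2_space M"
    and inc: "\<And>n. L2_norm M (\<lambda>x. v (Suc n) x - v n x) \<le> K / 2 ^ n"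
  shows "\<exists>u\<in>L2_space M. (\<lambda>n. L2_norm M (\<lambda>x. v n x - u x)) \<longlonglongrightarrow> 0"
proof -
  note v[measurable]
  have K: "0 \<le> K" using order_trans[OF L2_norm_nonneg inc[of 0]] by simp
  let ?d = "\<lambda>k x. cmod (v (Suc k) x - v k x)"
  have "(\<integral>\<^sup>+x. (\<Sum>k. ennreal (2 ^ k * (?d k x)\<^sup>2)) \<partial>M)
      = (\<Sum>k. \<integral>\<^sup>+x. ennreal (2 ^ k * (?d k x)\<^sup>2) \<partial>M)"
    by (intro nn_integral_suminf) measurable
  also have "\<dots> \<le> (\<Sum>k. ennreal (K\<^sup>2 * (1/2) ^ k))"
  proof (intro suminf_le allI)
    fix k
    have "(\<integral>\<^sup>+x. ennreal (2 ^ k * (?d k x)\<^sup>2) \<partial>M) = ennreal (2 ^ k) * (\<integral>\<^sup>+x. ennreal ((?d k x)\<^sup>2) \<partial>M)"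
      by (subst nn_integral_cmult[symmetric]) (auto simp: ennreal_mult)
    also have "\<dots> = ennreal (2 ^ k * (L2_norm M (\<lambda>x. v (Suc k) x - v k x))\<^sup>2)"
      by (subst nn_integral_L2_norm) (auto intro!: L2_space_diff v simp: ennreal_mult)
    also have "\<dots> \<le> ennreal (2 ^ k * (K / 2 ^ k)\<^sup>2)"
      by (intro ennreal_leI mult_left_mono power_mono inc) auto
    also have "2 ^ k * (K / 2 ^ k)\<^sup>2 = K\<^sup>2 * (1/2) ^ k"
      by (simp add: power2_eq_square field_simps)
    finally show "(\<integral>\<^sup>+x. ennreal (2 ^ k * (?d k x)\<^sup>2) \<partial>M) \<le> ennreal (K\<^sup>2 * (1/2) ^ k)" .
  qed auto
  also have "\<dots> < \<infinity>"
    by (subst suminf_ennreal2) (auto intro!: summable_mult summable_geometric)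
  finally have "AE x in M. (\<Sum>k. ennreal (2 ^ k * (?d k x)\<^sup>2)) \<noteq> \<infinity>"
    by (intro nn_integral_PInf_AE) (auto simp: less_top)
  then have conv: "AE x in M. convergent (\<lambda>n. v n x)"
  proof (rule AE_mp, intro AE_I2 impI)
    fix x assume "(\<Sum>k. ennreal (2 ^ k * (?d k x)\<^sup>2)) \<noteq> \<infinity>"
    then have "summable (\<lambda>k. 2 ^ k * (?d k x)\<^sup>2)"
      by (intro summable_suminf_not_top) auto
    moreover have "summable (\<lambda>k. (1/2::real) ^ k)" by (rule summable_geometric) simp
    ultimately have "summable (\<lambda>k. (1/2) ^ k + 2 ^ k * (?d k x)\<^sup>2)" by (rule summable_add[rotated])
    moreover have "norm (v (Suc k) x - v k x) \<le> (1/2) ^ k + 2 ^ k * (?d k x)\<^sup>2" for k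
    proof (cases "?d k x \<le> (1/2) ^ k")
      case True
      then show ?thesis by (simp add: add_increasing2)
    next
      case False
      then have "1 \<le> 2 ^ k * ?d k x" by (simp add: power_divide field_simps)
      then have "1 * ?d k x \<le> (2 ^ k * ?d k x) * ?d k x" by (intro mult_right_mono) auto
      then show ?thesis by (simp add: power2_eq_square mult.assoc add_increasing)
    qed
    ultimately have "summable (\<lambda>k. v (Suc k) x - v k x)"
      by (rule summable_comparison_test'[where N = 0])
    then have "convergent (\<lambda>n. v n x - v 0 x)"
      by (simp only: summable_iff_convergent sum_lessThan_telescope[of "\<lambda>k. v k x"])
    then show "convergent (\<lambda>n. v n x)" by (simp only: convergent_diff_const_right_iff)
  qed
  define u where "u x = lim (\<lambda>n. v n x)" for x
  have u_meas[measurable]: "u \<in> borel_measurable M" unfolding u_def by measurable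
  have tail: "L2_norm M (\<lambda>x. v (n + j) x - v n x) \<le> K * 2 / 2 ^ n - K * 2 / 2 ^ (n + j)" for n j
  proof (induction j)
    case 0
    then show ?case by (simp add: L2_norm_def)
  next
    case (Suc j)
    have "L2_norm M (\<lambda>x. v (n + Suc j) x - v n x)
        \<le> L2_norm M (\<lambda>x. v (Suc (n + j)) x - v (n + j) x) + L2_norm M (\<lambda>x. v (n + j) x - v n x)"
      using L2_norm_triangle_diff[OF v v v] by simp
    also have "\<dots> \<le> K / 2 ^ (n + j) + (K * 2 / 2 ^ n - K * 2 / 2 ^ (n + j))"
      by (intro add_mono inc Suc)
    also have "\<dots> = K * 2 / 2 ^ n - K * 2 / 2 ^ (n + Suc j)"
      by (simp add: field_simps)
    finally show ?case .
  qed
  have dist: "(\<integral>\<^sup>+x. ennreal ((cmod (v n x - u x))\<^sup>2) \<partial>M) \<le> ennreal ((K * 2 / 2 ^ n)\<^sup>2)" for n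
  proof -
    have "(\<integral>\<^sup>+x. ennreal ((cmod (v n x - u x))\<^sup>2) \<partial>M)
        = (\<integral>\<^sup>+x. liminf (\<lambda>j. ennreal ((cmod (v (n + j) x - v n x))\<^sup>2)) \<partial>M)"
    proof (rule nn_integral_cong_AE, rule AE_mp[OF conv], intro AE_I2 impI)
      fix x assume "convergent (\<lambda>n. v n x)"
      then have "(\<lambda>j. v j x) \<longlonglongrightarrow> u x" unfolding u_def by (simp add: convergent_LIMSEQ_iff)
      then have "(\<lambda>j. v (n + j) x) \<longlonglongrightarrow> u x"
        using LIMSEQ_ignore_initial_segment[of "\<lambda>j. v j x" "u x" n] by (simp add: add.commute)
      then have "(\<lambda>j. ennreal ((cmod (v (n + j) x - v n x))\<^sup>2)) \<longlonglongrightarrow> ennreal ((cmod (u x - v n x))\<^sup>2)"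
        by (intro tendsto_intros)
      then have "liminf (\<lambda>j. ennreal ((cmod (v (n + j) x - v n x))\<^sup>2)) = ennreal ((cmod (u x - v n x))\<^sup>2)"
        by (intro lim_imp_Liminf) auto
      then show "ennreal ((cmod (v n x - u x))\<^sup>2) = liminf (\<lambda>j. ennreal ((cmod (v (n + j) x - v n x))\<^sup>2))"
        by (simp only: norm_minus_commute[of "v n x" "u x"])
    qed
    also have "\<dots> \<le> liminf (\<lambda>j. \<integral>\<^sup>+x. ennreal ((cmod (v (n + j) x - v n x))\<^sup>2) \<partial>M)"
      by (intro nn_integral_liminf) measurable
    also have "\<dots> \<le> liminf (\<lambda>j::nat. ennreal ((K * 2 / 2 ^ n)\<^sup>2))"
    proof (intro Liminf_mono always_eventually allI)
      fix j
      have "L2_norm M (\<lambda>x. v (n + j) x - v n x) \<le> K * 2 / 2 ^ n"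
        using tail[of n j] K by (smt (verit) divide_nonneg_nonneg zero_le_power mult_nonneg_nonneg)
      then show "(\<integral>\<^sup>+x. ennreal ((cmod (v (n + j) x - v n x))\<^sup>2) \<partial>M) \<le> ennreal ((K * 2 / 2 ^ n)\<^sup>2)"
        by (subst nn_integral_L2_norm) (auto intro!: L2_space_diff v ennreal_leI power_mono)
    qed
    finally show ?thesis by (simp add: Liminf_const)
  qed
  have diff: "(\<lambda>x. v n x - u x) \<in> L2_space M" for n
    unfolding L2_space_iff_nn_integral using dist[of n] by (auto intro: le_less_trans)
  have "u \<in> L2_space M"
    using L2_space_diff[OF v[of 0] diff[of 0]] by simp
  moreover have "(\<lambda>n. L2_norm M (\<lambda>x. v n x - u x)) \<longlonglongrightarrow> 0"
  proof (rule tendsto_sandwich[OF _ _ tendsto_const])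
    have "(\<lambda>n. K * 2 * (1/2) ^ n) \<longlonglongrightarrow> K * 2 * 0"
      by (intro tendsto_mult tendsto_const LIMSEQ_power_zero) auto
    then show "(\<lambda>n. K * 2 / 2 ^ n) \<longlonglongrightarrow> 0" by (simp add: power_divide)
    show "\<forall>\<^sub>F n in sequentially. L2_norm M (\<lambda>x. v n x - u x) \<le> K * 2 / 2 ^ n"
    proof (intro always_eventually allI)
      fix n
      have "(L2_norm M (\<lambda>x. v n x - u x))\<^sup>2 \<le> (K * 2 / 2 ^ n)\<^sup>2"
        using dist[of n] unfolding nn_integral_L2_norm[OF diff] by simp
      then show "L2_norm M (\<lambda>x. v n x - u x) \<le> K * 2 / 2 ^ n"
        by (rule power2_le_imp_le) (use K in simp)
    qed
  qed auto
  ultimately show ?thesis by blast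
qed

text \<open>
  A preimage of \<open>f\<close> under the frame operator is found by minimising
  \<open>\<parallel>C u\<parallel>\<^sup>2 - 2 Re \<langle>f, u\<rangle>\<close>: the lower bound makes this functional bounded below, the parallelogram
  law makes minimising sequences Cauchy, and at a minimum the first variation vanishes.
\<close>

lemma frame_operator_surj:
  fixes M :: "'a measure" and N :: "'b measure"
  assumes CL: "\<And>u. u \<in> L2_space M \<Longrightarrow> C u \<in> L2_space N"
    and Clin: "\<And>u v c. u \<in> L2_space M \<Longrightarrow> v \<in> L2_space M \<Longrightarrow>
        C (\<lambda>x. u x + c * v x) = (\<lambda>y. C u y + c * C v y)"
    and A: "0 < A" "\<And>u. u \<in> L2_space M \<Longrightarrow> A * (L2_norm M u)\<^sup>2 \<le> (L2_norm N (C u))\<^sup>2"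
    and B: "\<And>u. u \<in> L2_space M \<Longrightarrow> (L2_norm N (C u))\<^sup>2 \<le> B * (L2_norm M u)\<^sup>2"
    and f: "f \<in> L2_space M"
  shows "\<exists>u\<in>L2_space M. \<forall>w\<in>L2_space M. L2_inner N (C u) (C w) = L2_inner M f w"
proof -
  let ?V = "L2_space M"
  define J where "J u = (L2_norm N (C u))\<^sup>2 - 2 * Re (L2_inner M f u)" for u
  have Jvar: "J (\<lambda>x. u x + c * w x) = J u + 2 * Re (cnj c * (L2_inner N (C u) (C w) - L2_inner M f w))
      + (cmod c)\<^sup>2 * (L2_norm N (C w))\<^sup>2" if "u \<in> ?V" "w \<in> ?V" for u w c
    using that f
    by (simp add: J_def Clin L2_norm_add_mult_square CL L2_inner_add_mult_right algebra_simps)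
  have Jbound: "- ((L2_norm M f)\<^sup>2 / A) \<le> J u" if u: "u \<in> ?V" for u
  proof -
    let ?a = "L2_norm M f" and ?b = "L2_norm M u"
    have "Re (L2_inner M f u) \<le> ?a * ?b"
      using L2_Cauchy_Schwarz[OF f u] complex_Re_le_cmod order_trans by blast
    then have "A * ?b\<^sup>2 - 2 * (?a * ?b) \<le> J u" using A(2)[OF u] by (simp add: J_def)
    moreover have "0 \<le> (A * ?b - ?a)\<^sup>2 / A" using A by simp
    moreover have "(A * ?b - ?a)\<^sup>2 / A = A * ?b\<^sup>2 - 2 * (?a * ?b) + ?a\<^sup>2 / A"
      using A by (simp add: power2_eq_square field_simps)
    ultimately show ?thesis by linarith
  qed
  define m where "m = Inf (J ` ?V)"
  have bdd: "bdd_below (J ` ?V)" using Jbound by (intro bdd_belowI) blast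
  have m: "m \<le> J u" if "u \<in> ?V" for u unfolding m_def using that bdd by (intro cInf_lower) auto
  have "\<exists>u\<in>?V. J u < m + (1/4) ^ n" for n :: nat
  proof -
    have "J ` ?V \<noteq> {}" using L2_space_zero by blast
    then have "\<exists>y\<in>J ` ?V. y < m + (1/4) ^ n"
      unfolding m_def by (intro cInf_lessD) auto
    then show ?thesis by blast
  qed
  then obtain v where v: "\<And>n. v n \<in> ?V" and Jv: "\<And>n. J (v n) < m + (1/4) ^ n"
    by metis
  let ?K = "2 / sqrt A"
  have inc: "L2_norm M (\<lambda>x. v (Suc n) x - v n x) \<le> ?K / 2 ^ n" for n
  proof -
    let ?d = "\<lambda>x. v (Suc n) x - v n x"
    have d: "?d \<in> ?V" by (intro L2_space_diff v)
    have mid: "(\<lambda>x. v n x + (1/2) * ?d x) \<in> ?V" by (intro L2_space_add_mult v d)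
    let ?R = "Re (L2_inner N (C (v n)) (C ?d) - L2_inner M f ?d)"
    have 1: "J (v (Suc n)) = J (v n) + 2 * ?R + (L2_norm N (C ?d))\<^sup>2"
      using Jvar[OF v[of n] d, of 1] by simp
    have 2: "J (\<lambda>x. v n x + (1/2) * ?d x) = J (v n) + ?R + (1/4) * (L2_norm N (C ?d))\<^sup>2"
      using Jvar[OF v[of n] d, of "1/2"] by (simp add: power_divide)
    have "m \<le> J (\<lambda>x. v n x + (1/2) * ?d x)" by (rule m[OF mid])
    with 1 2 Jv[of n] Jv[of "Suc n"] have "(L2_norm N (C ?d))\<^sup>2 \<le> 2 * (1/4) ^ n + 2 * (1/4) ^ Suc n"
      by linarith
    also have "\<dots> \<le> 4 * (1/4) ^ n" by simp
    finally have "A * (L2_norm M ?d)\<^sup>2 \<le> 4 * (1/4) ^ n" using A(2)[OF d] by linarith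
    then have "(L2_norm M ?d)\<^sup>2 \<le> 4 * (1/4) ^ n / A" using A(1) by (simp add: field_simps)
    also have "\<dots> = (?K / 2 ^ n)\<^sup>2"
      using A(1) power_mult[of "2::real" 2 n] power_mult[of "2::real" n 2]
      by (simp add: power_divide power_mult_distrib mult.commute)
    finally show ?thesis by (rule power2_le_imp_le) (use A in simp)
  qed
  obtain u where u: "u \<in> ?V" and lim: "(\<lambda>n. L2_norm M (\<lambda>x. v n x - u x)) \<longlonglongrightarrow> 0"
    using L2_Riesz_Fischer[of v M, OF v inc] by blast
  have Ju: "J u \<le> m"
  proof (rule LIMSEQ_le_const)
    let ?d = "\<lambda>n x. v n x - u x" and ?g = "L2_norm N (C u)"
    have d: "?d n \<in> ?V" for n by (intro L2_space_diff v u)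
    have "(\<lambda>n. m + (1/4) ^ n + 2 * (?g * (sqrt \<bar>B\<bar> * L2_norm M (?d n))) + 2 * (L2_norm M f * L2_norm M (?d n)))
        \<longlonglongrightarrow> m + 0 + 2 * (?g * (sqrt \<bar>B\<bar> * 0)) + 2 * (L2_norm M f * 0)"
      by (intro tendsto_intros lim LIMSEQ_power_zero) auto
    then show "(\<lambda>n. m + (1/4) ^ n + 2 * (?g * (sqrt \<bar>B\<bar> * L2_norm M (?d n))) + 2 * (L2_norm M f * L2_norm M (?d n)))
        \<longlonglongrightarrow> m" by simp
    show "\<exists>N0. \<forall>n\<ge>N0. J u \<le> m + (1/4) ^ n + 2 * (?g * (sqrt \<bar>B\<bar> * L2_norm M (?d n)))
        + 2 * (L2_norm M f * L2_norm M (?d n))"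
    proof (intro exI allI impI)
      fix n :: nat
      have "J (v n) = J u + 2 * Re (L2_inner N (C u) (C (?d n)) - L2_inner M f (?d n)) + (L2_norm N (C (?d n)))\<^sup>2"
        using Jvar[OF u d, of 1 n] by simp
      then have "J u \<le> J (v n) - 2 * Re (L2_inner N (C u) (C (?d n))) + 2 * Re (L2_inner M f (?d n))"
        by simp
      moreover have "- Re (L2_inner N (C u) (C (?d n))) \<le> ?g * (sqrt \<bar>B\<bar> * L2_norm M (?d n))"
      proof -
        have "- Re (L2_inner N (C u) (C (?d n))) \<le> cmod (L2_inner N (C u) (C (?d n)))"
          using abs_Re_le_cmod[of "L2_inner N (C u) (C (?d n))"] by linarith
        also have "\<dots> \<le> ?g * L2_norm N (C (?d n))" by (intro L2_Cauchy_Schwarz CL u d)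
        also have "L2_norm N (C (?d n)) \<le> sqrt \<bar>B\<bar> * L2_norm M (?d n)"
        proof (rule power2_le_imp_le)
          have "B * (L2_norm M (?d n))\<^sup>2 \<le> \<bar>B\<bar> * (L2_norm M (?d n))\<^sup>2" by (intro mult_right_mono) auto
          then show "(L2_norm N (C (?d n)))\<^sup>2 \<le> (sqrt \<bar>B\<bar> * L2_norm M (?d n))\<^sup>2"
            using B[OF d[of n]] by (simp add: power_mult_distrib)
        qed simp
        finally show ?thesis by (simp add: mult_left_mono)
      qed
      moreover have "Re (L2_inner M f (?d n)) \<le> L2_norm M f * L2_norm M (?d n)"
        using L2_Cauchy_Schwarz[OF f d] complex_Re_le_cmod order_trans by blast
      ultimately show "J u \<le> m + (1/4) ^ n + 2 * (?g * (sqrt \<bar>B\<bar> * L2_norm M (?d n)))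
        + 2 * (L2_norm M f * L2_norm M (?d n))"
        using Jv[of n] by linarith
    qed
  qed
  have "L2_inner N (C u) (C w) = L2_inner M f w" if w: "w \<in> ?V" for w
  proof (rule ccontr)
    define z where "z = L2_inner N (C u) (C w) - L2_inner M f w"
    define k where "k = (L2_norm N (C w))\<^sup>2 + 1"
    have k: "0 < k" by (simp add: k_def add_nonneg_pos)
    assume "L2_inner N (C u) (C w) \<noteq> L2_inner M f w"
    then have z: "0 < (cmod z)\<^sup>2" by (simp add: z_def)
    \<comment> \<open>The quadratic in the direction \<open>w\<close> is least at the step \<open>-z / \<parallel>C w\<parallel>\<^sup>2\<close>; the added \<open>1\<close> avoids
      a division by \<open>0\<close> and still leaves a decrease.\<close>
    let ?c = "- z / of_real k"
    have "m \<le> J (\<lambda>x. u x + ?c * w x)" by (intro m L2_space_add_mult u w)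
    also have "\<dots> = J u + 2 * Re (cnj ?c * z) + (cmod ?c)\<^sup>2 * (k - 1)"
      by (subst Jvar[OF u w]) (simp add: z_def k_def)
    also have "cnj ?c * z = of_real (- (cmod z)\<^sup>2 / k)"
      using complex_norm_square[of z] by (simp add: mult.commute)
    also have "(cmod ?c)\<^sup>2 = (cmod z)\<^sup>2 / k\<^sup>2"
      using k by (simp add: norm_divide power_divide)
    finally have "0 \<le> - 2 * (cmod z)\<^sup>2 / k + (cmod z)\<^sup>2 / k\<^sup>2 * (k - 1)"
      using Ju by simp
    then have "0 \<le> (- 2 * (cmod z)\<^sup>2 / k + (cmod z)\<^sup>2 / k\<^sup>2 * (k - 1)) * k\<^sup>2"
      using k by (intro mult_nonneg_nonneg) auto
    also have "\<dots> = - (cmod z)\<^sup>2 * (k + 1)"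
      using k by (simp add: power2_eq_square field_simps)
    finally show False using z k by (simp add: mult_le_0_iff zero_le_mult_iff)
  qed
  with u show ?thesis by blast
qed

section \<open>Topological groups and their duals\<close>

lemma (in topological_comm_group) continuous_map_mult:
  assumes "continuous_map X T f" "continuous_map X T h"
  shows "continuous_map X T (\<lambda>x. f x \<otimes> h x)"
  using continuous_map_compose[OF continuous_map_pairedI[OF assms] continuous_mult]
  by (simp add: o_def)

lemma (in topological_comm_group) continuous_map_inv:
  assumes "continuous_map X T f"
  shows "continuous_map X T (\<lambda>x. inv (f x))"
  using continuous_map_compose[OF assms continuous_inv] by (simp add: o_def)

lemma (in topological_comm_group) continuous_translation:
  assumes "x \<in> carrier G"
  shows "continuous_map T T (\<lambda>y. x \<otimes> y)"
  using assms by (intro continuous_map_mult) (auto simp: topspace_carrier)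

lemma topological_comm_group_DirProd:
  assumes "topological_comm_group G S" and "topological_comm_group H T"
  shows "topological_comm_group (G \<times>\<times> H) (prod_topology S T)"
proof -
  interpret G: topological_comm_group G S by fact
  interpret H: topological_comm_group H T by fact
  interpret GH: group "G \<times>\<times> H"
    by (rule DirProd_group) (rule G.group_axioms, rule H.group_axioms)
  have "comm_group (G \<times>\<times> H)"
    by (rule GH.group_comm_groupI) (auto simp: G.m_comm H.m_comm)
  then show ?thesis
  proof (rule topological_comm_group.intro, unfold_locales)
    show "topspace (prod_topology S T) = carrier (G \<times>\<times> H)"
      by (simp add: G.topspace_carrier H.topspace_carrier)
    let ?X = "prod_topology (prod_topology S T) (prod_topology S T)"
    have p1: "continuous_map ?X (prod_topology S T) fst" and p2: "continuous_map ?X (prod_topology S T) snd"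
      by (rule continuous_map_fst continuous_map_snd)+
    have "continuous_map ?X (prod_topology S T)
        (\<lambda>p. (fst (fst p) \<otimes>\<^bsub>G\<^esub> fst (snd p), snd (fst p) \<otimes>\<^bsub>H\<^esub> snd (snd p)))"
      using continuous_map_compose[OF p1 continuous_map_fst] continuous_map_compose[OF p2 continuous_map_fst]
        continuous_map_compose[OF p1 continuous_map_snd] continuous_map_compose[OF p2 continuous_map_snd]
      by (intro continuous_map_pairedI G.continuous_map_mult H.continuous_map_mult) (simp_all add: o_def)
    then show "continuous_map ?X (prod_topology S T) (\<lambda>(x, y). x \<otimes>\<^bsub>G \<times>\<times> H\<^esub> y)"
      by (simp add: DirProd_def case_prod_unfold)
    have "continuous_map (prod_topology S T) (prod_topology S T) (\<lambda>p. (inv\<^bsub>G\<^esub> fst p, inv\<^bsub>H\<^esub> snd p))"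
      by (intro continuous_map_pairedI G.continuous_map_inv H.continuous_map_inv
          continuous_map_fst continuous_map_snd)
    then show "continuous_map (prod_topology S T) (prod_topology S T) (\<lambda>x. inv\<^bsub>G \<times>\<times> H\<^esub> x)"
      by (rule continuous_map_eq)
        (auto simp: inv_DirProd[OF G.group_axioms H.group_axioms] G.topspace_carrier H.topspace_carrier)
  qed
qed

lemma dual_carrier_norm: "\<gamma> \<in> carrier (dual_group G T) \<Longrightarrow> x \<in> carrier G \<Longrightarrow> cmod (\<gamma> x) = 1"
  by (auto simp: dual_group_def PiE_iff)

lemma dual_carrier_continuous: "\<gamma> \<in> carrier (dual_group G T) \<Longrightarrow> continuous_map T euclidean \<gamma>"
  by (simp add: dual_group_def)

lemma dual_carrier_mult:
  "\<gamma> \<in> carrier (dual_group G T) \<Longrightarrow> x \<in> carrier G \<Longrightarrow> y \<in> carrier G \<Longrightarrow>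
    \<gamma> (x \<otimes>\<^bsub>G\<^esub> y) = \<gamma> x * \<gamma> y"
  by (auto simp: dual_group_def)

lemma dual_carrier_eqI:
  assumes "\<gamma> \<in> carrier (dual_group G T)" "\<delta> \<in> carrier (dual_group G T)"
    and "\<And>x. x \<in> carrier G \<Longrightarrow> \<gamma> x = \<delta> x"
  shows "\<gamma> = \<delta>"
  using assms by (auto simp: dual_group_def PiE_iff intro: extensionalityI)

lemma dual_mult_apply: "x \<in> carrier G \<Longrightarrow> (\<gamma> \<otimes>\<^bsub>dual_group G T\<^esub> \<delta>) x = \<gamma> x * \<delta> x"
  by (simp add: dual_group_def)

lemma dual_one_apply: "x \<in> carrier G \<Longrightarrow> \<one>\<^bsub>dual_group G T\<^esub> x = 1"
  by (simp add: dual_group_def)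

lemma (in topological_comm_group) dual_inv_apply:
  assumes "\<gamma> \<in> carrier (dual_group G T)" "x \<in> carrier G"
  shows "(inv\<^bsub>dual_group G T\<^esub> \<gamma>) x = cnj (\<gamma> x)"
proof -
  interpret D: comm_group "dual_group G T" by (rule comm_group_dual_group)
  have "(inv\<^bsub>dual_group G T\<^esub> \<gamma>) x * \<gamma> x = 1"
    using assms dual_mult_apply[OF assms(2), of T "inv\<^bsub>dual_group G T\<^esub> \<gamma>" \<gamma>]
      dual_one_apply[OF assms(2), of T] by simp
  moreover have "\<gamma> x * cnj (\<gamma> x) = 1"
    using dual_carrier_norm[OF assms] by (simp add: complex_norm_square[symmetric])
  ultimately show ?thesis by (metis mult.assoc mult.left_neutral mult.right_neutral)
qed

lemma openin_dual_subbase: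
  "compactin T K \<Longrightarrow> open U \<Longrightarrow>
    openin (dual_topology G T) {\<gamma> \<in> carrier (dual_group G T). \<gamma> ` K \<subseteq> U}"
  unfolding dual_topology_def by (rule topology_generated_by_Basis) auto

text \<open>
  Uniform closeness on a compact set \<open>K\<close> is a neighbourhood condition: cover the circle by finitely
  many small balls and constrain a character separately on the part of \<open>K\<close> that \<open>\<gamma>\<^sub>0\<close> sends near
  each centre.
\<close>

lemma dual_uniform_neighbourhood:
  assumes \<gamma>0: "\<gamma>0 \<in> carrier (dual_group G T)" and K: "compactin T K" and e: "0 < e"
    and T: "topspace T = carrier G"
  obtains W where "openin (dual_topology G T) W" "\<gamma>0 \<in> W"
    "\<And>\<gamma> x. \<gamma> \<in> W \<Longrightarrow> x \<in> K \<Longrightarrow> dist (\<gamma> x) (\<gamma>0 x) < e"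
proof -
  obtain F where F: "finite F" "sphere (0::complex) 1 \<subseteq> (\<Union>z\<in>F. ball z (e/3))"
  proof -
    have "\<forall>\<epsilon>>0. \<exists>k. finite k \<and> sphere (0::complex) 1 \<subseteq> (\<Union>x\<in>k. ball x \<epsilon>)"
      using compact_sphere[of "0::complex" 1] unfolding compact_eq_totally_bounded by (rule conjunct2)
    moreover have "0 < e / 3" using e by simp
    ultimately show thesis using that by blast
  qed
  define K' where "K' z = K \<inter> {x \<in> topspace T. \<gamma>0 x \<in> cball z (e/3)}" for z
  have K': "compactin T (K' z)" for z
    unfolding K'_def
    by (subst Int_commute, rule closed_Int_compactin[OF
          closedin_continuous_map_preimage[OF dual_carrier_continuous[OF \<gamma>0]] K]) simp
  let ?S = "\<lambda>z. {\<gamma> \<in> carrier (dual_group G T). \<gamma> ` K' z \<subseteq> ball z (e/2)}"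
  let ?W = "topspace (dual_topology G T) \<inter> \<Inter> (?S ` F)"
  show thesis
  proof
    show "openin (dual_topology G T) ?W"
    proof (cases "F = {}")
      case False
      then have "openin (dual_topology G T) (\<Inter> (?S ` F))"
        using F(1) by (intro openin_Inter) (auto intro: openin_dual_subbase K')
      then show ?thesis by (intro openin_Int openin_topspace)
    qed simp
    show "\<gamma>0 \<in> ?W"
      using \<gamma>0 e by (auto simp: topspace_dual_topology K'_def)
    fix \<gamma> x assume \<gamma>: "\<gamma> \<in> ?W" and x: "x \<in> K"
    then have xG: "x \<in> carrier G" using compactin_subset_topspace[OF K] T by auto
    then have "\<gamma>0 x \<in> sphere 0 1" using dual_carrier_norm[OF \<gamma>0] by simp
    then obtain z where z: "z \<in> F" "dist z (\<gamma>0 x) < e/3" using F(2) by auto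
    then have "x \<in> K' z" using x xG T by (simp add: K'_def)
    moreover have "\<gamma> ` K' z \<subseteq> ball z (e/2)" using \<gamma> z(1) by blast
    ultimately have "dist z (\<gamma> x) < e/2" by (auto simp del: less_divide_eq_numeral1)
    with z(2) have "dist (\<gamma> x) z + dist z (\<gamma>0 x) < e" using e by (simp add: dist_commute)
    then show "dist (\<gamma> x) (\<gamma>0 x) < e" using dist_triangle[of "\<gamma> x" "\<gamma>0 x" z] by linarith
  qed
qed

text \<open>
  In the other direction, a constraint \<open>\<gamma> ` K \<subseteq> U\<close> has a margin, since \<open>\<gamma> ` K\<close> is compact. So the
  compact-open topology is that of uniform convergence on compact sets, and continuity of maps into
  the dual group can be checked in these terms.
\<close>

lemma continuous_map_dual_topology:
  assumes "\<And>p. p \<in> topspace X \<Longrightarrow> \<phi> p \<in> carrier (dual_group G T)"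
    and "\<And>K e p. compactin T K \<Longrightarrow> 0 < e \<Longrightarrow> p \<in> topspace X \<Longrightarrow>
      \<exists>W. openin X W \<and> p \<in> W \<and> (\<forall>q\<in>W. \<forall>x\<in>K. dist (\<phi> q x) (\<phi> p x) < (e::real))"
  shows "continuous_map X (dual_topology G T) \<phi>"
  unfolding dual_topology_def
proof (rule continuous_on_generated_topo)
  let ?S = "{{\<gamma> \<in> carrier (dual_group G T). \<gamma> ` K \<subseteq> U} | K U. compactin T K \<and> open U}"
  have "topspace (topology_generated_by ?S) = carrier (dual_group G T)"
    using topspace_dual_topology[of G T] by (simp add: dual_topology_def)
  then show "\<phi> ` topspace X \<subseteq> \<Union> ?S" using assms(1) by auto
  fix V assume "V \<in> ?S"
  then obtain K U where V: "V = {\<gamma> \<in> carrier (dual_group G T). \<gamma> ` K \<subseteq> U}" "compactin T K" "open U"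
    by blast
  show "openin X (\<phi> -` V \<inter> topspace X)"
  proof (subst openin_subopen, intro ballI)
    fix p assume p: "p \<in> \<phi> -` V \<inter> topspace X"
    then have "\<phi> p \<in> carrier (dual_group G T)" "\<phi> p ` K \<subseteq> U" by (auto simp: V)
    moreover have "compact (\<phi> p ` K)"
      using image_compactin[OF V(2) dual_carrier_continuous[OF calculation(1)]] by simp
    ultimately obtain e where e: "0 < e" "(\<Union>z\<in>\<phi> p ` K. ball z e) \<subseteq> U"
      using compact_subset_open_imp_ball_epsilon_subset V(3) by blast
    from p have "p \<in> topspace X" by simp
    from assms(2)[OF V(2) e(1) this]
    obtain W where W: "openin X W" "p \<in> W" "\<forall>q\<in>W. \<forall>x\<in>K. dist (\<phi> q x) (\<phi> p x) < e"
      by (elim exE conjE)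
    have "W \<subseteq> \<phi> -` V \<inter> topspace X"
    proof
      fix q assume q: "q \<in> W"
      then have qX: "q \<in> topspace X" using openin_subset[OF W(1)] by blast
      have "\<phi> q x \<in> U" if "x \<in> K" for x
      proof -
        have "\<phi> q x \<in> ball (\<phi> p x) e"
          using W(3)[rule_format, OF q that] by (simp add: dist_commute)
        then show ?thesis using e(2) that by blast
      qed
      then show "q \<in> \<phi> -` V \<inter> topspace X" using qX assms(1) by (auto simp: V)
    qed
    with W show "\<exists>W. openin X W \<and> p \<in> W \<and> W \<subseteq> \<phi> -` V \<inter> topspace X" by blast
  qed
qed

lemma (in topological_comm_group) topological_comm_group_dual:
  "topological_comm_group (dual_group G T) (dual_topology G T)"
proof -
  interpret D: comm_group "dual_group G T" by (rule comm_group_dual_group)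
  let ?X = "dual_topology G T"
  show ?thesis
  proof (unfold_locales)
    show "topspace ?X = carrier (dual_group G T)" by (rule topspace_dual_topology)
    show "continuous_map (prod_topology ?X ?X) ?X (\<lambda>(\<gamma>, \<delta>). \<gamma> \<otimes>\<^bsub>dual_group G T\<^esub> \<delta>)"
    proof (rule continuous_map_dual_topology)
      fix K and e :: real and p
      assume K: "compactin T K" and e: "0 < e" and p: "p \<in> topspace (prod_topology ?X ?X)"
      obtain \<gamma>0 \<delta>0 where p0: "p = (\<gamma>0, \<delta>0)" by force
      with p have 0: "\<gamma>0 \<in> carrier (dual_group G T)" "\<delta>0 \<in> carrier (dual_group G T)"
        by (auto simp: topspace_dual_topology)
      obtain W1 where W1: "openin ?X W1" "\<gamma>0 \<in> W1"
          "\<And>\<gamma> x. \<gamma> \<in> W1 \<Longrightarrow> x \<in> K \<Longrightarrow> dist (\<gamma> x) (\<gamma>0 x) < e/2"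
        using dual_uniform_neighbourhood[OF 0(1) K, of "e/2"] e topspace_carrier by auto
      obtain W2 where W2: "openin ?X W2" "\<delta>0 \<in> W2"
          "\<And>\<gamma> x. \<gamma> \<in> W2 \<Longrightarrow> x \<in> K \<Longrightarrow> dist (\<gamma> x) (\<delta>0 x) < e/2"
        using dual_uniform_neighbourhood[OF 0(2) K, of "e/2"] e topspace_carrier by auto
      have "dist ((\<gamma> \<otimes>\<^bsub>dual_group G T\<^esub> \<delta>) x) ((\<gamma>0 \<otimes>\<^bsub>dual_group G T\<^esub> \<delta>0) x) < e"
        if "\<gamma> \<in> W1" "\<delta> \<in> W2" "x \<in> K" for \<gamma> \<delta> x
      proof -
        have x: "x \<in> carrier G" using that(3) compactin_subset_topspace[OF K] topspace_carrier by auto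
        have \<delta>: "\<delta> \<in> carrier (dual_group G T)"
          using that(2) openin_subset[OF W2(1)] by (auto simp: topspace_dual_topology)
        have "\<gamma> x * \<delta> x - \<gamma>0 x * \<delta>0 x = (\<gamma> x - \<gamma>0 x) * \<delta> x + \<gamma>0 x * (\<delta> x - \<delta>0 x)"
          by (simp add: algebra_simps)
        then have "cmod (\<gamma> x * \<delta> x - \<gamma>0 x * \<delta>0 x) \<le> cmod (\<gamma> x - \<gamma>0 x) * cmod (\<delta> x) + cmod (\<gamma>0 x) * cmod (\<delta> x - \<delta>0 x)"
          by (metis norm_mult norm_triangle_ineq)
        also have "\<dots> < e"
          using W1(3)[OF that(1,3)] W2(3)[OF that(2,3)] dual_carrier_norm[OF \<delta> x] dual_carrier_norm[OF 0(1) x]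
          by (simp add: dist_norm)
        finally show ?thesis using x by (simp add: dual_mult_apply dist_norm)
      qed
      then show "\<exists>W. openin (prod_topology ?X ?X) W \<and> p \<in> W \<and> (\<forall>q\<in>W. \<forall>x\<in>K.
          dist ((case q of (\<gamma>, \<delta>) \<Rightarrow> \<gamma> \<otimes>\<^bsub>dual_group G T\<^esub> \<delta>) x) ((case p of (\<gamma>, \<delta>) \<Rightarrow> \<gamma> \<otimes>\<^bsub>dual_group G T\<^esub> \<delta>) x) < e)"
        using W1(1,2) W2(1,2) by (intro exI[of _ "W1 \<times> W2"]) (auto simp: openin_prod_Times_iff p0)
    qed (auto simp: topspace_dual_topology)
    show "continuous_map ?X ?X (\<lambda>\<gamma>. inv\<^bsub>dual_group G T\<^esub> \<gamma>)"
    proof (rule continuous_map_dual_topology)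
      fix K and e :: real and \<gamma>0
      assume K: "compactin T K" and e: "0 < e" and "\<gamma>0 \<in> topspace ?X"
      then have 0: "\<gamma>0 \<in> carrier (dual_group G T)" by (simp add: topspace_dual_topology)
      obtain W where W: "openin ?X W" "\<gamma>0 \<in> W"
          "\<And>\<gamma> x. \<gamma> \<in> W \<Longrightarrow> x \<in> K \<Longrightarrow> dist (\<gamma> x) (\<gamma>0 x) < e"
        using dual_uniform_neighbourhood[OF 0 K e] topspace_carrier by auto
      have "dist ((inv\<^bsub>dual_group G T\<^esub> \<gamma>) x) ((inv\<^bsub>dual_group G T\<^esub> \<gamma>0) x) < e"
        if "\<gamma> \<in> W" "x \<in> K" for \<gamma> x
      proof -
        have x: "x \<in> carrier G" using that(2) compactin_subset_topspace[OF K] topspace_carrier by auto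
        have \<gamma>: "\<gamma> \<in> carrier (dual_group G T)"
          using that(1) openin_subset[OF W(1)] by (auto simp: topspace_dual_topology)
        show ?thesis
          using W(3)[OF that] by (simp add: dual_inv_apply \<gamma> 0 x dist_norm flip: complex_cnj_diff)
      qed
      with W show "\<exists>W. openin ?X W \<and> \<gamma>0 \<in> W \<and> (\<forall>\<gamma>\<in>W. \<forall>x\<in>K.
          dist ((inv\<^bsub>dual_group G T\<^esub> \<gamma>) x) ((inv\<^bsub>dual_group G T\<^esub> \<gamma>0) x) < e)" by blast
    qed (auto simp: topspace_dual_topology)
  qed
qed

lemma (in topological_comm_group) Hausdorff_space_dual: "Hausdorff_space (dual_topology G T)"
  unfolding Hausdorff_space_def topspace_dual_topology
proof (intro allI impI, elim conjE)
  fix \<gamma> \<delta>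
  assume \<gamma>: "\<gamma> \<in> carrier (dual_group G T)" and \<delta>: "\<delta> \<in> carrier (dual_group G T)" and "\<gamma> \<noteq> \<delta>"
  then obtain x where x: "x \<in> carrier G" "\<gamma> x \<noteq> \<delta> x" using dual_carrier_eqI by blast
  then obtain U V where UV: "open U" "open V" "\<gamma> x \<in> U" "\<delta> x \<in> V" "U \<inter> V = {}"
    by (meson separation_t2)
  have "compactin T {x}" using x by (simp add: topspace_carrier)
  from openin_dual_subbase[OF this UV(1)] openin_dual_subbase[OF this UV(2)]
  show "\<exists>U V. openin (dual_topology G T) U \<and> openin (dual_topology G T) V \<and> \<gamma> \<in> U \<and> \<delta> \<in> V \<and> disjnt U V"
    using UV \<gamma> \<delta> by (intro exI conjI) (assumption | auto simp: disjnt_def)+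
qed

section \<open>Haar measures\<close>

lemma space_borel_of: "space (borel_of T) = topspace T"
  unfolding borel_of_def by (rule space_measure_of) (auto dest: openin_subset)

lemma openin_borel_of: "openin T U \<Longrightarrow> U \<in> sets (borel_of T)"
  unfolding borel_of_def by (subst sets_measure_of) (auto dest: openin_subset)

lemma closedin_borel_of: "closedin T C \<Longrightarrow> C \<in> sets (borel_of T)"
  using sets.compl_sets[OF openin_borel_of, of T "topspace T - C"]
  by (auto simp: closedin_def space_borel_of double_diff)

lemma haar_measure_sets: "haar_measure G T M \<Longrightarrow> sets M = sets (borel_of T)"
  by (simp add: haar_measure_def)

lemma haar_measure_space: "haar_measure G T M \<Longrightarrow> space M = topspace T"
  by (metis haar_measure_sets sets_eq_imp_space_eq space_borel_of)

lemma measurable_borel_ofI: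
  assumes "sets N = sets (borel_of T)" and "f \<in> space M \<rightarrow> topspace T"
    and "\<And>U. openin T U \<Longrightarrow> f -` U \<inter> space M \<in> sets M"
  shows "f \<in> M \<rightarrow>\<^sub>M N"
proof -
  have "f \<in> M \<rightarrow>\<^sub>M borel_of T"
    unfolding borel_of_def
    using assms(2,3) by (intro measurable_measure_of) (auto dest: openin_subset)
  then show ?thesis using measurable_cong_sets[OF refl assms(1)[symmetric]] by blast
qed

lemma continuous_map_measurable:
  assumes "sets M = sets (borel_of S)" "sets N = sets (borel_of T)" and "continuous_map S T f"
  shows "f \<in> M \<rightarrow>\<^sub>M N"
proof (rule measurable_borel_ofI[OF assms(2)])
  have sp: "space M = topspace S" using assms(1) by (metis sets_eq_imp_space_eq space_borel_of)
  then show "f \<in> space M \<rightarrow> topspace T" using assms(3) by (auto simp: continuous_map_def)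
  fix U assume "openin T U"
  then have "openin S {x \<in> topspace S. f x \<in> U}" using assms(3) by (rule openin_continuous_map_preimage[rotated])
  moreover have "f -` U \<inter> space M = {x \<in> topspace S. f x \<in> U}" by (auto simp: sp)
  ultimately show "f -` U \<inter> space M \<in> sets M" by (simp add: assms(1) openin_borel_of)
qed

lemma borel_eq_borel_of: "sets borel = sets (borel_of euclidean)"
  by (simp add: borel_def borel_of_def)

text \<open>
  For a second countable space the open sets of the square are countable unions of open
  rectangles, so continuous functions of two variables are measurable for the product measure.
\<close>

lemma continuous_map_measurable_pair:
  assumes T: "second_countable T" and M: "sets M = sets (borel_of T)"
    and N: "sets N = sets (borel_of S)" and f: "continuous_map (prod_topology T T) S f"
  shows "f \<in> M \<Otimes>\<^sub>M M \<rightarrow>\<^sub>M N"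
proof (rule measurable_borel_ofI[OF N])
  have sp: "space M = topspace T" using M by (metis sets_eq_imp_space_eq space_borel_of)
  then show "f \<in> space (M \<Otimes>\<^sub>M M) \<rightarrow> topspace S"
    using f by (auto simp: continuous_map_def space_pair_measure)
  fix U assume U: "openin S U"
  obtain \<B> where \<B>: "countable \<B>" "\<And>V. V \<in> \<B> \<Longrightarrow> openin T V"
      "\<And>U x. openin T U \<Longrightarrow> x \<in> U \<Longrightarrow> \<exists>V\<in>\<B>. x \<in> V \<and> V \<subseteq> U"
    using T unfolding second_countable_def by meson
  let ?P = "{p \<in> topspace (prod_topology T T). f p \<in> U}"
  have "openin (prod_topology T T) ?P" using f U by (rule openin_continuous_map_preimage)
  then have P: "\<exists>V\<in>\<B>. \<exists>W\<in>\<B>. x \<in> V \<and> y \<in> W \<and> V \<times> W \<subseteq> ?P" if "(x, y) \<in> ?P" for x y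
  proof -
    from that \<open>openin _ ?P\<close> obtain V0 W0 where 0: "openin T V0" "openin T W0" "x \<in> V0" "y \<in> W0" "V0 \<times> W0 \<subseteq> ?P"
      unfolding openin_prod_topology_alt by (elim allE impE) (assumption, elim exE conjE)
    obtain V where V: "V \<in> \<B>" "x \<in> V" "V \<subseteq> V0" using \<B>(3)[OF 0(1,3)] by (elim bexE conjE)
    obtain W where W: "W \<in> \<B>" "y \<in> W" "W \<subseteq> W0" using \<B>(3)[OF 0(2,4)] by (elim bexE conjE)
    have "V \<times> W \<subseteq> ?P" using Sigma_mono[OF V(3) W(3)] 0(5) by (rule order_trans)
    with V W show ?thesis by (intro bexI conjI)
  qed
  have "?P = (\<Union>(V, W)\<in>{(V, W) \<in> \<B> \<times> \<B>. V \<times> W \<subseteq> ?P}. V \<times> W)" (is "_ = ?R")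
  proof (intro subset_antisym subsetI)
    fix p assume p: "p \<in> ?P"
    obtain x y where xy: "p = (x, y)" by force
    from P[OF p[unfolded xy]] obtain V W where VW: "V \<in> \<B>" "W \<in> \<B>" "x \<in> V" "y \<in> W" "V \<times> W \<subseteq> ?P"
      by (elim bexE conjE)
    have "(V, W) \<in> {(V, W) \<in> \<B> \<times> \<B>. V \<times> W \<subseteq> ?P}" using VW by simp
    then show "p \<in> ?R" unfolding xy using VW(3,4) by (intro UN_I[of "(V, W)"]) auto
  next
    fix p assume "p \<in> ?R"
    then show "p \<in> ?P" by (elim UN_E) (auto dest: subsetD)
  qed
  moreover have "?R \<in> sets (M \<Otimes>\<^sub>M M)"
  proof (rule sets.countable_UN'')
    show "countable {(V, W) \<in> \<B> \<times> \<B>. V \<times> W \<subseteq> ?P}"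
      by (rule countable_subset[OF _ countable_SIGMA[OF \<B>(1) \<B>(1)]]) auto
  qed (auto simp: M intro!: openin_borel_of \<B>(2))
  moreover have "f -` U \<inter> space (M \<Otimes>\<^sub>M M) = ?P" by (auto simp: sp space_pair_measure)
  ultimately show "f -` U \<inter> space (M \<Otimes>\<^sub>M M) \<in> sets (M \<Otimes>\<^sub>M M)" by simp
qed

lemma (in topological_comm_group) haar_measurable_translation:
  assumes "haar_measure G T M" "x \<in> carrier G"
  shows "(\<lambda>y. x \<otimes> y) \<in> M \<rightarrow>\<^sub>M M"
  using haar_measure_sets[OF assms(1)] haar_measure_sets[OF assms(1)] continuous_translation[OF assms(2)]
  by (rule continuous_map_measurable)

lemma (in topological_comm_group) haar_translation_distr:
  assumes H: "haar_measure G T M" and x: "x \<in> carrier G"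
  shows "distr M M (\<lambda>y. x \<otimes> y) = M"
proof (rule measure_eqI)
  have sp: "space M = carrier G" using haar_measure_space[OF H] topspace_carrier by simp
  note m = haar_measurable_translation[OF H]
  fix A assume "A \<in> sets (distr M M (\<lambda>y. x \<otimes> y))"
  then have A: "A \<in> sets M" by simp
  then have AG: "A \<subseteq> carrier G" using sets.sets_into_space sp by blast
  have "(\<lambda>y. x \<otimes> y) -` A \<inter> space M = (\<lambda>y. inv x \<otimes> y) ` A"
  proof (intro subset_antisym subsetI)
    fix y assume y: "y \<in> (\<lambda>y. x \<otimes> y) -` A \<inter> space M"
    then have "y = inv x \<otimes> (x \<otimes> y)" using x sp by (simp add: m_assoc[symmetric])
    then show "y \<in> (\<lambda>y. inv x \<otimes> y) ` A" using y by blast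
  next
    fix y assume "y \<in> (\<lambda>y. inv x \<otimes> y) ` A"
    then obtain a where a: "a \<in> A" "y = inv x \<otimes> a" by blast
    then have "a \<in> carrier G" "x \<otimes> y = a" using AG x by (auto simp: m_assoc[symmetric])
    then show "y \<in> (\<lambda>y. x \<otimes> y) -` A \<inter> space M" using a x sp by auto
  qed
  moreover have "emeasure M ((\<lambda>y. inv x \<otimes> y) ` A) = emeasure M A"
    using H A x by (simp add: haar_measure_def)
  ultimately show "emeasure (distr M M (\<lambda>y. x \<otimes> y)) A = emeasure M A"
    using A m[OF x] by (simp add: emeasure_distr)
qed simp

lemma (in topological_comm_group) haar_nn_integral_translation:
  assumes "haar_measure G T M" "x \<in> carrier G" and [measurable]: "F \<in> borel_measurable M"
  shows "(\<integral>\<^sup>+y. F (x \<otimes> y) \<partial>M) = (\<integral>\<^sup>+y. F y \<partial>M)"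
  using nn_integral_distr[OF haar_measurable_translation[OF assms(1,2)], of F] assms(3)
  by (simp add: haar_translation_distr[OF assms(1,2)])

lemma (in topological_comm_group) haar_integral_translation:
  fixes F :: "'a \<Rightarrow> complex"
  assumes "haar_measure G T M" "x \<in> carrier G" and [measurable]: "F \<in> borel_measurable M"
  shows "(\<integral>y. F (x \<otimes> y) \<partial>M) = (\<integral>y. F y \<partial>M)"
  using integral_distr[OF haar_measurable_translation[OF assms(1,2)], of F] assms(3)
  by (simp add: haar_translation_distr[OF assms(1,2)])

section \<open>The short-time Fourier transform\<close>

locale gabor_setting = lca_group G T for G (structure) and T +
  fixes M :: "'a measure" and M' :: "('a \<Rightarrow> complex) measure"
  assumes second_countable: "second_countable T"
    and haar: "haar_measure G T M" and dual_haar: "dual_haar_measure G T M M'"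
begin

abbreviation "Gd \<equiv> dual_group G T"
abbreviation "P \<equiv> G \<times>\<times> Gd"

lemma sets_M: "sets M = sets (borel_of T)" by (rule haar_measure_sets[OF haar])
lemma space_M: "space M = carrier G" using haar_measure_space[OF haar] topspace_carrier by simp
lemma sets_M': "sets M' = sets (borel_of (dual_topology G T))"
  using dual_haar haar_measure_sets unfolding dual_haar_measure_def by blast
lemma space_M': "space M' = carrier Gd"
  using dual_haar haar_measure_space topspace_dual_topology unfolding dual_haar_measure_def by blast

lemma compact_base:
  "\<exists>\<B>. countable \<B> \<and> (\<forall>B\<in>\<B>. openin T B) \<and> (\<forall>B\<in>\<B>. compactin T (T closure_of B)) \<and>
    (\<forall>U x. openin T U \<longrightarrow> x \<in> U \<longrightarrow> (\<exists>B\<in>\<B>. x \<in> B \<and> T closure_of B \<subseteq> U))"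
proof -
  obtain \<C> where \<C>: "countable \<C>" "\<And>V. V \<in> \<C> \<Longrightarrow> openin T V"
      "\<And>U x. openin T U \<Longrightarrow> x \<in> U \<Longrightarrow> \<exists>V\<in>\<C>. x \<in> V \<and> V \<subseteq> U"
    using second_countable unfolding second_countable_def by meson
  have nb: "neighbourhood_base_of (\<lambda>C. compactin T C \<and> closedin T C) T"
    using locally_compact locally_compact_space_neighbourhood_base_closedin[of T] Hausdorff by simp
  show ?thesis
  proof (intro exI[of _ "{V \<in> \<C>. compactin T (T closure_of V)}"] conjI allI impI)
    fix U x assume U: "openin T U" "x \<in> U"
    have "\<exists>W C. openin T W \<and> (compactin T C \<and> closedin T C) \<and> x \<in> W \<and> W \<subseteq> C \<and> C \<subseteq> U"
      using nb U unfolding neighbourhood_base_of by blast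
    then obtain W C where C: "openin T W" "compactin T C" "closedin T C" "x \<in> W" "W \<subseteq> C" "C \<subseteq> U"
      by (elim exE conjE)
    obtain V where V: "V \<in> \<C>" "x \<in> V" "V \<subseteq> W" using \<C>(3)[OF C(1,4)] by (elim bexE conjE)
    have "T closure_of V \<subseteq> C" using V(3) C(5) C(3) by (intro closure_of_minimal) auto
    moreover have "compactin T (T closure_of V)"
      using calculation by (rule closed_compactin[OF C(2)]) simp
    ultimately show "\<exists>B\<in>{V \<in> \<C>. compactin T (T closure_of V)}. x \<in> B \<and> T closure_of B \<subseteq> U"
      using V C(6) by (intro bexI[of _ V]) auto
  qed (auto intro: \<C>(2) countable_subset[OF _ \<C>(1)])
qed

lemma emeasure_compact_finite: "compactin T K \<Longrightarrow> emeasure M K < \<infinity>"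
  using haar by (simp add: haar_measure_def)

lemma compactin_sets: "compactin T K \<Longrightarrow> K \<in> sets M"
  using compactin_imp_closedin[OF Hausdorff] closedin_borel_of sets_M by blast

lemma emeasure_relatively_compact_finite:
  assumes "openin T B" "compactin T (T closure_of B)"
  shows "emeasure M B < \<infinity>"
proof -
  have "emeasure M B \<le> emeasure M (T closure_of B)"
    using openin_subset[OF assms(1)]
    by (intro emeasure_mono closure_of_subset compactin_sets assms(2))
  then show ?thesis using emeasure_compact_finite[OF assms(2)] by (rule le_less_trans)
qed

lemma sigma_finite_M: "sigma_finite_measure M"
proof -
  from compact_base
  obtain \<B> where \<B>0: "countable \<B>" "\<forall>B\<in>\<B>. openin T B" "\<forall>B\<in>\<B>. compactin T (T closure_of B)"
    "\<forall>U x. openin T U \<longrightarrow> x \<in> U \<longrightarrow> (\<exists>B\<in>\<B>. x \<in> B \<and> T closure_of B \<subseteq> U)"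
    by (elim exE conjE)
  note \<B> = \<B>0[rule_format]
  have "\<Union>\<B> = space M"
    using \<B>(4)[OF openin_topspace] openin_subset[OF \<B>(2)] unfolding space_M topspace_carrier by blast
  moreover have "\<B> \<subseteq> sets M" using \<B>(2) openin_borel_of sets_M by blast
  moreover have "emeasure M B \<noteq> \<infinity>" if "B \<in> \<B>" for B
    using emeasure_relatively_compact_finite[OF \<B>(2)[OF that] \<B>(3)[OF that]] by simp
  ultimately show ?thesis using \<B>(1)
    by (intro sigma_finite_measure.intro exI[of _ \<B>] conjI ballI)
qed

sublocale M: sigma_finite_measure M by (rule sigma_finite_M)

lemma character_measurable: "\<gamma> \<in> carrier Gd \<Longrightarrow> \<gamma> \<in> borel_measurable M"
  using sets_M borel_eq_borel_of dual_carrier_continuous by (rule continuous_map_measurable)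

text \<open>
  The dual measure is \<open>\<sigma>\<close>-finite because the Fourier transforms of the indicators of the sets of a
  countable base are square-integrable and have no common zero: a character is nearly constant on
  small sets, so its integral over some basic set of positive measure is not \<open>0\<close>.
\<close>

lemma sigma_finite_M': "sigma_finite_measure M'"
proof -
  from compact_base
  obtain \<B> where \<B>0: "countable \<B>" "\<forall>B\<in>\<B>. openin T B" "\<forall>B\<in>\<B>. compactin T (T closure_of B)"
    "\<forall>U x. openin T U \<longrightarrow> x \<in> U \<longrightarrow> (\<exists>B\<in>\<B>. x \<in> B \<and> T closure_of B \<subseteq> U)"
    by (elim exE conjE)
  note \<B> = \<B>0[rule_format]
  have sets: "B \<in> sets M" and fin: "emeasure M B < \<infinity>" if "B \<in> \<B>" for B
    using that \<B>(2,3) emeasure_relatively_compact_finite openin_borel_of sets_M by blast+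
  have int: "integrable M (indicator B :: 'a \<Rightarrow> complex)" if "B \<in> \<B>" for B
  proof -
    have "integrable M (\<lambda>x. complex_of_real (indicator B x))"
      using sets[OF that] fin[OF that] by (intro integrable_of_real) (simp add: integrable_indicator_iff)
    moreover have "(\<lambda>x. complex_of_real (indicator B x)) = indicator B" by (auto simp: indicator_def)
    ultimately show ?thesis by simp
  qed
  define F where "F B = fourier_transform M (indicator B)" for B
  have F: "F B \<in> L2_space M'" if "B \<in> \<B>" for B
  proof -
    have 1: "integrable M (indicator B :: 'a \<Rightarrow> complex)" by (rule int[OF that])
    have "(\<lambda>x. (cmod (indicator B x))\<^sup>2) = (indicator B :: 'a \<Rightarrow> real)"
      by (auto simp: indicator_def)
    then have "(indicator B :: 'a \<Rightarrow> complex) \<in> L2_space M"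
      using sets[OF that] fin[OF that] by (simp add: L2_space_def integrable_indicator_iff)
    with 1 dual_haar show ?thesis unfolding dual_haar_measure_def F_def by blast
  qed
  define A where "A B n = {\<gamma> \<in> space M'. 1 / real (Suc n) \<le> (cmod (F B \<gamma>))\<^sup>2}" for B n
  have A_sets: "A B n \<in> sets M'" if "B \<in> \<B>" for B n
    using F[OF that] unfolding A_def by measurable
  have A_fin: "emeasure M' (A B n) \<noteq> \<infinity>" if "B \<in> \<B>" for B n
  proof -
    note F[OF that, measurable] A_sets[OF that, of n, measurable]
    have "ennreal (1 / real (Suc n)) * emeasure M' (A B n)
        = (\<integral>\<^sup>+\<gamma>. ennreal (1 / real (Suc n)) * indicator (A B n) \<gamma> \<partial>M')"
      by (simp add: nn_integral_cmult_indicator)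
    also have "\<dots> \<le> (\<integral>\<^sup>+\<gamma>. ennreal ((cmod (F B \<gamma>))\<^sup>2) \<partial>M')"
    proof (intro nn_integral_mono)
      fix \<gamma>
      show "ennreal (1 / real (Suc n)) * indicator (A B n) \<gamma> \<le> ennreal ((cmod (F B \<gamma>))\<^sup>2)"
        by (cases "\<gamma> \<in> A B n") (auto simp: A_def intro!: ennreal_leI)
    qed
    also have "\<dots> < \<infinity>" using F[OF that] by (simp add: L2_space_iff_nn_integral)
    finally show ?thesis by (auto simp: ennreal_mult_eq_top_iff ennreal_mult_less_top top_unique)
  qed
  have cover: "\<exists>B\<in>\<B>. \<exists>n. \<gamma> \<in> A B n" if \<gamma>: "\<gamma> \<in> carrier Gd" for \<gamma>
  proof -
    have "\<exists>x0\<in>carrier G. \<forall>B\<in>\<B>. x0 \<in> B \<longrightarrow> emeasure M B \<noteq> 0"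
    proof (rule ccontr)
      assume "\<not> ?thesis"
      then have "space M \<subseteq> (\<Union>B\<in>{B \<in> \<B>. emeasure M B = 0}. B)" unfolding space_M by blast
      moreover have "(\<Union>B\<in>{B \<in> \<B>. emeasure M B = 0}. B) \<in> null_sets M"
        using sets by (intro null_sets_UN') (auto intro: countable_subset[OF _ \<B>(1)] simp: null_sets_def)
      ultimately have "emeasure M (space M) = 0"
        by (meson null_setsD1 null_sets_subset sets.top)
      then show False using haar by (simp add: haar_measure_def)
    qed
    then obtain x0 where x0: "x0 \<in> carrier G" "\<And>B. B \<in> \<B> \<Longrightarrow> x0 \<in> B \<Longrightarrow> emeasure M B \<noteq> 0" by blast
    have "openin T {x \<in> topspace T. \<gamma> x \<in> ball (\<gamma> x0) (1/2)}"
      using dual_carrier_continuous[OF \<gamma>] by (rule openin_continuous_map_preimage) simp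
    moreover have "x0 \<in> {x \<in> topspace T. \<gamma> x \<in> ball (\<gamma> x0) (1/2)}"
      using x0 by (simp add: topspace_carrier)
    ultimately obtain B where B: "B \<in> \<B>" "x0 \<in> B" "T closure_of B \<subseteq> {x \<in> topspace T. \<gamma> x \<in> ball (\<gamma> x0) (1/2)}"
      using \<B>(4) by meson
    have near: "cmod (\<gamma> x0 - \<gamma> x) < 1/2" if "x \<in> B" for x
      using closure_of_subset[OF openin_subset[OF \<B>(2)[OF B(1)]]] B(3) that by (auto simp: dist_norm)
    let ?m = "measure M B"
    have m: "0 < ?m" using x0(2)[OF B(1,2)] fin[OF B(1)] by (simp add: emeasure_eq_ennreal_measure zero_less_measure_iff)
    have int: "integrable M (indicator B :: 'a \<Rightarrow> complex)" "integrable M (indicator B :: 'a \<Rightarrow> real)"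
      using int[OF B(1)] sets[OF B(1)] fin[OF B(1)] by (simp_all add: integrable_indicator_iff)
    have "(\<lambda>x. complex_of_real (indicator B x)) = indicator B" by (auto simp: indicator_def)
    then have meas: "(\<integral>x. indicator B x \<partial>M) = complex_of_real ?m"
      using integral_complex_of_real[of M "indicator B"] sets[OF B(1)] by (simp add: sets.Int_space_eq2)
    have int2: "integrable M (\<lambda>x. indicator B x * cnj (\<gamma> x))"
    proof (rule Bochner_Integration.integrable_bound[OF int(1)])
      show "(\<lambda>x. indicator B x * cnj (\<gamma> x)) \<in> borel_measurable M"
        using character_measurable[OF \<gamma>] sets[OF B(1)] by measurable
      show "AE x in M. norm (indicator B x * cnj (\<gamma> x)) \<le> norm (indicator B x :: complex)"
        using dual_carrier_norm[OF \<gamma>] by (intro AE_I2) (simp add: norm_mult space_M)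
    qed
    have "F B \<gamma> \<noteq> 0"
    proof
      assume "F B \<gamma> = 0"
      then have "(\<integral>x. indicator B x * cnj (\<gamma> x0) - indicator B x * cnj (\<gamma> x) \<partial>M) = of_real ?m * cnj (\<gamma> x0)"
        using int int2 meas
        by (simp add: F_def fourier_transform_def)
      then have "?m = cmod (\<integral>x. indicator B x * cnj (\<gamma> x0) - indicator B x * cnj (\<gamma> x) \<partial>M)"
        using dual_carrier_norm[OF \<gamma> x0(1)] by (simp add: norm_mult)
      also have "\<dots> \<le> (\<integral>x. indicator B x * (1/2) \<partial>M)"
      proof (rule order_trans[OF integral_norm_bound integral_mono])
        fix x assume "x \<in> space M"
        show "norm (indicator B x * cnj (\<gamma> x0) - indicator B x * cnj (\<gamma> x)) \<le> indicator B x * (1/2)"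
          using near[of x] complex_mod_cnj[of "\<gamma> x0 - \<gamma> x"] by (cases "x \<in> B") simp_all
      qed (use int int2 in simp_all)
      also have "\<dots> = ?m / 2" using sets[OF B(1)] by (simp add: sets.Int_space_eq2)
      finally show False using m by simp
    qed
    then have "0 < (cmod (F B \<gamma>))\<^sup>2" by simp
    then obtain n where "1 / real (Suc n) < (cmod (F B \<gamma>))\<^sup>2" by (rule nat_approx_posE)
    then have "\<gamma> \<in> A B n" using \<gamma> by (simp add: A_def space_M')
    with B(1) show ?thesis by blast
  qed
  let ?C = "(\<lambda>(B, n). A B n) ` (\<B> \<times> UNIV)"
  have "countable ?C" using \<B>(1) by (intro countable_image countable_SIGMA) auto
  moreover have "?C \<subseteq> sets M'" using A_sets by auto
  moreover have "\<Union>?C = space M'" using cover by (force simp: A_def space_M')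
  moreover have "\<forall>a\<in>?C. emeasure M' a \<noteq> \<infinity>" using A_fin by auto
  ultimately show ?thesis by (intro sigma_finite_measure.intro exI[of _ ?C] conjI)
qed

sublocale M': sigma_finite_measure M' by (rule sigma_finite_M')
sublocale MM': pair_sigma_finite M M' ..
sublocale MM: pair_sigma_finite M M ..

text \<open>
  A value \<open>\<gamma> x\<close> lies in an open set \<open>U\<close> exactly if a basic neighbourhood of \<open>x\<close> has compact closure
  sent into \<open>U\<close> by \<open>\<gamma>\<close>. So the preimage of \<open>U\<close> is a countable union of rectangles, whose second sides
  are open by definition of the compact-open topology.
\<close>

lemma evaluation_measurable: "(\<lambda>(x, \<gamma>). \<gamma> x) \<in> borel_measurable (M \<Otimes>\<^sub>M M')"
proof (rule borel_measurableI)
  fix U :: "complex set" assume U: "open U"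
  from compact_base
  obtain \<B> where \<B>0: "countable \<B>" "\<forall>B\<in>\<B>. openin T B" "\<forall>B\<in>\<B>. compactin T (T closure_of B)"
    "\<forall>U x. openin T U \<longrightarrow> x \<in> U \<longrightarrow> (\<exists>B\<in>\<B>. x \<in> B \<and> T closure_of B \<subseteq> U)"
    by (elim exE conjE)
  note \<B> = \<B>0[rule_format]
  let ?R = "\<Union>B\<in>\<B>. B \<times> {\<gamma> \<in> carrier Gd. \<gamma> ` (T closure_of B) \<subseteq> U}"
  have "(\<lambda>(x, \<gamma>). \<gamma> x) -` U \<inter> space (M \<Otimes>\<^sub>M M') = ?R"
  proof (intro subset_antisym subsetI)
    fix p assume p: "p \<in> (\<lambda>(x, \<gamma>). \<gamma> x) -` U \<inter> space (M \<Otimes>\<^sub>M M')"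
    obtain x \<gamma> where xg: "p = (x, \<gamma>)" by force
    with p have x: "x \<in> carrier G" "\<gamma> \<in> carrier Gd" "\<gamma> x \<in> U"
      by (auto simp: space_pair_measure space_M space_M')
    have "openin T {y \<in> topspace T. \<gamma> y \<in> U}"
      using dual_carrier_continuous[OF x(2)] U by (intro openin_continuous_map_preimage) auto
    moreover have "x \<in> {y \<in> topspace T. \<gamma> y \<in> U}" using x by (simp add: topspace_carrier)
    ultimately obtain B where "B \<in> \<B>" "x \<in> B" "T closure_of B \<subseteq> {y \<in> topspace T. \<gamma> y \<in> U}"
      using \<B>(4) by meson
    then show "p \<in> ?R" unfolding xg using x by (intro UN_I[of B]) auto
  next
    fix p assume "p \<in> ?R"
    then obtain B where B: "B \<in> \<B>" "p \<in> B \<times> {\<gamma> \<in> carrier Gd. \<gamma> ` (T closure_of B) \<subseteq> U}" by blast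
    have "B \<subseteq> carrier G" "B \<subseteq> T closure_of B"
      using openin_subset[OF \<B>(2)[OF B(1)]] closure_of_subset[of B T] topspace_carrier by simp_all
    with B show "p \<in> (\<lambda>(x, \<gamma>). \<gamma> x) -` U \<inter> space (M \<Otimes>\<^sub>M M')"
      by (auto simp: space_pair_measure space_M space_M')
  qed
  moreover have "?R \<in> sets (M \<Otimes>\<^sub>M M')"
    using \<B>(1)
    by (intro sets.countable_UN'' pair_measureI)
      (auto simp: sets_M sets_M' intro!: openin_borel_of openin_dual_subbase \<B>(2,3) U)
  ultimately show "(\<lambda>(x, \<gamma>). \<gamma> x) -` U \<inter> space (M \<Otimes>\<^sub>M M') \<in> sets (M \<Otimes>\<^sub>M M')" by simp
qed

lemma div_measurable [measurable]: "(\<lambda>(x, l). x \<otimes> inv l) \<in> M \<Otimes>\<^sub>M M \<rightarrow>\<^sub>M M"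
proof (rule continuous_map_measurable_pair[OF second_countable sets_M sets_M])
  show "continuous_map (prod_topology T T) T (\<lambda>(x, l). x \<otimes> inv l)"
    unfolding case_prod_unfold
    by (intro continuous_map_mult continuous_map_inv continuous_map_fst continuous_map_snd)
qed

lemma mult_measurable [measurable]: "(\<lambda>(x, l). x \<otimes> l) \<in> M \<Otimes>\<^sub>M M \<rightarrow>\<^sub>M M"
  by (rule continuous_map_measurable_pair[OF second_countable sets_M sets_M continuous_mult])

lemma gabor_analysis_measurable:
  assumes [measurable]: "f \<in> borel_measurable M" "u \<in> borel_measurable M"
  shows "gabor_analysis G M u f \<in> borel_measurable (M \<Otimes>\<^sub>M M')"
proof -
  have 1: "(\<lambda>q. snd (fst q) (snd q)) \<in> borel_measurable ((M \<Otimes>\<^sub>M M') \<Otimes>\<^sub>M M)"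
    using measurable_compose[OF _ evaluation_measurable, of "\<lambda>q. (snd q, snd (fst q))" "(M \<Otimes>\<^sub>M M') \<Otimes>\<^sub>M M"]
    by simp
  have 2: "(\<lambda>q. snd q \<otimes> inv (fst (fst q))) \<in> (M \<Otimes>\<^sub>M M') \<Otimes>\<^sub>M M \<rightarrow>\<^sub>M M"
    using measurable_compose[OF _ div_measurable, of "\<lambda>q. (snd q, fst (fst q))" "(M \<Otimes>\<^sub>M M') \<Otimes>\<^sub>M M"]
    by simp
  note [measurable] = 1 measurable_compose[OF 2 assms(2)]
  have "(\<lambda>(\<xi>, x). f x * cnj (time_frequency_shift G \<xi> u x)) \<in> borel_measurable ((M \<Otimes>\<^sub>M M') \<Otimes>\<^sub>M M)"
    unfolding time_frequency_shift_def modulation_def translation_def case_prod_unfold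
    by measurable
  then show ?thesis
    unfolding gabor_analysis_def L2_inner_def by (rule M.borel_measurable_lebesgue_integral)
qed

text \<open>
  The substitution \<open>x \<mapsto> x l\<close> for fixed \<open>l\<close> moves the translation onto \<open>\<phi>\<close>; after a change of the order
  of integration, the integral over \<open>l\<close> for fixed \<open>x\<close> is again that of a translate.
\<close>

lemma nn_integral_translation_product:
  assumes [measurable]: "\<phi> \<in> borel_measurable M" "\<psi> \<in> borel_measurable M"
  shows "(\<integral>\<^sup>+l. \<integral>\<^sup>+x. \<phi> x * \<psi> (x \<otimes> inv l) \<partial>M \<partial>M) = (\<integral>\<^sup>+x. \<phi> x \<partial>M) * (\<integral>\<^sup>+x. \<psi> x \<partial>M)"
proof -
  have [measurable]: "(\<lambda>x. x \<otimes> inv l) \<in> M \<rightarrow>\<^sub>M M" "(\<lambda>x. l \<otimes> x) \<in> M \<rightarrow>\<^sub>M M" if "l \<in> carrier G" for l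
    using measurable_compose[OF measurable_Pair2'[of l M M] mult_measurable]
      measurable_compose[OF measurable_Pair1'[of l M M] div_measurable] that by (simp_all add: space_M)
  have "(\<integral>\<^sup>+l. \<integral>\<^sup>+x. \<phi> x * \<psi> (x \<otimes> inv l) \<partial>M \<partial>M) = (\<integral>\<^sup>+l. \<integral>\<^sup>+x. \<phi> (x \<otimes> l) * \<psi> x \<partial>M \<partial>M)"
  proof (rule nn_integral_cong)
    fix l assume "l \<in> space M"
    then have l: "l \<in> carrier G" by (simp add: space_M)
    note [measurable] = l
    have "(\<integral>\<^sup>+x. \<phi> x * \<psi> (x \<otimes> inv l) \<partial>M) = (\<integral>\<^sup>+x. \<phi> (l \<otimes> x) * \<psi> (l \<otimes> x \<otimes> inv l) \<partial>M)"
      by (rule haar_nn_integral_translation[OF haar l, symmetric]) measurable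
    also have "\<dots> = (\<integral>\<^sup>+x. \<phi> (x \<otimes> l) * \<psi> x \<partial>M)"
    proof (rule nn_integral_cong)
      fix x assume "x \<in> space M"
      then have "l \<otimes> x \<otimes> inv l = x" "l \<otimes> x = x \<otimes> l"
        using l by (simp_all add: space_M m_comm[of l x] m_assoc)
      then show "\<phi> (l \<otimes> x) * \<psi> (l \<otimes> x \<otimes> inv l) = \<phi> (x \<otimes> l) * \<psi> x" by simp
    qed
    finally show "(\<integral>\<^sup>+x. \<phi> x * \<psi> (x \<otimes> inv l) \<partial>M) = (\<integral>\<^sup>+x. \<phi> (x \<otimes> l) * \<psi> x \<partial>M)" .
  qed
  also have "\<dots> = (\<integral>\<^sup>+x. \<integral>\<^sup>+l. \<phi> (x \<otimes> l) * \<psi> x \<partial>M \<partial>M)"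
  proof (rule MM.Fubini'[of "\<lambda>l x. \<phi> (x \<otimes> l) * \<psi> x", symmetric])
    have "(\<lambda>p. snd p \<otimes> fst p) \<in> M \<Otimes>\<^sub>M M \<rightarrow>\<^sub>M M"
      using measurable_compose[OF _ mult_measurable, of "\<lambda>p. (snd p, fst p)" "M \<Otimes>\<^sub>M M"] by simp
    from measurable_compose[OF this assms(1)]
    show "(\<lambda>(l, x). \<phi> (x \<otimes> l) * \<psi> x) \<in> borel_measurable (M \<Otimes>\<^sub>M M)"
      unfolding case_prod_unfold by measurable
  qed
  also have "\<dots> = (\<integral>\<^sup>+x. (\<integral>\<^sup>+l. \<phi> l \<partial>M) * \<psi> x \<partial>M)"
  proof (rule nn_integral_cong)
    fix x assume "x \<in> space M"
    then have x: "x \<in> carrier G" by (simp add: space_M)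
    note [measurable] = haar_measurable_translation[OF haar x]
    show "(\<integral>\<^sup>+l. \<phi> (x \<otimes> l) * \<psi> x \<partial>M) = (\<integral>\<^sup>+l. \<phi> l \<partial>M) * \<psi> x"
      by (simp add: nn_integral_multc haar_nn_integral_translation[OF haar x])
  qed
  also have "\<dots> = (\<integral>\<^sup>+x. \<phi> x \<partial>M) * (\<integral>\<^sup>+x. \<psi> x \<partial>M)"
    by (rule nn_integral_cmult) measurable
  finally show ?thesis .
qed

lemma translation_measurable:
  "l \<in> carrier G \<Longrightarrow> u \<in> borel_measurable M \<Longrightarrow> translation G l u \<in> borel_measurable M"
  unfolding translation_def
  using measurable_compose[OF measurable_Pair1'[of l M M] div_measurable] by (simp add: space_M measurable_compose)

lemma translation_L2:
  assumes l: "l \<in> carrier G" and u: "u \<in> L2_space M"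
  shows "translation G l u \<in> L2_space M"
proof -
  have "(\<integral>\<^sup>+x. ennreal ((cmod (u (x \<otimes> inv l)))\<^sup>2) \<partial>M) = (\<integral>\<^sup>+x. ennreal ((cmod (u (inv l \<otimes> x)))\<^sup>2) \<partial>M)"
    using l by (intro nn_integral_cong) (simp add: space_M m_comm)
  also have "\<dots> = (\<integral>\<^sup>+x. ennreal ((cmod (u x))\<^sup>2) \<partial>M)"
    using l u by (intro haar_nn_integral_translation[OF haar]) auto
  finally show ?thesis
    using u translation_measurable[OF l] by (simp add: L2_space_iff_nn_integral translation_def)
qed

lemma time_frequency_shift_L2:
  assumes \<nu>: "\<nu> \<in> carrier P" and u: "u \<in> L2_space M"
  shows "time_frequency_shift G \<nu> u \<in> L2_space M"
proof -
  have l: "fst \<nu> \<in> carrier G" and \<gamma>: "snd \<nu> \<in> carrier Gd" using \<nu> by (auto simp: DirProd_def)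
  note t = translation_L2[OF l u]
  have "(\<integral>\<^sup>+x. ennreal ((cmod (snd \<nu> x * translation G (fst \<nu>) u x))\<^sup>2) \<partial>M)
      = (\<integral>\<^sup>+x. ennreal ((cmod (translation G (fst \<nu>) u x))\<^sup>2) \<partial>M)"
    by (intro nn_integral_cong) (simp add: norm_mult dual_carrier_norm[OF \<gamma>] space_M)
  then show ?thesis
    using t borel_measurable_times[OF character_measurable[OF \<gamma>] L2_space_measurable[OF t]]
    by (simp add: L2_space_iff_nn_integral time_frequency_shift_def modulation_def[abs_def])
qed

text \<open>
  Plancherel's theorem in the frequency variable followed by Tonelli's theorem in the remaining
  two. Boundedness of \<open>f\<close> ensures that \<open>f\<close> times a translate of \<open>u\<close> is square-integrable for every,
  rather than almost every, translate.
\<close>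

lemma stft_isometry:
  assumes f: "f \<in> L2_space M" and b: "\<And>x. x \<in> carrier G \<Longrightarrow> cmod (f x) \<le> b" and u: "u \<in> L2_space M"
  shows "gabor_analysis G M u f \<in> L2_space (M \<Otimes>\<^sub>M M')"
    and "L2_norm (M \<Otimes>\<^sub>M M') (gabor_analysis G M u f) = L2_norm M f * L2_norm M u"
proof -
  note [measurable] = f u
  let ?V = "gabor_analysis G M u f"
  have V[measurable]: "?V \<in> borel_measurable (M \<Otimes>\<^sub>M M')"
    by (rule gabor_analysis_measurable) measurable
  have inner: "(\<integral>\<^sup>+\<gamma>. ennreal ((cmod (?V (l, \<gamma>)))\<^sup>2) \<partial>M')
      = (\<integral>\<^sup>+x. ennreal ((cmod (f x))\<^sup>2) * ennreal ((cmod (u (x \<otimes> inv l)))\<^sup>2) \<partial>M)"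
    if "l \<in> space M" for l
  proof -
    have l: "l \<in> carrier G" using that by (simp add: space_M)
    let ?\<phi> = "\<lambda>x. f x * cnj (translation G l u x)"
    have t: "translation G l u \<in> L2_space M" by (rule translation_L2[OF l u])
    note [measurable] = t
    have int: "integrable M ?\<phi>" by (rule L2_mult_integrable[OF f t])
    have "integrable M (\<lambda>x. (cmod (?\<phi> x))\<^sup>2)"
    proof (rule Bochner_Integration.integrable_bound)
      show "integrable M (\<lambda>x. b\<^sup>2 * (cmod (translation G l u x))\<^sup>2)"
        using L2_space_integrable_square[OF t] by simp
      show "AE x in M. norm ((cmod (?\<phi> x))\<^sup>2) \<le> norm (b\<^sup>2 * (cmod (translation G l u x))\<^sup>2)"
        using b by (intro AE_I2) (auto simp: space_M norm_mult power_mult_distrib intro!: mult_right_mono power_mono)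
    qed measurable
    then have L2: "?\<phi> \<in> L2_space M" by (simp add: L2_space_def)
    have eq: "?V (l, \<gamma>) = fourier_transform M ?\<phi> \<gamma>" for \<gamma>
      unfolding gabor_analysis_def L2_inner_def fourier_transform_def time_frequency_shift_def modulation_def
      by (intro Bochner_Integration.integral_cong) auto
    have FT: "fourier_transform M ?\<phi> \<in> L2_space M'" "L2_norm M' (fourier_transform M ?\<phi>) = L2_norm M ?\<phi>"
      using dual_haar int L2 unfolding dual_haar_measure_def by blast+
    have "(\<integral>\<^sup>+\<gamma>. ennreal ((cmod (?V (l, \<gamma>)))\<^sup>2) \<partial>M') = ennreal ((L2_norm M ?\<phi>)\<^sup>2)"
      unfolding eq nn_integral_L2_norm[OF FT(1)] FT(2) ..
    also have "\<dots> = (\<integral>\<^sup>+x. ennreal ((cmod (?\<phi> x))\<^sup>2) \<partial>M)" by (rule nn_integral_L2_norm[OF L2, symmetric])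
    finally show ?thesis by (simp add: translation_def norm_mult power_mult_distrib ennreal_mult)
  qed
  have "(\<integral>\<^sup>+\<xi>. ennreal ((cmod (?V \<xi>))\<^sup>2) \<partial>(M \<Otimes>\<^sub>M M'))
      = (\<integral>\<^sup>+l. \<integral>\<^sup>+\<gamma>. ennreal ((cmod (?V (l, \<gamma>)))\<^sup>2) \<partial>M' \<partial>M)"
    by (rule M'.nn_integral_fst[symmetric]) measurable
  also have "\<dots> = (\<integral>\<^sup>+l. \<integral>\<^sup>+x. ennreal ((cmod (f x))\<^sup>2) * ennreal ((cmod (u (x \<otimes> inv l)))\<^sup>2) \<partial>M \<partial>M)"
    by (rule nn_integral_cong) (rule inner)
  also have "\<dots> = (\<integral>\<^sup>+x. ennreal ((cmod (f x))\<^sup>2) \<partial>M) * (\<integral>\<^sup>+x. ennreal ((cmod (u x))\<^sup>2) \<partial>M)"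
    by (rule nn_integral_translation_product) measurable
  also have "\<dots> = ennreal ((L2_norm M f * L2_norm M u)\<^sup>2)"
    by (simp add: nn_integral_L2_norm f u ennreal_mult power_mult_distrib)
  finally have *: "(\<integral>\<^sup>+\<xi>. ennreal ((cmod (?V \<xi>))\<^sup>2) \<partial>(M \<Otimes>\<^sub>M M')) = ennreal ((L2_norm M f * L2_norm M u)\<^sup>2)" .
  then show L2: "?V \<in> L2_space (M \<Otimes>\<^sub>M M')" by (simp add: L2_space_iff_nn_integral)
  show "L2_norm (M \<Otimes>\<^sub>M M') ?V = L2_norm M f * L2_norm M u"
    using * unfolding nn_integral_L2_norm[OF L2] by (simp add: power2_eq_iff_nonneg)
qed

lemma gabor_analysis_window_add_mult:
  assumes "f \<in> L2_space M" "u \<in> L2_space M" "w \<in> L2_space M" "\<nu> \<in> carrier P"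
  shows "gabor_analysis G M (\<lambda>x. u x + c * w x) f \<nu> = gabor_analysis G M u f \<nu> + cnj c * gabor_analysis G M w f \<nu>"
proof -
  have "time_frequency_shift G \<nu> (\<lambda>x. u x + c * w x)
      = (\<lambda>x. time_frequency_shift G \<nu> u x + c * time_frequency_shift G \<nu> w x)"
    by (simp add: fun_eq_iff time_frequency_shift_def modulation_def translation_def algebra_simps)
  then show ?thesis
    unfolding gabor_analysis_def using assms by (simp add: L2_inner_add_mult_right time_frequency_shift_L2)
qed

text \<open>The orthogonality relations, by polarising the isometry in the window.\<close>

lemma stft_orthogonality:
  assumes f: "f \<in> L2_space M" and b: "\<And>x. x \<in> carrier G \<Longrightarrow> cmod (f x) \<le> b"
    and u: "u \<in> L2_space M" and w: "w \<in> L2_space M"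
  shows "L2_inner (M \<Otimes>\<^sub>M M') (gabor_analysis G M u f) (gabor_analysis G M w f)
      = of_real ((L2_norm M f)\<^sup>2) * L2_inner M w u"
proof -
  let ?N = "M \<Otimes>\<^sub>M M'" and ?V = "\<lambda>u. gabor_analysis G M u f"
  let ?z = "L2_inner ?N (?V u) (?V w)" and ?r = "of_real ((L2_norm M f)\<^sup>2) * L2_inner M w u"
  note iso = stft_isometry[OF f b]
  have "Re (c * ?z) = Re (c * ?r)" for c
  proof -
    have uw: "(\<lambda>x. u x + c * w x) \<in> L2_space M" by (intro L2_space_add_mult u w)
    have "(L2_norm ?N (\<lambda>\<xi>. ?V u \<xi> + cnj c * ?V w \<xi>))\<^sup>2 = (L2_norm ?N (?V (\<lambda>x. u x + c * w x)))\<^sup>2"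
      by (intro arg_cong[where f = "\<lambda>t. t\<^sup>2"] L2_norm_cong)
        (simp add: gabor_analysis_window_add_mult f u w space_pair_measure space_M space_M' DirProd_def)
    also have "\<dots> = (L2_norm M f)\<^sup>2 * (L2_norm M (\<lambda>x. u x + c * w x))\<^sup>2"
      by (simp add: iso(2)[OF _ uw] power_mult_distrib)
    finally have "2 * Re (c * ?z) = (L2_norm M f)\<^sup>2 * (2 * Re (cnj c * L2_inner M u w))"
      using L2_norm_add_mult_square[OF iso(1)[OF _ u] iso(1)[OF _ w], of "cnj c"]
        L2_norm_add_mult_square[OF u w, of c]
      by (simp add: iso(2)[OF _ u] iso(2)[OF _ w] power_mult_distrib algebra_simps)
    also have "Re (cnj c * L2_inner M u w) = Re (c * L2_inner M w u)"
      by (subst L2_inner_commute[of M w u]) simp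
    finally show ?thesis by (simp add: algebra_simps)
  qed
  from this[of 1] this[of \<i>] show ?thesis by (simp add: complex_eq_iff)
qed

end

section \<open>The algebra of time-frequency shifts\<close>

text \<open>
  Splitting elements of the time-frequency plane into pairs would hide the group laws of the plane
  and membership in \<open>\<Delta>\<close> from the simplifier.
\<close>

declare carrier_DirProd [simp del] one_DirProd [simp del] mult_DirProd [simp del]

context gabor_setting
begin

lemma carrier_P: "\<nu> \<in> carrier P \<longleftrightarrow> fst \<nu> \<in> carrier G \<and> snd \<nu> \<in> carrier Gd"
  by (cases \<nu>) (simp add: carrier_DirProd)

lemma mult_P: "\<xi> \<otimes>\<^bsub>P\<^esub> \<nu> = (fst \<xi> \<otimes> fst \<nu>, snd \<xi> \<otimes>\<^bsub>Gd\<^esub> snd \<nu>)"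
  by (simp add: mult_DirProd')

lemma topological_comm_group_P: "topological_comm_group P (prod_topology T (dual_topology G T))"
  using topological_comm_group_axioms topological_comm_group_dual by (rule topological_comm_group_DirProd)

sublocale P: topological_comm_group P "prod_topology T (dual_topology G T)"
  by (rule topological_comm_group_P)

lemma time_frequency_shift_apply:
  "time_frequency_shift G \<nu> u x = snd \<nu> x * u (x \<otimes> inv fst \<nu>)"
  by (simp add: time_frequency_shift_def modulation_def translation_def)

text \<open>The adjoint, and inverse, of the unitary operator \<open>\<pi>(\<nu>)\<close>.\<close>

definition adjoint_shift :: "'a \<times> ('a \<Rightarrow> complex) \<Rightarrow> ('a \<Rightarrow> complex) \<Rightarrow> 'a \<Rightarrow> complex" where
  "adjoint_shift \<nu> f = translation G (inv fst \<nu>) (\<lambda>y. cnj (snd \<nu> y) * f y)"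

lemma adjoint_shift_L2:
  assumes \<nu>: "\<nu> \<in> carrier P" and f: "f \<in> L2_space M"
  shows "adjoint_shift \<nu> f \<in> L2_space M"
proof -
  have l: "fst \<nu> \<in> carrier G" and \<gamma>: "snd \<nu> \<in> carrier Gd" using \<nu> by (simp_all add: carrier_P)
  note [measurable] = character_measurable[OF \<gamma>] f
  have "(\<integral>\<^sup>+x. ennreal ((cmod (cnj (snd \<nu> x) * f x))\<^sup>2) \<partial>M) = (\<integral>\<^sup>+x. ennreal ((cmod (f x))\<^sup>2) \<partial>M)"
    by (intro nn_integral_cong) (simp add: norm_mult dual_carrier_norm[OF \<gamma>] space_M)
  moreover have "(\<lambda>x. cnj (snd \<nu> x) * f x) \<in> borel_measurable M" by measurable
  ultimately have "(\<lambda>x. cnj (snd \<nu> x) * f x) \<in> L2_space M"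
    using f by (simp add: L2_space_iff_nn_integral)
  then show ?thesis unfolding adjoint_shift_def by (rule translation_L2[OF inv_closed[OF l]])
qed

lemma L2_inner_time_frequency_shift:
  assumes \<nu>: "\<nu> \<in> carrier P" and f: "f \<in> L2_space M" and w: "w \<in> L2_space M"
  shows "L2_inner M f (time_frequency_shift G \<nu> w) = L2_inner M (adjoint_shift \<nu> f) w"
proof -
  have l: "fst \<nu> \<in> carrier G" and \<gamma>: "snd \<nu> \<in> carrier Gd" using \<nu> by (simp_all add: carrier_P)
  note [measurable] = f time_frequency_shift_L2[OF \<nu> w]
  have "L2_inner M f (time_frequency_shift G \<nu> w)
      = (\<integral>x. f (fst \<nu> \<otimes> x) * cnj (time_frequency_shift G \<nu> w (fst \<nu> \<otimes> x)) \<partial>M)"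
    unfolding L2_inner_def by (rule haar_integral_translation[OF haar l, symmetric]) measurable
  also have "\<dots> = L2_inner M (adjoint_shift \<nu> f) w"
    unfolding L2_inner_def
  proof (intro Bochner_Integration.integral_cong refl)
    fix x assume "x \<in> space M"
    then have "x \<otimes> fst \<nu> \<otimes> inv fst \<nu> = x" "fst \<nu> \<otimes> x = x \<otimes> fst \<nu>"
      using l by (simp_all add: space_M m_comm[of "fst \<nu>" x] m_assoc)
    then show "f (fst \<nu> \<otimes> x) * cnj (time_frequency_shift G \<nu> w (fst \<nu> \<otimes> x)) = adjoint_shift \<nu> f x * cnj (w x)"
      using l by (simp add: adjoint_shift_def translation_def time_frequency_shift_apply)
  qed
  finally show ?thesis .
qed

lemma character_cnj_cancel:
  assumes "\<gamma> \<in> carrier Gd" "x \<in> carrier G"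
  shows "cnj (\<gamma> x) * \<gamma> x = 1" "\<gamma> x * cnj (\<gamma> x) = 1"
  using dual_carrier_norm[OF assms] complex_norm_square[of "\<gamma> x"] by (simp_all add: mult.commute)

lemma time_frequency_shift_adjoint_shift:
  assumes "\<nu> \<in> carrier P" "x \<in> carrier G"
  shows "time_frequency_shift G \<nu> (adjoint_shift \<nu> f) x = f x"
    and "adjoint_shift \<nu> (time_frequency_shift G \<nu> f) x = f x"
proof -
  have l: "fst \<nu> \<in> carrier G" and \<gamma>: "snd \<nu> \<in> carrier Gd" using assms by (simp_all add: carrier_P)
  have "x \<otimes> inv fst \<nu> \<otimes> fst \<nu> = x" "x \<otimes> fst \<nu> \<otimes> inv fst \<nu> = x"
    using assms(2) l by (simp_all add: m_assoc)
  then show "time_frequency_shift G \<nu> (adjoint_shift \<nu> f) x = f x"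
    and "adjoint_shift \<nu> (time_frequency_shift G \<nu> f) x = f x"
    using character_cnj_cancel[OF \<gamma>] assms(2) l
    by (simp_all add: time_frequency_shift_apply adjoint_shift_def translation_def mult.assoc[symmetric])
qed

lemma time_frequency_shift_unitary:
  assumes \<nu>: "\<nu> \<in> carrier P" and u: "u \<in> L2_space M" and w: "w \<in> L2_space M"
  shows "L2_inner M (time_frequency_shift G \<nu> u) (time_frequency_shift G \<nu> w) = L2_inner M u w"
  unfolding L2_inner_time_frequency_shift[OF \<nu> time_frequency_shift_L2[OF \<nu> u] w]
  by (rule L2_inner_cong) (simp_all add: time_frequency_shift_adjoint_shift \<nu> space_M)

lemma L2_norm_time_frequency_shift:
  assumes "\<nu> \<in> carrier P" "u \<in> L2_space M"
  shows "L2_norm M (time_frequency_shift G \<nu> u) = L2_norm M u"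
  using time_frequency_shift_unitary[OF assms assms(2)]
  by (simp add: L2_inner_self power2_eq_iff_nonneg del: of_real_power)

lemma L2_norm_adjoint_shift:
  assumes \<nu>: "\<nu> \<in> carrier P" and f: "f \<in> L2_space M"
  shows "L2_norm M (adjoint_shift \<nu> f) = L2_norm M f"
proof -
  have "L2_norm M (adjoint_shift \<nu> f) = L2_norm M (time_frequency_shift G \<nu> (adjoint_shift \<nu> f))"
    using L2_norm_time_frequency_shift[OF \<nu> adjoint_shift_L2[OF \<nu> f]] by simp
  also have "\<dots> = L2_norm M f"
    by (rule L2_norm_cong) (simp add: time_frequency_shift_adjoint_shift \<nu> space_M)
  finally show ?thesis .
qed

text \<open>
  Time-frequency shifts form a projective representation: composing two of them costs a
  unimodular factor, which cancels when one coefficient is multiplied by the conjugate of another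
  one at the same point.
\<close>

lemma gabor_analysis_compose:
  assumes \<xi>: "\<xi> \<in> carrier P" and \<nu>: "\<nu> \<in> carrier P" and u: "u \<in> L2_space M" and f: "f \<in> L2_space M"
  shows "gabor_analysis G M u (adjoint_shift \<xi> f) \<nu>
      = snd \<nu> (fst \<xi>) * gabor_analysis G M u f (\<xi> \<otimes>\<^bsub>P\<^esub> \<nu>)"
proof -
  have l: "fst \<xi> \<in> carrier G" "fst \<nu> \<in> carrier G" and \<gamma>: "snd \<xi> \<in> carrier Gd" "snd \<nu> \<in> carrier Gd"
    using \<xi> \<nu> by (simp_all add: carrier_P)
  have "gabor_analysis G M u (adjoint_shift \<xi> f) \<nu>
      = L2_inner M f (time_frequency_shift G \<xi> (time_frequency_shift G \<nu> u))"
    unfolding gabor_analysis_def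
    by (rule L2_inner_time_frequency_shift[OF \<xi> f time_frequency_shift_L2[OF \<nu> u], symmetric])
  also have "\<dots> = L2_inner M f (\<lambda>x. cnj (snd \<nu> (fst \<xi>)) * time_frequency_shift G (\<xi> \<otimes>\<^bsub>P\<^esub> \<nu>) u x)"
  proof (rule L2_inner_cong)
    fix x assume "x \<in> space M"
    then have x: "x \<in> carrier G" by (simp add: space_M)
    have "snd \<nu> (x \<otimes> inv fst \<xi>) * snd \<nu> (fst \<xi>) = snd \<nu> x"
      using dual_carrier_mult[OF \<gamma>(2), of "x \<otimes> inv fst \<xi>" "fst \<xi>"] x l by (simp add: m_assoc)
    then have "snd \<nu> (x \<otimes> inv fst \<xi>) * (snd \<nu> (fst \<xi>) * cnj (snd \<nu> (fst \<xi>))) = snd \<nu> x * cnj (snd \<nu> (fst \<xi>))"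
      by (simp add: mult.assoc[symmetric])
    then have "snd \<nu> (x \<otimes> inv fst \<xi>) = snd \<nu> x * cnj (snd \<nu> (fst \<xi>))"
      by (simp add: character_cnj_cancel[OF \<gamma>(2) l(1)])
    moreover have "x \<otimes> inv fst \<xi> \<otimes> inv fst \<nu> = x \<otimes> inv (fst \<xi> \<otimes> fst \<nu>)"
      using x l by (simp add: inv_mult m_assoc)
    ultimately show "time_frequency_shift G \<xi> (time_frequency_shift G \<nu> u) x
        = cnj (snd \<nu> (fst \<xi>)) * time_frequency_shift G (\<xi> \<otimes>\<^bsub>P\<^esub> \<nu>) u x"
      using x by (simp add: time_frequency_shift_apply mult_P dual_mult_apply)
  qed simp
  also have "\<dots> = snd \<nu> (fst \<xi>) * gabor_analysis G M u f (\<xi> \<otimes>\<^bsub>P\<^esub> \<nu>)"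
    unfolding gabor_analysis_def by (subst L2_inner_mult_right) simp
  finally show ?thesis .
qed

lemma gabor_analysis_compose_product:
  assumes \<xi>: "\<xi> \<in> carrier P" and \<nu>: "\<nu> \<in> carrier P"
    and u: "u \<in> L2_space M" and w: "w \<in> L2_space M" and f: "f \<in> L2_space M" and f': "f' \<in> L2_space M"
  shows "gabor_analysis G M u (adjoint_shift \<xi> f) \<nu> * cnj (gabor_analysis G M w (adjoint_shift \<xi> f') \<nu>)
      = gabor_analysis G M u f (\<xi> \<otimes>\<^bsub>P\<^esub> \<nu>) * cnj (gabor_analysis G M w f' (\<xi> \<otimes>\<^bsub>P\<^esub> \<nu>))"
proof -
  have "snd \<nu> (fst \<xi>) * cnj (snd \<nu> (fst \<xi>)) = 1"
    using \<xi> \<nu> by (intro character_cnj_cancel) (simp_all add: carrier_P)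
  moreover have "(a * b) * cnj (a * c) = (a * cnj a) * (b * cnj c)" for a b c :: complex
    by (simp add: ac_simps)
  ultimately show ?thesis
    unfolding gabor_analysis_compose[OF \<xi> \<nu> u f] gabor_analysis_compose[OF \<xi> \<nu> w f'] by simp
qed

lemma gabor_analysis_one: "gabor_analysis G M u f \<one>\<^bsub>P\<^esub> = L2_inner M f u"
  unfolding gabor_analysis_def
  by (rule L2_inner_cong) (simp_all add: time_frequency_shift_apply space_M dual_one_apply one_DirProd)

lemma gabor_analysis_linear:
  assumes "f \<in> L2_space M" "f' \<in> L2_space M" "u \<in> L2_space M" "\<nu> \<in> carrier P"
  shows "gabor_analysis G M u (\<lambda>x. f x + c * f' x) \<nu> = gabor_analysis G M u f \<nu> + c * gabor_analysis G M u f' \<nu>"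
  unfolding gabor_analysis_def using assms by (simp add: L2_inner_add_mult_left time_frequency_shift_L2)

lemma gabor_analysis_bound:
  assumes "f \<in> L2_space M" "u \<in> L2_space M" "\<nu> \<in> carrier P"
  shows "cmod (gabor_analysis G M u f \<nu>) \<le> L2_norm M f * L2_norm M u"
  unfolding gabor_analysis_def
  using L2_Cauchy_Schwarz[OF assms(1) time_frequency_shift_L2[OF assms(3,2)]]
  by (simp only: L2_norm_time_frequency_shift[OF assms(3,2)])

lemma bounded_L2_function:
  obtains f where "f \<in> L2_space M" "\<And>x. cmod (f x) \<le> 1" "L2_norm M f \<noteq> 0"
proof -
  have "emeasure M (space M) = (SUP K\<in>{K. compactin T K \<and> K \<subseteq> space M}. emeasure M K)"
    using haar unfolding haar_measure_def by (simp add: haar_measure_space[OF haar])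
  moreover have "emeasure M (space M) \<noteq> 0" using haar by (simp add: haar_measure_def)
  ultimately obtain K where K: "compactin T K" "emeasure M K \<noteq> 0"
    by (auto simp: bot_ennreal[symmetric] SUP_bot_conv)
  note fin = emeasure_compact_finite[OF K(1)] and sets = compactin_sets[OF K(1)]
  have eq: "(\<lambda>x. (cmod (indicator K x))\<^sup>2) = (indicator K :: 'a \<Rightarrow> real)"
    by (auto simp: indicator_def)
  show thesis
  proof
    show "(indicator K :: 'a \<Rightarrow> complex) \<in> L2_space M"
      using sets fin by (simp add: L2_space_def eq integrable_indicator_iff)
    show "cmod (indicator K x) \<le> 1" for x by (simp add: indicator_def)
    have "(L2_norm M (indicator K))\<^sup>2 = measure M K"
      using sets by (simp add: L2_norm_square eq sets.Int_space_eq2)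
    moreover have "measure M K \<noteq> 0" using K(2) fin by (simp add: measure_def enn2real_eq_0_iff)
    ultimately show "L2_norm M (indicator K) \<noteq> 0" by (auto simp: power2_eq_square)
  qed
qed

end

section \<open>Square-summable functions\<close>

lemma L2_inner_count_space_indicator:
  fixes c :: "'b \<Rightarrow> complex"
  assumes "\<nu> \<in> S"
  shows "L2_inner (count_space S) c (indicator {\<nu>}) = c \<nu>"
proof -
  have *: "{a \<in> S. c a * cnj (indicator {\<nu>} a) \<noteq> 0} \<subseteq> {\<nu>}" by (auto simp: indicator_def)
  then have "L2_inner (count_space S) c (indicator {\<nu>})
      = (\<Sum>a\<in>{a \<in> S. c a * cnj (indicator {\<nu>} a) \<noteq> 0}. c a * cnj (indicator {\<nu>} a))"
    unfolding L2_inner_def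
    by (intro lebesgue_integral_count_space_finite_support) (rule finite_subset, assumption, simp)
  also have "\<dots> = (\<Sum>a\<in>{\<nu>}. c a * cnj (indicator {\<nu>} a))"
    using * assms by (intro sum.mono_neutral_left) auto
  finally show ?thesis by simp
qed

lemma indicator_L2_count_space:
  "(indicator {\<nu>} :: 'b \<Rightarrow> complex) \<in> L2_space (count_space S)"
  unfolding L2_space_iff_nn_integral
proof
  have "(\<integral>\<^sup>+x. ennreal ((cmod (indicator {\<nu>} x))\<^sup>2) \<partial>count_space S) \<le> (\<integral>\<^sup>+x. indicator {\<nu>} x \<partial>count_space S)"
    by (intro nn_integral_mono) (auto simp: indicator_def)
  also have "\<dots> = (\<integral>\<^sup>+x. indicator ({\<nu>} \<inter> S) x \<partial>count_space S)"
    by (intro nn_integral_cong) (auto simp: indicator_def)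
  also have "\<dots> = emeasure (count_space S) ({\<nu>} \<inter> S)" by (rule nn_integral_indicator) simp
  also have "\<dots> < \<infinity>" by (simp add: ennreal_of_nat_eq_real_of_nat)
  finally show "(\<integral>\<^sup>+x. ennreal ((cmod (indicator {\<nu>} x))\<^sup>2) \<partial>count_space S) < \<infinity>" .
qed simp

lemma count_space_point_le_L2_norm:
  assumes c: "c \<in> L2_space (count_space S)" and \<nu>: "\<nu> \<in> S"
  shows "cmod (c \<nu>) \<le> L2_norm (count_space S) c"
proof -
  have "(L2_norm (count_space S) (indicator {\<nu>}))\<^sup>2 = 1"
    using L2_inner_self[of "count_space S" "indicator {\<nu>}"] L2_inner_count_space_indicator[OF \<nu>, of "indicator {\<nu>}"]
    by (metis indicator_simps(1) insertI1 of_real_eq_1_iff)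
  then have "L2_norm (count_space S) (indicator {\<nu>}) = 1" by (simp add: power2_eq_1_iff)
       (smt (verit) L2_norm_nonneg)
  then show ?thesis
    using L2_Cauchy_Schwarz[OF c indicator_L2_count_space[of \<nu> S]] by (simp add: L2_inner_count_space_indicator[OF \<nu>])
qed

lemma count_space_finite_approximation:
  fixes c :: "'b \<Rightarrow> complex"
  assumes c: "c \<in> L2_space (count_space S)" and e: "0 < e"
  obtains F where "finite F" "F \<subseteq> S"
    "L2_norm (count_space S) (\<lambda>x. (if x \<in> F then c x else 0) - c x) < e"
proof -
  let ?\<phi> = "\<lambda>x. (cmod (c x))\<^sup>2" and ?N = "count_space S"
  have int: "Infinite_Set_Sum.abs_summable_on ?\<phi> S"
    using L2_space_integrable_square[OF c] by (simp add: Infinite_Set_Sum.abs_summable_on_def)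
  then have "(\<lambda>x. norm (?\<phi> x)) summable_on S" by (rule abs_summable_equivalent[THEN iffD2])
  then have "?\<phi> summable_on S" by simp
  then have "(?\<phi> has_sum infsum ?\<phi> S) S" by (rule has_sum_infsum)
  then have "((\<lambda>F. sum ?\<phi> F) \<longlongrightarrow> infsum ?\<phi> S) (finite_subsets_at_top S)" by (simp add: has_sum_def)
  then have "\<forall>\<^sub>F F in finite_subsets_at_top S. dist (sum ?\<phi> F) (infsum ?\<phi> S) < e\<^sup>2"
    using e by (intro tendstoD) auto
  then obtain F where F: "finite F" "F \<subseteq> S" "dist (sum ?\<phi> F) (infsum ?\<phi> S) < e\<^sup>2"
    unfolding eventually_finite_subsets_at_top by blast
  have I: "(\<integral>x. ?\<phi> x \<partial>?N) = infsum ?\<phi> S"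
    using infsetsum_infsum[OF int] by (simp add: infsetsum_def)
  have F_int: "integrable ?N (\<lambda>x. if x \<in> F then ?\<phi> x else 0)"
    using L2_space_integrable_square[OF c] by (rule Bochner_Integration.integrable_bound) auto
  have "(\<integral>x. (if x \<in> F then ?\<phi> x else 0) \<partial>?N) = (\<Sum>x\<in>{x \<in> S. (if x \<in> F then ?\<phi> x else 0) \<noteq> 0}. (if x \<in> F then ?\<phi> x else 0))"
    by (intro lebesgue_integral_count_space_finite_support finite_subset[OF _ F(1)]) (auto split: if_splits)
  also have "\<dots> = sum ?\<phi> F"
    using F by (intro sum.mono_neutral_cong_left) auto
  finally have S: "(\<integral>x. (if x \<in> F then ?\<phi> x else 0) \<partial>?N) = sum ?\<phi> F" .
  have "(L2_norm ?N (\<lambda>x. (if x \<in> F then c x else 0) - c x))\<^sup>2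
      = (\<integral>x. ?\<phi> x - (if x \<in> F then ?\<phi> x else 0) \<partial>?N)"
    unfolding L2_norm_square by (intro Bochner_Integration.integral_cong) auto
  also have "\<dots> = infsum ?\<phi> S - sum ?\<phi> F"
    using L2_space_integrable_square[OF c] F_int by (simp add: I S)
  also have "\<dots> < e\<^sup>2" using F(3) by (simp add: dist_real_def)
  finally show thesis using F(1,2) that e power_less_imp_less_base[of _ 2 e] by (meson less_imp_le)
qed

section \<open>The canonical dual window of a discrete Gabor frame\<close>

locale discrete_gabor_frame = gabor_setting +
  fixes \<Delta> :: "('a \<times> ('a \<Rightarrow> complex)) set" and g :: "'a \<Rightarrow> complex"
  assumes subgroup: "subgroup \<Delta> P" and g: "g \<in> L2_space M"
    and frame: "gabor_frame G M (count_space \<Delta>) g"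
begin

abbreviation "D \<equiv> count_space \<Delta>"
abbreviation "C \<equiv> gabor_analysis G M g"

lemma in_P: "\<nu> \<in> \<Delta> \<Longrightarrow> \<nu> \<in> carrier P" using subgroup.mem_carrier[OF subgroup] .

lemma analysis_L2: "f \<in> L2_space M \<Longrightarrow> C f \<in> L2_space D"
  unfolding L2_space_iff_nn_integral[of _ D]
proof (intro conjI)
  assume f: "f \<in> L2_space M"
  from frame f obtain B where "(\<integral>\<^sup>+\<nu>. ennreal ((cmod (C f \<nu>))\<^sup>2) \<partial>D) \<le> ennreal (B * (L2_norm M f)\<^sup>2)"
    unfolding gabor_frame_def by blast
  then show "(\<integral>\<^sup>+\<nu>. ennreal ((cmod (C f \<nu>))\<^sup>2) \<partial>D) < \<infinity>"
    by (rule le_less_trans) simp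
qed simp

lemma frame_operator_preimage:
  assumes f: "f \<in> L2_space M"
  shows "\<exists>u\<in>L2_space M. \<forall>w\<in>L2_space M. L2_inner D (C u) (C w) = L2_inner M f w"
proof -
  obtain A B where AB: "0 < A" "A \<le> B"
    "\<And>f. f \<in> L2_space M \<Longrightarrow> ennreal (A * (L2_norm M f)\<^sup>2) \<le> (\<integral>\<^sup>+\<nu>. ennreal ((cmod (C f \<nu>))\<^sup>2) \<partial>D)"
    "\<And>f. f \<in> L2_space M \<Longrightarrow> (\<integral>\<^sup>+\<nu>. ennreal ((cmod (C f \<nu>))\<^sup>2) \<partial>D) \<le> ennreal (B * (L2_norm M f)\<^sup>2)"
    using frame unfolding gabor_frame_def by blast
  \<comment> \<open>Cutting off outside \<open>\<Delta>\<close> makes linearity hold as an equation between functions.\<close>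
  let ?C = "\<lambda>f \<nu>. if \<nu> \<in> \<Delta> then C f \<nu> else 0"
  have L2: "?C f \<in> L2_space D" if "f \<in> L2_space M" for f
    using analysis_L2[OF that] by (subst L2_space_cong[of _ _ "C f"]) auto
  have norm: "L2_norm D (?C f) = L2_norm D (C f)" for f
    by (rule L2_norm_cong) simp
  have inner: "L2_inner D (?C f) (?C w) = L2_inner D (C f) (C w)" for f w
    by (rule L2_inner_cong) simp_all
  have "\<exists>u\<in>L2_space M. \<forall>w\<in>L2_space M. L2_inner D (?C u) (?C w) = L2_inner M f w"
  proof (rule frame_operator_surj[OF L2 _ AB(1) _ _ f])
    fix u v c assume "u \<in> L2_space M" "v \<in> L2_space M"
    then show "?C (\<lambda>x. u x + c * v x) = (\<lambda>\<nu>. ?C u \<nu> + c * ?C v \<nu>)"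
      by (intro ext) (simp add: gabor_analysis_linear g in_P)
  next
    fix u assume u: "u \<in> L2_space M"
    show "A * (L2_norm M u)\<^sup>2 \<le> (L2_norm D (?C u))\<^sup>2"
      using AB(3)[OF u] unfolding norm nn_integral_L2_norm[OF analysis_L2[OF u]] by simp
    show "(L2_norm D (?C u))\<^sup>2 \<le> B * (L2_norm M u)\<^sup>2"
      using AB(4)[OF u] AB(1,2) unfolding norm nn_integral_L2_norm[OF analysis_L2[OF u]] by simp
  qed
  then show ?thesis unfolding inner .
qed

text \<open>
  The preimage of \<open>g\<close> under the frame operator is unique only up to equality almost everywhere, hence
  the choice.
\<close>

definition dual_window :: "'a \<Rightarrow> complex" where
  "dual_window = (SOME u. u \<in> L2_space M \<and> (\<forall>w\<in>L2_space M. L2_inner D (C u) (C w) = L2_inner M g w))"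

lemma dual_window: "dual_window \<in> L2_space M"
  and frame_operator_dual_window: "w \<in> L2_space M \<Longrightarrow> L2_inner D (C dual_window) (C w) = L2_inner M g w"
proof -
  have "dual_window \<in> L2_space M \<and> (\<forall>w\<in>L2_space M. L2_inner D (C dual_window) (C w) = L2_inner M g w)"
    unfolding dual_window_def using frame_operator_preimage[OF g] unfolding Bex_def by (rule someI_ex)
  then show "dual_window \<in> L2_space M"
    and "w \<in> L2_space M \<Longrightarrow> L2_inner D (C dual_window) (C w) = L2_inner M g w" by blast+
qed

lemma bij_betw_mult: "\<nu> \<in> \<Delta> \<Longrightarrow> bij_betw (\<lambda>\<mu>. \<nu> \<otimes>\<^bsub>P\<^esub> \<mu>) \<Delta> \<Delta>"
proof (rule bij_betw_byWitness[where f' = "\<lambda>\<mu>. inv\<^bsub>P\<^esub> \<nu> \<otimes>\<^bsub>P\<^esub> \<mu>"])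
  assume \<nu>: "\<nu> \<in> \<Delta>"
  show "\<forall>a\<in>\<Delta>. inv\<^bsub>P\<^esub> \<nu> \<otimes>\<^bsub>P\<^esub> (\<nu> \<otimes>\<^bsub>P\<^esub> a) = a" "\<forall>a\<in>\<Delta>. \<nu> \<otimes>\<^bsub>P\<^esub> (inv\<^bsub>P\<^esub> \<nu> \<otimes>\<^bsub>P\<^esub> a) = a"
    using in_P \<nu> by (simp_all add: P.m_assoc[symmetric])
  show "(\<otimes>\<^bsub>P\<^esub>) \<nu> ` \<Delta> \<subseteq> \<Delta>" "(\<otimes>\<^bsub>P\<^esub>) (inv\<^bsub>P\<^esub> \<nu>) ` \<Delta> \<subseteq> \<Delta>"
    using subgroup.m_closed[OF subgroup] subgroup.m_inv_closed[OF subgroup] \<nu> by blast+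
qed

text \<open>
  The frame operator commutes with the time-frequency shifts from \<open>\<Delta>\<close>, because these permute the
  frame up to unimodular factors.
\<close>

lemma frame_operator_shifted_dual_window:
  assumes \<nu>: "\<nu> \<in> \<Delta>" and w: "w \<in> L2_space M"
  shows "L2_inner D (C (time_frequency_shift G \<nu> dual_window)) (C w) = L2_inner M (time_frequency_shift G \<nu> g) w"
proof -
  note \<nu>P = in_P[OF \<nu>]
  let ?h = "time_frequency_shift G \<nu> dual_window"
  have h: "?h \<in> L2_space M" by (rule time_frequency_shift_L2[OF \<nu>P dual_window])
  have "L2_inner D (C ?h) (C w) = (\<integral>\<mu>. C ?h (\<nu> \<otimes>\<^bsub>P\<^esub> \<mu>) * cnj (C w (\<nu> \<otimes>\<^bsub>P\<^esub> \<mu>)) \<partial>D)"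
    unfolding L2_inner_def by (rule integral_bij_count_space[OF bij_betw_mult[OF \<nu>], symmetric])
  also have "\<dots> = L2_inner D (C (adjoint_shift \<nu> ?h)) (C (adjoint_shift \<nu> w))"
    unfolding L2_inner_def
    by (intro Bochner_Integration.integral_cong refl gabor_analysis_compose_product[symmetric] \<nu>P g h w)
      (simp add: in_P)
  also have "\<dots> = L2_inner D (C dual_window) (C (adjoint_shift \<nu> w))"
    unfolding gabor_analysis_def
    by (rule L2_inner_cong) (auto intro!: L2_inner_cong simp: time_frequency_shift_adjoint_shift \<nu>P space_M)
  also have "\<dots> = L2_inner M g (adjoint_shift \<nu> w)"
    by (rule frame_operator_dual_window[OF adjoint_shift_L2[OF \<nu>P w]])
  also have "\<dots> = L2_inner M (time_frequency_shift G \<nu> g) w"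
    by (subst (1 2) L2_inner_commute) (simp add: L2_inner_time_frequency_shift[OF \<nu>P w g])
  finally show ?thesis .
qed

text \<open>
  The frame expansion \<open>f = \<Sum> \<langle>f, \<pi>(\<nu>) g\<rangle> \<pi>(\<nu>) h\<close>, paired with \<open>f\<close>. With \<open>u\<close> a preimage of \<open>f\<close>
  under the frame operator, the coefficients with respect to \<open>h\<close> are those of \<open>u\<close> with respect
  to \<open>g\<close>.
\<close>

lemma dual_window_expansion:
  assumes f: "f \<in> L2_space M"
  shows "L2_inner D (C f) (gabor_analysis G M dual_window f) = of_real ((L2_norm M f)\<^sup>2)"
proof -
  obtain u where u: "u \<in> L2_space M" "\<And>w. w \<in> L2_space M \<Longrightarrow> L2_inner D (C u) (C w) = L2_inner M f w"
    using frame_operator_preimage[OF f] by blast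
  have "gabor_analysis G M dual_window f \<nu> = C u \<nu>" if \<nu>: "\<nu> \<in> \<Delta>" for \<nu>
  proof -
    note \<nu>P = in_P[OF \<nu>]
    have "gabor_analysis G M dual_window f \<nu> = L2_inner D (C u) (C (time_frequency_shift G \<nu> dual_window))"
      unfolding gabor_analysis_def[of _ _ dual_window] by (rule u(2)[OF time_frequency_shift_L2[OF \<nu>P dual_window], symmetric])
    also have "\<dots> = cnj (L2_inner M (time_frequency_shift G \<nu> g) u)"
      by (subst L2_inner_commute) (simp add: frame_operator_shifted_dual_window[OF \<nu> u(1)])
    also have "\<dots> = C u \<nu>"
      unfolding gabor_analysis_def by (rule L2_inner_commute[symmetric])
    finally show ?thesis .
  qed
  then have "L2_inner D (C f) (gabor_analysis G M dual_window f) = L2_inner D (C f) (C u)"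
    by (intro L2_inner_cong) simp_all
  also have "\<dots> = cnj (L2_inner M f f)" by (subst L2_inner_commute) (simp add: u(2)[OF f])
  finally show ?thesis by (simp add: L2_inner_self)
qed

text \<open>
  Integrate \<open>V\<^sub>g f\<close> times the conjugate of
  \<open>V\<^sub>h f\<close> over the time-frequency plane. The orthogonality relations give
  \<open>\<parallel>f\<parallel>\<^sup>2 \<langle>h, g\<rangle>\<close>; by Weil's formula the integral is also that over the quotient of a sum over a
  coset, and each such sum is a frame expansion with value \<open>\<parallel>f\<parallel>\<^sup>2\<close>.
\<close>

theorem L2_inner_dual_window:
  assumes Q: "quotient_haar_measure P (prod_topology T (dual_topology G T)) \<Delta> (M \<Otimes>\<^sub>M M') D Q"
  shows "L2_inner M dual_window g = of_real (measure Q (space Q))"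
proof -
  obtain f where f: "f \<in> L2_space M" "\<And>x. cmod (f x) \<le> 1" "L2_norm M f \<noteq> 0"
    by (rule bounded_L2_function) blast
  let ?c = "(L2_norm M f)\<^sup>2"
  let ?F = "\<lambda>\<xi>. C f \<xi> * cnj (gabor_analysis G M dual_window f \<xi>)"
  let ?TP = "prod_topology T (dual_topology G T)"
  have int: "integrable (M \<Otimes>\<^sub>M M') ?F"
    by (intro L2_mult_integrable stft_isometry(1)[where b = 1] f g dual_window)
  have "of_real ?c * L2_inner M dual_window g = (\<integral>\<xi>. ?F \<xi> \<partial>(M \<Otimes>\<^sub>M M'))"
    using stft_orthogonality[OF f(1) f(2) g dual_window] unfolding L2_inner_def[of "M \<Otimes>\<^sub>M M'"] by simp
  also have "\<dots> = (\<integral>K. the_elem ((\<lambda>\<xi>. \<integral>\<nu>. ?F (\<xi> \<otimes>\<^bsub>P\<^esub> \<nu>) \<partial>D) ` K) \<partial>Q)"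
    using Q int unfolding quotient_haar_measure_def by blast
  also have "\<dots> = (\<integral>K. complex_of_real ?c \<partial>Q)"
  proof (intro Bochner_Integration.integral_cong refl)
    fix K assume K: "K \<in> space Q"
    have "haar_measure (P Mod \<Delta>) (quotient_topology P ?TP \<Delta>) Q"
      using Q by (simp add: quotient_haar_measure_def)
    then have "K \<in> topspace (quotient_topology P ?TP \<Delta>)" using K by (simp add: haar_measure_space)
    then have "K \<in> carrier (P Mod \<Delta>)"
      using openin_quotient_topology openin_topspace by blast
    then obtain a where a: "a \<in> carrier P" "K = \<Delta> #>\<^bsub>P\<^esub> a" by (auto simp: FactGroup_def RCOSETS_def)
    then have K_sub: "K \<subseteq> carrier P" and K_ne: "K \<noteq> {}"
      using P.r_coset_subset_G[of \<Delta> a] P.rcos_self[OF a(1) subgroup] subgroup.subset[OF subgroup] by auto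
    have "(\<integral>\<nu>. ?F (\<xi> \<otimes>\<^bsub>P\<^esub> \<nu>) \<partial>D) = of_real ?c" if "\<xi> \<in> K" for \<xi>
    proof -
      have \<xi>: "\<xi> \<in> carrier P" using that K_sub by blast
      have "(\<integral>\<nu>. ?F (\<xi> \<otimes>\<^bsub>P\<^esub> \<nu>) \<partial>D)
          = L2_inner D (C (adjoint_shift \<xi> f)) (gabor_analysis G M dual_window (adjoint_shift \<xi> f))"
        unfolding L2_inner_def
        by (intro Bochner_Integration.integral_cong refl gabor_analysis_compose_product[symmetric] \<xi> g dual_window f)
          (simp add: in_P)
      also have "\<dots> = of_real ?c"
        by (simp only: dual_window_expansion[OF adjoint_shift_L2[OF \<xi> f(1)]] L2_norm_adjoint_shift[OF \<xi> f(1)])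
      finally show ?thesis .
    qed
    then have "(\<lambda>\<xi>. \<integral>\<nu>. ?F (\<xi> \<otimes>\<^bsub>P\<^esub> \<nu>) \<partial>D) ` K = {of_real ?c}" using K_ne by auto
    then show "the_elem ((\<lambda>\<xi>. \<integral>\<nu>. ?F (\<xi> \<otimes>\<^bsub>P\<^esub> \<nu>) \<partial>D) ` K) = of_real ?c"
      by (simp only: the_elem_eq)
  qed
  also have "\<dots> = of_real ?c * of_real (measure Q (space Q))" by (simp add: scaleR_conv_of_real)
  finally show ?thesis using f(3) by simp
qed

text \<open>
  If \<open>\<langle>h, g\<rangle> = 1\<close>, then the coefficient sequence of \<open>h\<close> has norm
  \<open>\<langle>g, h\<rangle> = 1\<close> and value \<open>1\<close> at the unit, so all its other values vanish.
\<close>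

lemma analysis_dual_window_eq_indicator:
  assumes 1: "L2_inner M dual_window g = 1" and \<nu>: "\<nu> \<in> \<Delta>"
  shows "C dual_window \<nu> = indicator {\<one>\<^bsub>P\<^esub>} \<nu>"
proof -
  let ?\<delta> = "indicator {\<one>\<^bsub>P\<^esub>} :: _ \<Rightarrow> complex" and ?h = dual_window
  have one: "\<one>\<^bsub>P\<^esub> \<in> \<Delta>" using subgroup.one_closed[OF subgroup] .
  note \<delta> = indicator_L2_count_space[of "\<one>\<^bsub>P\<^esub>" \<Delta>]
  have "complex_of_real ((L2_norm D (C ?h))\<^sup>2) = L2_inner M g ?h"
    by (simp only: L2_inner_self[symmetric] frame_operator_dual_window[OF dual_window])
  also have "\<dots> = 1" by (subst L2_inner_commute) (simp add: 1)
  finally have "(L2_norm D (C ?h))\<^sup>2 = 1" by (simp only: of_real_eq_1_iff)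
  moreover have "L2_inner D (C ?h) ?\<delta> = 1"
    by (simp only: L2_inner_count_space_indicator[OF one] gabor_analysis_one 1)
  moreover have "complex_of_real ((L2_norm D ?\<delta>)\<^sup>2) = 1"
    by (simp only: L2_inner_self[symmetric] L2_inner_count_space_indicator[OF one]) simp
  then have "(L2_norm D ?\<delta>)\<^sup>2 = 1" by (simp only: of_real_eq_1_iff)
  ultimately have "(L2_norm D (\<lambda>\<nu>. C ?h \<nu> - ?\<delta> \<nu>))\<^sup>2 = 0"
    using L2_norm_add_mult_square[OF analysis_L2[OF dual_window] \<delta>, of "-1"] by simp
  then have "cmod (C ?h \<nu> - ?\<delta> \<nu>) \<le> 0"
    using count_space_point_le_L2_norm[OF L2_space_diff[OF analysis_L2[OF dual_window] \<delta>] \<nu>] by simp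
  then show ?thesis by simp
qed

lemma analysis_shifted_dual_window_eq_indicator:
  assumes 1: "L2_inner M dual_window g = 1" and \<nu>: "\<nu> \<in> \<Delta>" and \<mu>: "\<mu> \<in> \<Delta>"
  shows "C (time_frequency_shift G \<nu> dual_window) \<mu> = indicator {\<nu>} \<mu>"
proof (cases "\<mu> = \<nu>")
  case True
  then show ?thesis
    using time_frequency_shift_unitary[OF in_P[OF \<nu>] dual_window g] 1 by (simp add: gabor_analysis_def)
next
  case False
  let ?\<kappa> = "inv\<^bsub>P\<^esub> \<nu> \<otimes>\<^bsub>P\<^esub> \<mu>" and ?h = "time_frequency_shift G \<nu> dual_window"
  note \<nu>P = in_P[OF \<nu>] and \<mu>P = in_P[OF \<mu>]
  have \<kappa>: "?\<kappa> \<in> \<Delta>" using subgroup \<nu> \<mu> by (simp only: subgroup.m_closed subgroup.m_inv_closed)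
  have mult: "\<nu> \<otimes>\<^bsub>P\<^esub> ?\<kappa> = \<mu>" using \<nu>P \<mu>P by (simp add: P.m_assoc[symmetric])
  have "?\<kappa> \<noteq> \<one>\<^bsub>P\<^esub>"
  proof
    assume "?\<kappa> = \<one>\<^bsub>P\<^esub>"
    then have "\<mu> = \<nu>" using mult P.r_one[OF \<nu>P] by simp
    then show False using False by simp
  qed
  then have "C dual_window ?\<kappa> = 0" using analysis_dual_window_eq_indicator[OF 1 \<kappa>] by simp
  moreover have "C dual_window ?\<kappa> = C (adjoint_shift \<nu> ?h) ?\<kappa>"
    unfolding gabor_analysis_def
    by (rule L2_inner_cong) (simp_all add: time_frequency_shift_adjoint_shift \<nu>P space_M)
  moreover have "\<dots> = snd ?\<kappa> (fst \<nu>) * C ?h (\<nu> \<otimes>\<^bsub>P\<^esub> ?\<kappa>)"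
    by (rule gabor_analysis_compose[OF \<nu>P in_P[OF \<kappa>] g time_frequency_shift_L2[OF \<nu>P dual_window]])
  moreover have "snd ?\<kappa> (fst \<nu>) \<noteq> 0"
    using dual_carrier_norm[of "snd ?\<kappa>" G T "fst \<nu>"] in_P[OF \<kappa>] \<nu>P unfolding carrier_P by fastforce
  ultimately have "C ?h \<mu> = 0" unfolding mult by simp
  then show ?thesis using False by simp
qed

text \<open>The shifts of \<open>h\<close> are sent to the unit sequences, whose finite combinations are dense.\<close>

lemma total_riesz_if_inner_eq_one:
  assumes 1: "L2_inner M dual_window g = 1"
  shows "gabor_total_riesz_family G M D g"
  unfolding gabor_total_riesz_family_def
proof (intro conjI frame ballI allI impI)
  fix c :: "'a \<times> ('a \<Rightarrow> complex) \<Rightarrow> complex" and e :: real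
  assume "c \<in> L2_space D" "0 < e"
  then obtain F where F: "finite F" "F \<subseteq> \<Delta>" "L2_norm D (\<lambda>x. (if x \<in> F then c x else 0) - c x) < e"
    by (rule count_space_finite_approximation)
  let ?h = "\<lambda>\<nu>. time_frequency_shift G \<nu> dual_window"
  let ?f = "\<lambda>x. \<Sum>\<nu>\<in>F. c \<nu> * ?h \<nu> x"
  have h: "?h \<nu> \<in> L2_space M" if "\<nu> \<in> F" for \<nu>
    by (rule time_frequency_shift_L2[OF in_P[OF subsetD[OF F(2) that]] dual_window])
  have "C ?f \<mu> = (if \<mu> \<in> F then c \<mu> else 0)" if \<mu>: "\<mu> \<in> \<Delta>" for \<mu>
  proof -
    have "C ?f \<mu> = (\<Sum>\<nu>\<in>F. c \<nu> * C (?h \<nu>) \<mu>)"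
      unfolding gabor_analysis_def
      by (rule L2_inner_sum_left[OF F(1) h time_frequency_shift_L2[OF in_P[OF \<mu>] g]])
    also have "\<dots> = (\<Sum>\<nu>\<in>F. if \<nu> = \<mu> then c \<nu> else 0)"
    proof (intro sum.cong refl)
      fix \<nu> assume "\<nu> \<in> F"
      then have "C (?h \<nu>) \<mu> = indicator {\<nu>} \<mu>"
        using F(2) by (intro analysis_shifted_dual_window_eq_indicator[OF 1 _ \<mu>]) blast
      then show "c \<nu> * C (?h \<nu>) \<mu> = (if \<nu> = \<mu> then c \<nu> else 0)" by simp
    qed
    also have "\<dots> = (if \<mu> \<in> F then c \<mu> else 0)" by (simp add: F(1))
    finally show ?thesis .
  qed
  then have "L2_norm D (\<lambda>\<nu>. C ?f \<nu> - c \<nu>) = L2_norm D (\<lambda>\<nu>. (if \<nu> \<in> F then c \<nu> else 0) - c \<nu>)"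
    by (intro L2_norm_cong) simp
  moreover have "?f \<in> L2_space M" by (rule L2_space_sum[OF F(1) h])
  ultimately show "\<exists>f\<in>L2_space M. L2_norm D (\<lambda>\<nu>. C f \<nu> - c \<nu>) < e"
    using F(3) by (intro bexI[of _ ?f]) simp_all
qed

text \<open>
  Conversely, \<open>C h\<close> and the unit sequence at the neutral element have the same inner products
  with the range of \<open>C\<close>; if that range is dense, they agree.
\<close>

lemma inner_eq_one_if_total_riesz:
  assumes R: "gabor_total_riesz_family G M D g"
  shows "L2_inner M dual_window g = 1"
proof -
  let ?\<delta> = "indicator {\<one>\<^bsub>P\<^esub>} :: _ \<Rightarrow> complex" and ?h = dual_window
  let ?r = "\<lambda>\<nu>. C ?h \<nu> + (-1) * ?\<delta> \<nu>"
  have one: "\<one>\<^bsub>P\<^esub> \<in> \<Delta>" using subgroup.one_closed[OF subgroup] .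
  note \<delta> = indicator_L2_count_space[of "\<one>\<^bsub>P\<^esub>" \<Delta>] and Ch = analysis_L2[OF dual_window]
  have r: "?r \<in> L2_space D" by (intro L2_space_add_mult Ch \<delta>)
  have orth: "L2_inner D ?r (C f) = 0" if f: "f \<in> L2_space M" for f
  proof -
    have "L2_inner D ?\<delta> (C f) = cnj (C f \<one>\<^bsub>P\<^esub>)"
      by (subst L2_inner_commute) (simp only: L2_inner_count_space_indicator[OF one])
    also have "\<dots> = L2_inner M g f" by (simp only: gabor_analysis_one L2_inner_commute[symmetric])
    finally show ?thesis
      by (simp only: L2_inner_add_mult_left[OF Ch \<delta> analysis_L2[OF f]] frame_operator_dual_window[OF f]) simp
  qed
  have "L2_norm D ?r \<le> e" if e: "0 < e" for e
  proof (cases "L2_norm D ?r = 0")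
    case False
    obtain f where f: "f \<in> L2_space M" "L2_norm D (\<lambda>\<nu>. C f \<nu> - ?r \<nu>) < e"
      using R[unfolded gabor_total_riesz_family_def, THEN conjunct2, rule_format, OF r e] by (elim bexE)
    let ?d = "\<lambda>\<nu>. C f \<nu> + (-1) * ?r \<nu>"
    have "L2_inner D ?r ?d = - complex_of_real ((L2_norm D ?r)\<^sup>2)"
      by (simp only: L2_inner_add_mult_right[OF analysis_L2[OF f(1)] r r] orth[OF f(1)] L2_inner_self) simp
    then have "(L2_norm D ?r)\<^sup>2 = cmod (L2_inner D ?r ?d)"
      by (simp only: norm_minus_cancel norm_of_real) simp
    also have "\<dots> \<le> L2_norm D ?r * L2_norm D ?d"
      by (intro L2_Cauchy_Schwarz r L2_space_add_mult analysis_L2 f)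
    also have "?d = (\<lambda>\<nu>. C f \<nu> - ?r \<nu>)" by auto
    also have "L2_norm D ?r * L2_norm D (\<lambda>\<nu>. C f \<nu> - ?r \<nu>) \<le> L2_norm D ?r * e"
      using f(2) by (intro mult_left_mono) simp_all
    finally have "L2_norm D ?r * L2_norm D ?r \<le> L2_norm D ?r * e" by (simp only: power2_eq_square)
    moreover have "0 < L2_norm D ?r" using False L2_norm_nonneg[of D ?r] by linarith
    ultimately show ?thesis by (simp only: mult_le_cancel_left_pos)
  qed (use e in simp)
  then have "L2_norm D ?r \<le> 0" by (rule dense_ge)
  then have "cmod (?r \<one>\<^bsub>P\<^esub>) \<le> 0" using count_space_point_le_L2_norm[OF r one] by linarith
  then show ?thesis by (simp add: gabor_analysis_one)
qed

end

section \<open>Compactness of the quotient\<close>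

text \<open>
  There is room for finitely many disjoint
  translates of a compact set \<open>K\<close> of positive measure only; for a maximal such collection every
  further translate meets one of its members, so the sets \<open>x K K\<^sup>-\<^sup>1\<close> cover the group.
\<close>

lemma (in topological_comm_group) compact_space_if_finite_haar_measure:
  assumes M: "haar_measure G T M" and fin: "emeasure M (space M) < \<infinity>"
  shows "compact_space T"
proof -
  have sp: "space M = carrier G" using haar_measure_space[OF M] topspace_carrier by simp
  have "emeasure M (space M) = (SUP K\<in>{K. compactin T K \<and> K \<subseteq> space M}. emeasure M K)"
    using M unfolding haar_measure_def by (simp add: haar_measure_space[OF M])
  moreover have "emeasure M (space M) \<noteq> 0" using M by (simp add: haar_measure_def)
  ultimately obtain K where K: "compactin T K" "emeasure M K \<noteq> 0"
    by (auto simp: bot_ennreal[symmetric] SUP_bot_conv)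
  have K_sub: "K \<subseteq> carrier G" using compactin_subset_topspace[OF K(1)] topspace_carrier by simp
  have K_ne: "K \<noteq> {}" using K(2) by auto
  \<comment> \<open>Sets that are not measurable have measure \<open>0\<close>, so \<open>K\<close> and its translates are measurable.\<close>
  have K_sets: "K \<in> sets M" using K(2) emeasure_notin_sets by blast
  let ?tr = "\<lambda>x. (\<lambda>y. x \<otimes> y) ` K"
  have tr: "emeasure M (?tr x) = emeasure M K" if "x \<in> carrier G" for x
    using M K_sets that by (simp add: haar_measure_def)
  then have tr_sets: "?tr x \<in> sets M" if "x \<in> carrier G" for x
    using that K(2) emeasure_notin_sets[of "?tr x" M] by auto
  interpret M: finite_measure M using fin by (intro finite_measureI) simp
  let ?m = "measure M K"
  have m: "0 < ?m" using K(2) by (simp add: M.emeasure_eq_measure zero_less_measure_iff)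
  define packing where "packing F \<longleftrightarrow> finite F \<and> F \<subseteq> carrier G \<and> disjoint_family_on ?tr F" for F
  have bound: "card F \<le> nat \<lfloor>measure M (space M) / ?m\<rfloor>" if "packing F" for F
  proof -
    have F: "finite F" "F \<subseteq> carrier G" "disjoint_family_on ?tr F" using that by (auto simp: packing_def)
    have "real (card F) * ?m = (\<Sum>x\<in>F. measure M (?tr x))"
      using F(2) tr by (simp add: measure_def subset_iff)
    also have "\<dots> = measure M (\<Union>x\<in>F. ?tr x)"
      using F tr_sets by (intro M.finite_measure_finite_Union[symmetric]) auto
    also have "\<dots> \<le> measure M (space M)" by (rule M.bounded_measure)
    finally have "real (card F) \<le> measure M (space M) / ?m" using m by (simp add: field_simps)
    then show ?thesis by linarith
  qed
  have "\<exists>F. packing F \<and> (\<forall>F'. packing F' \<longrightarrow> card F' \<le> card F)"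
  proof (rule ex_has_greatest_nat)
    show "packing {}" by (simp add: packing_def disjoint_family_on_def)
    show "\<forall>F. packing F \<longrightarrow> card F < Suc (nat \<lfloor>measure M (space M) / ?m\<rfloor>)"
      using bound by (simp add: less_Suc_eq_le)
  qed
  then obtain F where F: "packing F" "\<And>F'. packing F' \<Longrightarrow> card F' \<le> card F" by blast
  then have F': "finite F" "F \<subseteq> carrier G" by (auto simp: packing_def)
  let ?d = "\<lambda>x. (\<lambda>(a, b). x \<otimes> (a \<otimes> inv b)) ` (K \<times> K)"
  have cover: "carrier G \<subseteq> (\<Union>x\<in>F. ?d x)"
  proof
    fix y assume y: "y \<in> carrier G"
    have "\<exists>x\<in>F. ?tr x \<inter> ?tr y \<noteq> {}"
    proof (rule ccontr)
      assume "\<not> ?thesis"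
      then have disj: "?tr x \<inter> ?tr y = {}" if "x \<in> F" for x using that by blast
      then have "y \<notin> F" using K_ne by blast
      have "packing (insert y F)"
        using F(1) y disj \<open>y \<notin> F\<close> by (auto simp: packing_def disjoint_family_on_insert Int_commute)
      from F(2)[OF this] show False using F'(1) \<open>y \<notin> F\<close> by simp
    qed
    then obtain x a b where x: "x \<in> F" and ab: "a \<in> K" "b \<in> K" "x \<otimes> a = y \<otimes> b" by auto
    then have "x \<in> carrier G" "a \<in> carrier G" "b \<in> carrier G" using F'(2) K_sub by auto
    then have "y = x \<otimes> (a \<otimes> inv b)" using ab(3) y by (simp add: m_assoc[symmetric]) (simp add: m_assoc)
    then show "y \<in> (\<Union>x\<in>F. ?d x)" using x ab by auto
  qed
  have d: "compactin T (?d x)" if "x \<in> F" for x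
  proof (rule image_compactin)
    show "compactin (prod_topology T T) (K \<times> K)" using K(1) by (simp add: compactin_Times)
    have "x \<in> carrier G" using that F' by blast
    then show "continuous_map (prod_topology T T) T (\<lambda>(a, b). x \<otimes> (a \<otimes> inv b))"
      unfolding case_prod_unfold
      by (intro continuous_map_mult continuous_map_inv continuous_map_fst continuous_map_snd)
        (simp add: topspace_carrier)
  qed
  have "(\<Union>x\<in>F. ?d x) \<subseteq> carrier G"
    using compactin_subset_topspace[OF d] unfolding topspace_carrier by (rule UN_least)
  with cover have "topspace T = (\<Union>x\<in>F. ?d x)" unfolding topspace_carrier by (rule subset_antisym)
  moreover have "compactin T (\<Union>x\<in>F. ?d x)" using d F'(1) by (intro compactin_Union) auto
  ultimately show ?thesis by (simp add: compact_space_def)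
qed

text \<open>
  The projection is open, so a pair of cosets has neighbourhoods of the form \<open>p ` U \<times> p ` V\<close>, to which
  continuity of the multiplication descends.
\<close>

lemma (in topological_comm_group) topological_comm_group_quotient:
  assumes H: "subgroup H G"
  shows "topological_comm_group (G Mod H) (quotient_topology G T H)"
proof -
  interpret N: normal H G using H by (rule subgroup_imp_normal)
  interpret Q: comm_group "G Mod H" using H by (rule abelian_FactGroup)
  let ?q = "quotient_topology G T H" and ?p = "\<lambda>x. H #> x"
  have qm: "quotient_map T ?q ?p" by (rule quotient_map_quotient_topology)
  have top: "topspace ?q = carrier (G Mod H)"
    using quotient_imp_surjective_map[OF qm] by (auto simp: FactGroup_def RCOSETS_def topspace_carrier)
  have open_map: "openin ?q (?p ` U)" if U: "openin T U" for U
  proof -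
    have U_sub: "U \<subseteq> carrier G" using openin_subset[OF U] topspace_carrier by simp
    have "{x \<in> topspace T. ?p x \<in> ?p ` U} = (\<Union>h\<in>H. {x \<in> topspace T. h \<otimes> x \<in> U})"
    proof (intro subset_antisym subsetI)
      fix x assume "x \<in> {x \<in> topspace T. ?p x \<in> ?p ` U}"
      then obtain u where xu: "x \<in> carrier G" "u \<in> U" "H #> x = H #> u" by (auto simp: topspace_carrier)
      then have "u \<in> H #> x" using rcos_self[of u H] H U_sub by auto
      then obtain h where "h \<in> H" "u = h \<otimes> x" by (auto simp: r_coset_def)
      then show "x \<in> (\<Union>h\<in>H. {x \<in> topspace T. h \<otimes> x \<in> U})" using xu by (auto simp: topspace_carrier)
    next
      fix x assume "x \<in> (\<Union>h\<in>H. {x \<in> topspace T. h \<otimes> x \<in> U})"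
      then obtain h where h: "h \<in> H" "x \<in> carrier G" "h \<otimes> x \<in> U" by (auto simp: topspace_carrier)
      then have "H #> x = H #> (h \<otimes> x)"
        using coset_mult_assoc[of H h x] coset_join2[of h H] H N.mem_carrier N.subset by simp
      then show "x \<in> {x \<in> topspace T. ?p x \<in> ?p ` U}" using h by (auto simp: topspace_carrier)
    qed
    also have "openin T \<dots>"
    proof (rule openin_Union)
      fix K assume "K \<in> (\<lambda>h. {x \<in> topspace T. h \<otimes> x \<in> U}) ` H"
      then obtain h where "h \<in> H" and K: "K = {x \<in> topspace T. h \<otimes> x \<in> U}" by blast
      show "openin T K"
        unfolding K using continuous_translation[OF N.mem_carrier[OF \<open>h \<in> H\<close>]] U
        by (rule openin_continuous_map_preimage)
    qed
    finally have "openin T {x \<in> topspace T. ?p x \<in> ?p ` U}" .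
    moreover have "?p ` U \<subseteq> carrier (G Mod H)" using U_sub by (auto simp: FactGroup_def RCOSETS_def)
    ultimately show ?thesis by (simp add: openin_quotient_topology)
  qed
  have rep: "\<exists>x\<in>carrier G. X = ?p x" if "X \<in> carrier (G Mod H)" for X
    using that by (auto simp: FactGroup_def RCOSETS_def)
  have mult: "?p x \<otimes>\<^bsub>G Mod H\<^esub> ?p y = ?p (x \<otimes> y)" if "x \<in> carrier G" "y \<in> carrier G" for x y
    using N.rcos_sum[OF that] by (simp add: FactGroup_def)
  have carr: "?p x \<in> carrier (G Mod H)" if "x \<in> carrier G" for x
    using that by (auto simp: FactGroup_def RCOSETS_def)
  have cont_p: "continuous_map T ?q ?p" using qm by (rule quotient_imp_continuous_map)
  show ?thesis
  proof (unfold_locales)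
    show "topspace ?q = carrier (G Mod H)" by (rule top)
    show "continuous_map (prod_topology ?q ?q) ?q (\<lambda>(X, Y). X \<otimes>\<^bsub>G Mod H\<^esub> Y)"
      unfolding continuous_map_def
    proof (intro conjI allI impI)
      show "(\<lambda>(X, Y). X \<otimes>\<^bsub>G Mod H\<^esub> Y) \<in> topspace (prod_topology ?q ?q) \<rightarrow> topspace ?q"
        by (auto simp: top simp del: mult_FactGroup)
      fix W assume W: "openin ?q W"
      let ?S = "{(x, y). x \<in> carrier G \<and> y \<in> carrier G \<and> ?p (x \<otimes> y) \<in> W}"
      have "openin (prod_topology T T) {z \<in> topspace (prod_topology T T). (\<lambda>(x, y). ?p (x \<otimes> y)) z \<in> W}"
        using continuous_map_compose[OF continuous_mult cont_p] W
        by (intro openin_continuous_map_preimage) (simp_all add: o_def case_prod_unfold)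
      also have "{z \<in> topspace (prod_topology T T). (\<lambda>(x, y). ?p (x \<otimes> y)) z \<in> W} = ?S"
        by (auto simp: topspace_carrier)
      finally have S: "openin (prod_topology T T) ?S" .
      show "openin (prod_topology ?q ?q) {Z \<in> topspace (prod_topology ?q ?q). (\<lambda>(X, Y). X \<otimes>\<^bsub>G Mod H\<^esub> Y) Z \<in> W}"
        unfolding openin_prod_topology_alt
      proof (intro allI impI)
        fix X Y assume XY: "(X, Y) \<in> {Z \<in> topspace (prod_topology ?q ?q). (\<lambda>(X, Y). X \<otimes>\<^bsub>G Mod H\<^esub> Y) Z \<in> W}"
        then have "X \<in> carrier (G Mod H)" "Y \<in> carrier (G Mod H)" by (auto simp: top)
        then obtain x y where xy: "x \<in> carrier G" "y \<in> carrier G" "X = ?p x" "Y = ?p y"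
          using rep[of X] rep[of Y] by blast
        then have "(x, y) \<in> ?S" using XY by (simp add: mult[symmetric] del: mult_FactGroup)
        then obtain U V where UV: "openin T U" "openin T V" "x \<in> U" "y \<in> V" "U \<times> V \<subseteq> ?S"
          using S unfolding openin_prod_topology_alt by (elim allE impE) (assumption, elim exE conjE)
        have "?p ` U \<times> ?p ` V \<subseteq> {Z \<in> topspace (prod_topology ?q ?q). (\<lambda>(X, Y). X \<otimes>\<^bsub>G Mod H\<^esub> Y) Z \<in> W}"
        proof (intro subsetI)
          fix Z assume "Z \<in> ?p ` U \<times> ?p ` V"
          then obtain u v where uv: "u \<in> U" "v \<in> V" "Z = (?p u, ?p v)" by auto
          then have "(u, v) \<in> ?S" using UV(5) by blast
          then show "Z \<in> {Z \<in> topspace (prod_topology ?q ?q). (\<lambda>(X, Y). X \<otimes>\<^bsub>G Mod H\<^esub> Y) Z \<in> W}"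
            by (simp add: uv(3) top carr mult del: mult_FactGroup)
        qed
        with UV xy open_map show "\<exists>U V. openin ?q U \<and> openin ?q V \<and> X \<in> U \<and> Y \<in> V \<and>
            U \<times> V \<subseteq> {Z \<in> topspace (prod_topology ?q ?q). (\<lambda>(X, Y). X \<otimes>\<^bsub>G Mod H\<^esub> Y) Z \<in> W}"
          by (intro exI[of _ "?p ` U"] exI[of _ "?p ` V"]) simp
      qed
    qed
    have "continuous_map T ?q (\<lambda>x. inv\<^bsub>G Mod H\<^esub> (?p x))"
    proof (rule continuous_map_eq)
      show "continuous_map T ?q (\<lambda>x. ?p (inv x))"
        using continuous_map_compose[OF continuous_inv cont_p] by (simp add: o_def)
      show "?p (inv x) = inv\<^bsub>G Mod H\<^esub> (?p x)" if "x \<in> topspace T" for x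
        using that by (simp add: topspace_carrier N.inv_FactGroup carr N.rcos_inv)
    qed
    then show "continuous_map ?q ?q (\<lambda>X. inv\<^bsub>G Mod H\<^esub> X)"
      using continuous_compose_quotient_map_eq[OF qm, of ?q "\<lambda>X. inv\<^bsub>G Mod H\<^esub> X"] by (simp add: o_def)
  qed
qed

section \<open>Discreteness of the index group of a total Riesz family\<close>

context gabor_setting
begin

lemma gabor_analysis_measurable_subgroup:
  assumes D: "haar_measure H (subtopology (prod_topology T (dual_topology G T)) \<Delta>) D"
    and [measurable]: "f \<in> borel_measurable M" "u \<in> borel_measurable M"
  shows "gabor_analysis G M u f \<in> borel_measurable D"
proof -
  let ?S = "subtopology (prod_topology T (dual_topology G T)) \<Delta>"
  have "fst \<in> D \<rightarrow>\<^sub>M M" "snd \<in> D \<rightarrow>\<^sub>M M'"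
    by (rule continuous_map_measurable[OF haar_measure_sets[OF D]],
        auto simp: sets_M sets_M' intro!: continuous_map_from_subtopology continuous_map_fst continuous_map_snd)+
  then have "(\<lambda>\<nu>. (fst \<nu>, snd \<nu>)) \<in> D \<rightarrow>\<^sub>M M \<Otimes>\<^sub>M M'" by (rule measurable_Pair)
  from measurable_compose[OF this gabor_analysis_measurable[OF assms(2,3)]] show ?thesis by simp
qed

text \<open>
  Coefficient functions obey \<open>|C f| \<le> \<parallel>f\<parallel> \<parallel>g\<parallel> \<le> \<parallel>C f\<parallel> \<parallel>g\<parallel> / \<surd>A\<close>. If they approximate the indicator of
  a set of small positive measure, which has small norm, they are uniformly small, yet close to \<open>1\<close>
  on that set.
\<close>

lemma total_riesz_measure_lower_bound:
  assumes \<Delta>: "subgroup \<Delta> P"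
    and D: "haar_measure H (subtopology (prod_topology T (dual_topology G T)) \<Delta>) D"
    and g: "g \<in> L2_space M"
    and R: "gabor_total_riesz_family G M D g"
  obtains \<epsilon> :: real where "0 < \<epsilon>"
    "\<And>U. U \<in> sets D \<Longrightarrow> emeasure D U < ennreal \<epsilon> \<Longrightarrow> emeasure D U = 0"
proof -
  let ?C = "gabor_analysis G M g"
  obtain A B where 0: "0 < A" "A \<le> B"
    "\<forall>f\<in>L2_space M. ennreal (A * (L2_norm M f)\<^sup>2) \<le> (\<integral>\<^sup>+\<nu>. ennreal ((cmod (?C f \<nu>))\<^sup>2) \<partial>D) \<and>
      (\<integral>\<^sup>+\<nu>. ennreal ((cmod (?C f \<nu>))\<^sup>2) \<partial>D) \<le> ennreal (B * (L2_norm M f)\<^sup>2)"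
    using R[unfolded gabor_total_riesz_family_def, THEN conjunct1] unfolding gabor_frame_def
    by (elim exE conjE)
  note AB = 0(1,2) 0(3)[rule_format, THEN conjunct1] 0(3)[rule_format, THEN conjunct2]
  have space_D: "space D = \<Delta>"
    using haar_measure_space[OF D] subgroup.subset[OF \<Delta>] P.topspace_carrier by auto
  have L2: "?C f \<in> L2_space D" if f: "f \<in> L2_space M" for f
    using gabor_analysis_measurable_subgroup[OF D, of f g] f g AB(4)[OF f]
    by (auto simp: L2_space_iff_nn_integral[of _ D] intro: le_less_trans[OF _ ennreal_less_top])
  define q where "q = L2_norm M g / sqrt A"
  have q: "0 \<le> q" using AB(1) by (simp add: q_def)
  have point: "cmod (?C f \<nu>) \<le> q * L2_norm D (?C f)" if f: "f \<in> L2_space M" and \<nu>: "\<nu> \<in> \<Delta>" for f \<nu>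
  proof -
    have "A * (L2_norm M f)\<^sup>2 \<le> (L2_norm D (?C f))\<^sup>2"
      using AB(3)[OF f] unfolding nn_integral_L2_norm[OF L2[OF f]] by simp
    then have "(sqrt A * L2_norm M f)\<^sup>2 \<le> (L2_norm D (?C f))\<^sup>2" using AB(1) by (simp add: power_mult_distrib)
    then have "sqrt A * L2_norm M f \<le> L2_norm D (?C f)" by (rule power2_le_imp_le) simp
    then have "L2_norm M f \<le> L2_norm D (?C f) / sqrt A" using AB(1) by (simp add: field_simps)
    then have "L2_norm M f * L2_norm M g \<le> L2_norm D (?C f) / sqrt A * L2_norm M g"
      by (rule mult_right_mono) simp
    moreover have "cmod (?C f \<nu>) \<le> L2_norm M f * L2_norm M g"
      by (rule gabor_analysis_bound[OF f g subgroup.mem_carrier[OF \<Delta> \<nu>]])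
    ultimately show ?thesis by (simp add: q_def mult.commute)
  qed
  \<comment> \<open>For sets of measure below \<open>r\<^sup>2\<close> the indicator has norm at most \<open>r\<close>. With an approximation error of
    at most \<open>r\<close> too, the coefficients are at most \<open>q (2 r) \<le> 1/2\<close>.\<close>
  let ?r = "1 / (4 * (q + 1))"
  have r: "0 < ?r" "q * (2 * ?r) \<le> 1/2" using q by (simp_all add: field_simps)
  show thesis
  proof (rule that[of "?r\<^sup>2"])
    show "0 < ?r\<^sup>2" using r(1) by simp
    fix U assume U: "U \<in> sets D" and small: "emeasure D U < ennreal (?r\<^sup>2)"
    let ?I = "indicator U :: _ \<Rightarrow> complex" and ?m = "measure D U"
    have lt: "emeasure D U < \<infinity>" using less_trans[OF small ennreal_less_top] by simp
    then have fin: "emeasure D U = ennreal ?m" by (intro emeasure_eq_ennreal_measure) simp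
    have eq: "(\<lambda>x. (cmod (?I x))\<^sup>2) = indicator U" by (auto simp: indicator_def)
    have I: "?I \<in> L2_space D"
      using U lt by (simp add: L2_space_def eq integrable_indicator_iff)
    have I_norm: "(L2_norm D ?I)\<^sup>2 = ?m" using U by (simp add: L2_norm_square eq sets.Int_space_eq2)
    have "?m < ?r\<^sup>2" using small unfolding fin by (simp add: ennreal_less_iff)
    then have "L2_norm D ?I \<le> ?r" using r(1) I_norm by (intro power2_le_imp_le[of "L2_norm D ?I" ?r]) simp_all
    show "emeasure D U = 0"
    proof (rule ccontr)
      assume "emeasure D U \<noteq> 0"
      then have m: "0 < ?m" using fin by (simp add: zero_less_measure_iff)
      let ?e = "min ?r (sqrt ?m / 2)"
      have "0 < ?e" using r(1) m by simp
      then obtain f where f: "f \<in> L2_space M" "L2_norm D (\<lambda>\<nu>. ?C f \<nu> - ?I \<nu>) < ?e"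
        using R[unfolded gabor_total_riesz_family_def, THEN conjunct2, rule_format, OF I] by blast
      let ?d = "\<lambda>\<nu>. ?C f \<nu> - ?I \<nu>"
      have d: "?d \<in> L2_space D" by (intro L2_space_diff L2 f I)
      have "L2_norm D (?C f) \<le> L2_norm D ?d + L2_norm D ?I"
        using L2_norm_triangle[OF d I] by simp
      also have "\<dots> \<le> 2 * ?r" using f(2) \<open>L2_norm D ?I \<le> ?r\<close> by linarith
      finally have Cf: "L2_norm D (?C f) \<le> 2 * ?r" .
      have half: "cmod (?C f \<nu>) \<le> 1/2" if "\<nu> \<in> \<Delta>" for \<nu>
        using point[OF f(1) that] mult_left_mono[OF Cf q] r(2) by linarith
      have "ennreal (1/4) * emeasure D U = (\<integral>\<^sup>+\<nu>. ennreal (1/4) * indicator U \<nu> \<partial>D)"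
        using U by (simp add: nn_integral_cmult_indicator)
      also have "\<dots> \<le> (\<integral>\<^sup>+\<nu>. ennreal ((cmod (?d \<nu>))\<^sup>2) \<partial>D)"
      proof (rule nn_integral_mono)
        fix \<nu> assume "\<nu> \<in> space D"
        then have "1/2 \<le> cmod (?d \<nu>)" if "\<nu> \<in> U"
          using half[of \<nu>] that norm_triangle_ineq2[of 1 "?C f \<nu>"] by (simp add: space_D norm_minus_commute)
        then have "(1/2)\<^sup>2 \<le> (cmod (?d \<nu>))\<^sup>2" if "\<nu> \<in> U" using that by (intro power_mono) auto
        then show "ennreal (1/4) * indicator U \<nu> \<le> ennreal ((cmod (?d \<nu>))\<^sup>2)"
          by (cases "\<nu> \<in> U") (auto simp: power2_eq_square intro!: ennreal_leI)
      qed
      also have "\<dots> = ennreal ((L2_norm D ?d)\<^sup>2)" by (rule nn_integral_L2_norm[OF d])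
      finally have "?m / 4 \<le> (L2_norm D ?d)\<^sup>2" unfolding fin by (simp add: ennreal_mult[symmetric])
      also have "\<dots> < (sqrt ?m / 2)\<^sup>2" using f(2) by (intro power_strict_mono) simp_all
      also have "\<dots> = ?m / 4" using m by (simp add: power_divide)
      finally show False by simp
    qed
  qed
qed

text \<open>
  Points have measure at least the bound \<open>\<epsilon>\<close> of the previous lemma: otherwise, by invariance and outer
  regularity, every point has a null neighbourhood, hence every compact set, and by inner regularity
  the group, is null. As the measure is finite near a point, the point has a finite neighbourhood,
  and a finite open set in a Hausdorff space consists of isolated points.
\<close>

lemma total_riesz_imp_discrete:
  assumes \<Delta>: "subgroup \<Delta> P"
    and D: "haar_measure (P\<lparr>carrier := \<Delta>\<rparr>) (subtopology (prod_topology T (dual_topology G T)) \<Delta>) D"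
    and g: "g \<in> L2_space M"
    and R: "gabor_total_riesz_family G M D g"
  shows "subtopology (prod_topology T (dual_topology G T)) \<Delta> = discrete_topology \<Delta>"
proof -
  let ?TP = "prod_topology T (dual_topology G T)"
  let ?S = "subtopology ?TP \<Delta>"
  have top: "topspace ?S = \<Delta>" using subgroup.subset[OF \<Delta>] P.topspace_carrier by auto
  have space_D: "space D = \<Delta>" using haar_measure_space[OF D] top by simp
  have "Hausdorff_space ?TP"
    using Hausdorff Hausdorff_space_dual by (simp add: Hausdorff_space_prod_topology)
  then have Hd: "Hausdorff_space ?S" by (rule Hausdorff_space_subtopology)
  have sets_D: "U \<in> sets D" if "openin ?S U" for U
    using that haar_measure_sets[OF D] openin_borel_of by blast
  have pt: "compactin ?S {\<nu>}" "{\<nu>} \<in> sets D" if "\<nu> \<in> \<Delta>" for \<nu>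
  proof -
    show c: "compactin ?S {\<nu>}" using that by (simp add: top del: topspace_subtopology)
    show "{\<nu>} \<in> sets D"
      using compactin_imp_closedin[OF Hd c] haar_measure_sets[OF D] closedin_borel_of by blast
  qed
  obtain \<epsilon> where \<epsilon>: "0 < \<epsilon>" "\<And>U. U \<in> sets D \<Longrightarrow> emeasure D U < ennreal \<epsilon> \<Longrightarrow> emeasure D U = 0"
    using total_riesz_measure_lower_bound[OF \<Delta> D g R] by blast
  have outer: "\<exists>U. openin ?S U \<and> \<nu> \<in> U \<and> emeasure D U < b" if "\<nu> \<in> \<Delta>" "emeasure D {\<nu>} < b" for \<nu> b
  proof -
    have "emeasure D {\<nu>} = (INF U\<in>{U. openin ?S U \<and> {\<nu>} \<subseteq> U}. emeasure D U)"
      using D pt(2)[OF that(1)] unfolding haar_measure_def by blast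
    with that(2) show ?thesis by (auto simp: INF_less_iff)
  qed
  have one: "\<one>\<^bsub>P\<^esub> \<in> \<Delta>" using subgroup.one_closed[OF \<Delta>] .
  have inv: "emeasure D {\<nu>} = emeasure D {\<one>\<^bsub>P\<^esub>}" if "\<nu> \<in> \<Delta>" for \<nu>
  proof -
    have "\<forall>x\<in>carrier (P\<lparr>carrier := \<Delta>\<rparr>). \<forall>A\<in>sets D.
        emeasure D ((\<lambda>y. x \<otimes>\<^bsub>P\<lparr>carrier := \<Delta>\<rparr>\<^esub> y) ` A) = emeasure D A"
      using D unfolding haar_measure_def by (elim conjE)
    then have "\<forall>A\<in>sets D. emeasure D ((\<lambda>y. \<nu> \<otimes>\<^bsub>P\<lparr>carrier := \<Delta>\<rparr>\<^esub> y) ` A) = emeasure D A"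
      by (rule bspec) (simp add: that)
    then have "emeasure D ((\<lambda>y. \<nu> \<otimes>\<^bsub>P\<lparr>carrier := \<Delta>\<rparr>\<^esub> y) ` {\<one>\<^bsub>P\<^esub>}) = emeasure D {\<one>\<^bsub>P\<^esub>}"
      using pt(2)[OF one] by (rule bspec)
    then show ?thesis using P.r_one[OF subgroup.mem_carrier[OF \<Delta> that]] by simp
  qed
  have "\<not> emeasure D {\<one>\<^bsub>P\<^esub>} < ennreal \<epsilon>"
  proof
    assume "emeasure D {\<one>\<^bsub>P\<^esub>} < ennreal \<epsilon>"
    then have nbhd: "\<exists>U. openin ?S U \<and> \<nu> \<in> U \<and> emeasure D U = 0" if "\<nu> \<in> \<Delta>" for \<nu>
      using outer[OF that, of "ennreal \<epsilon>"] inv[OF that] \<epsilon>(2) sets_D by metis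
    have "emeasure D K = 0" if K: "compactin ?S K" for K
    proof -
      let ?\<U> = "{U. openin ?S U \<and> emeasure D U = 0}"
      have "K \<subseteq> \<Union>?\<U>" using nbhd compactin_subset_topspace[OF K] top by blast
      then obtain \<F> where \<F>: "finite \<F>" "\<F> \<subseteq> ?\<U>" "K \<subseteq> \<Union>\<F>"
        using K unfolding compactin_def by (metis (no_types, lifting) mem_Collect_eq)
      have "(\<Union>U\<in>\<F>. U) \<in> null_sets D"
        using \<F>(1,2) sets_D by (intro null_sets_UN') (auto intro: countable_finite simp: null_sets_def)
      then have "emeasure D (\<Union>\<F>) = 0" by auto
      moreover have "emeasure D K \<le> emeasure D (\<Union>\<F>)"
        using \<F>(2,3) by (intro emeasure_mono sets_D openin_Union) auto
      ultimately show ?thesis by simp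
    qed
    moreover have "emeasure D (space D) = (SUP K\<in>{K. compactin ?S K \<and> K \<subseteq> space D}. emeasure D K)"
    proof -
      have "\<forall>U. openin ?S U \<longrightarrow> emeasure D U = (SUP K\<in>{K. compactin ?S K \<and> K \<subseteq> U}. emeasure D K)"
        using D unfolding haar_measure_def by (elim conjE)
      from mp[OF spec[OF this, of "topspace ?S"] openin_topspace]
      show ?thesis unfolding haar_measure_space[OF D] .
    qed
    ultimately have "emeasure D (space D) = 0" by (auto simp: bot_ennreal[symmetric] SUP_bot_conv)
    then show False using D unfolding haar_measure_def by blast
  qed
  then have big: "ennreal \<epsilon> \<le> emeasure D {\<nu>}" if "\<nu> \<in> \<Delta>" for \<nu> using inv[OF that] by simp
  have "openin ?S {\<nu>}" if \<nu>: "\<nu> \<in> \<Delta>" for \<nu>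
  proof -
    have "emeasure D {\<nu>} < \<infinity>" using D pt(1)[OF \<nu>] unfolding haar_measure_def by blast
    then obtain U where U: "openin ?S U" "\<nu> \<in> U" "emeasure D U < \<infinity>" using outer[OF \<nu>] by blast
    have U_sub: "U \<subseteq> \<Delta>" using openin_subset[OF U(1)] top by simp
    let ?n = "Suc (nat \<lceil>measure D U / \<epsilon>\<rceil>)"
    have "finite U"
    proof (rule ccontr)
      assume "infinite U"
      then obtain F where F: "finite F" "card F = ?n" "F \<subseteq> U" using infinite_arbitrarily_large by blast
      have "of_nat ?n * ennreal \<epsilon> = (\<Sum>\<nu>\<in>F. ennreal \<epsilon>)" by (simp add: F(2))
      also have "\<dots> \<le> (\<Sum>\<nu>\<in>F. emeasure D {\<nu>})" using F(3) U_sub big by (intro sum_mono) auto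
      also have "\<dots> = emeasure D (\<Union>\<nu>\<in>F. {\<nu>})"
        using F U_sub pt(2) by (intro sum_emeasure) (auto simp: disjoint_family_on_def)
      also have "\<dots> \<le> emeasure D U" using F(3) sets_D[OF U(1)] by (intro emeasure_mono) auto
      also have "\<dots> = ennreal (measure D U)" using U(3) by (simp add: emeasure_eq_ennreal_measure)
      finally have "real ?n * \<epsilon> \<le> measure D U"
        using \<epsilon>(1) by (simp add: ennreal_of_nat_eq_real_of_nat ennreal_mult[symmetric] del: of_nat_Suc)
      then have "real ?n \<le> measure D U / \<epsilon>" using \<epsilon>(1) by (simp add: field_simps)
      then show False by linarith
    qed
    then have "closedin ?S (U - {\<nu>})"
      using Hd U_sub top by (intro closedin_Hausdorff_finite) auto
    then have "openin ?S (U - (U - {\<nu>}))" using U(1) by (rule openin_diff[rotated])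
    moreover have "U - (U - {\<nu>}) = {\<nu>}" using U(2) by auto
    ultimately show ?thesis by simp
  qed
  then show ?thesis
    by (subst eq_commute, subst discrete_topology_unique) (simp add: top del: topspace_subtopology)
qed

end

section \<open>The characterisation of total Riesz families\<close>

theorem theorem5p7:
  fixes G :: "('a, 'm) monoid_scheme" and T :: "'a topology"
    and M :: "'a measure" and M' :: "('a \<Rightarrow> complex) measure"
    and \<Delta> :: "('a \<times> ('a \<Rightarrow> complex)) set"
    and D :: "('a \<times> ('a \<Rightarrow> complex)) measure"
    and Q :: "('a \<times> ('a \<Rightarrow> complex)) set measure"
    and g :: "'a \<Rightarrow> complex"
  defines "P \<equiv> G \<times>\<times> dual_group G T"
    and "TP \<equiv> prod_topology T (dual_topology G T)"
  assumes "lca_group G T" and "second_countable T"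
    and "haar_measure G T M" and "dual_haar_measure G T M M'"
    and "subgroup \<Delta> P" and "closedin TP \<Delta>"
    and "haar_measure (P\<lparr>carrier := \<Delta>\<rparr>) (subtopology TP \<Delta>) D"
    and counting: "subtopology TP \<Delta> = discrete_topology \<Delta> \<Longrightarrow> D = count_space \<Delta>"
    and "quotient_haar_measure P TP \<Delta> (M \<Otimes>\<^sub>M M') D Q"
    and "g \<in> L2_space M"
  shows "gabor_total_riesz_family G M D g \<longleftrightarrow>
           uniform_lattice P TP \<Delta> \<and> subgroup_size Q = 1 \<and> gabor_frame G M D g"
proof -
  interpret lca_group G T by fact
  interpret S: gabor_setting G T M M' by unfold_locales (fact assms)+
  have size: "subgroup_size Q = emeasure Q (space Q)" by (simp add: subgroup_size_def)
  note \<Delta> = \<open>subgroup \<Delta> P\<close>[unfolded P_def]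
  show ?thesis
  proof
    assume R: "gabor_total_riesz_family G M D g"
    have discrete: "subtopology TP \<Delta> = discrete_topology \<Delta>"
      using S.total_riesz_imp_discrete[of \<Delta> D g] R assms unfolding P_def TP_def by blast
    then have D: "D = count_space \<Delta>" by (rule counting)
    have frame: "gabor_frame G M D g" using R by (simp add: gabor_total_riesz_family_def)
    interpret F: discrete_gabor_frame G T M M' \<Delta> g
      using \<Delta> \<open>g \<in> L2_space M\<close> frame
      by (intro discrete_gabor_frame.intro discrete_gabor_frame_axioms.intro S.gabor_setting_axioms)
        (simp_all add: D)
    have "complex_of_real (measure Q (space Q)) = 1"
      using F.L2_inner_dual_window[of Q] F.inner_eq_one_if_total_riesz R
        \<open>quotient_haar_measure P TP \<Delta> (M \<Otimes>\<^sub>M M') D Q\<close> by (simp add: D P_def TP_def)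
    then have "measure Q (space Q) = 1" by (simp only: of_real_eq_1_iff)
    then have one: "emeasure Q (space Q) = 1"
      by (metis emeasure_eq_ennreal_measure ennreal_1 measure_eq_emeasure_eq_ennreal measure_zero_top zero_neq_one)
    interpret Quot: topological_comm_group "P Mod \<Delta>" "quotient_topology P TP \<Delta>"
      unfolding P_def TP_def using \<Delta> by (rule S.P.topological_comm_group_quotient)
    have "compact_space (quotient_topology P TP \<Delta>)"
    proof (rule Quot.compact_space_if_finite_haar_measure)
      show "haar_measure (P Mod \<Delta>) (quotient_topology P TP \<Delta>) Q"
        using \<open>quotient_haar_measure P TP \<Delta> (M \<Otimes>\<^sub>M M') D Q\<close> by (simp add: quotient_haar_measure_def)
    qed (simp add: one)
    with \<open>subgroup \<Delta> P\<close> discrete have "uniform_lattice P TP \<Delta>" by (simp add: uniform_lattice_def)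
    with one frame show "uniform_lattice P TP \<Delta> \<and> subgroup_size Q = 1 \<and> gabor_frame G M D g"
      by (simp add: size)
  next
    assume U: "uniform_lattice P TP \<Delta> \<and> subgroup_size Q = 1 \<and> gabor_frame G M D g"
    then have D: "D = count_space \<Delta>" by (intro counting) (simp add: uniform_lattice_def)
    interpret F: discrete_gabor_frame G T M M' \<Delta> g
      using \<Delta> \<open>g \<in> L2_space M\<close> U
      by (intro discrete_gabor_frame.intro discrete_gabor_frame_axioms.intro S.gabor_setting_axioms)
        (simp_all add: D)
    have "measure Q (space Q) = 1" using U by (simp add: size measure_def)
    then have "L2_inner M F.dual_window g = 1"
      using F.L2_inner_dual_window[of Q] \<open>quotient_haar_measure P TP \<Delta> (M \<Otimes>\<^sub>M M') D Q\<close>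
      by (simp add: D P_def TP_def)
    then show "gabor_total_riesz_family G M D g" unfolding D by (rule F.total_riesz_if_inner_eq_one)
  qed
qed

end
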